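(* Let $a,b\ge1$ be integers, and let $U$ and $U'$ be the $\mathbb Z\times\mathbb Z$ matrices $$U=q^{\Delta^2/2a}\,\Gamma_-\Gamma_+P_1^{\Delta}\Gamma_-\Gamma_+\cdots P_{a-1}^{\Delta}\Gamma_-\Gamma_+\;Q^{\Delta}\;\Gamma_-\Gamma_+R_{b-1}^{\Delta}\Gamma_-\Gamma_+\cdots R_1^{\Delta}\Gamma_-\Gamma_+\,q^{\Delta^2/2b},$$ $$U'=q^{\Delta^2/2a}\,\Gamma_-\Gamma_+P_1^{\Delta}\Gamma_-\Gamma_+\cdots P_{a-1}^{\Delta}\Gamma_-\Gamma_+\;Q^{\Delta}\;\Gamma'_-\Gamma'_+R_{b-1}^{\Delta}\Gamma'_-\Gamma'_+\cdots R_1^{\Delta}\Gamma'_-\Gamma'_+\,q^{-\Delta^2/2b},$$ with $\Gamma_\pm=\Gamma_\pm(q^{-\rho})$, $\Gamma'_\pm=\Gamma'_\pm(q^{-\rho})$ (notation in the context). These are the generating matrices of the first and the second orbifold melting crystal model, respectively. (i) $U$ determines a special solution $(L,\bar L)$ of the 2D Toda hierarchy for which, at all times $(\boldsymbol t,\bar{\boldsymbol t})$, the Lax operators have the factorized form $$L^a=D^{-1}\bar L^{-b}=BC,$$ where $D$ is a non-zero constant and $$B=\Lambda^a+\beta_1\Lambda^{a-1}+\cdots+\beta_a,\qquad C=1+\gamma_1\Lambda^{-1}+\cdots+\gamma_b\Lambda^{-b}$$ with $\beta_i,\gamma_j$ diagonal matrices (depending on $\boldsymbol t,\bar{\boldsymbol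 t}$). Thus the first orbifold model corresponds to a special solution of the bi-graded Toda hierarchy of bi-degree $(a,b)$. (ii) $U'$ determines a special solution $(L,\bar L)$ of the 2D Toda hierarchy for which, at all times $(\boldsymbol t,\bar{\boldsymbol t})$, the Lax operators have the factorized form $$L^a=BC^{-1},\qquad \bar L^{-b}=D\,CB^{-1},$$ where $D$ is a non-zero constant and $B,C$ are matrices of the same form as in (i). Thus the second orbifold model corresponds to a special solution of the rational reduction of bi-degree $(a,b)$ of the 2D Toda hierarchy.
   Context: Matrices: $\Delta=\sum_{n\in\mathbb Z}nE_{nn}$, $\Lambda=\sum_{n\in\mathbb Z}E_{n,n+1}$, where $E_{mn}=(\delta_{im}\delta_{jn})_{i,j\in\mathbb Z}$; $u^\Delta=\sum_nu^nE_{nn}$, $q^{c\Delta^2}=\sum_nq^{cn^2}E_{nn}$. Further $$\Gamma_\pm(q^{-\rho})=\prod_{i\ge1}(1-q^{i-1/2}\Lambda^{\pm1})^{-1},\qquad \Gamma'_\pm(q^{-\rho})=\prod_{i\ge1}(1+q^{i-1/2}\Lambda^{\pm1}),$$ expanded as power series in $\Lambda^{\pm1}$. $q,Q,P_1,\dots,P_{a-1},R_1,\dots,R_{b-1}$ are nonzero parameters (a branch of $\log q$ is fixed), such that the matrix products converge: with $Q^{(1)}=1$, $Q^{(i)}=P_1\cdots P_{i-1}$ ($2\le i\le a$), $Q^{(a+1)}=P_1\cdots P_{a-1}Q$, $Q^{(a+j)}=Q^{(a+1)}R_{b-1}\cdots R_{b-j+1}$ ($2\le j\le b$), it suffices e.g.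 that $0<|q|<1$ and $|Q^{(k)}/Q^{(l)}|<|q|^{-1}$ for all $k,l$. Solution of the 2D Toda hierarchy determined by a matrix $U$: one considers the factorization problem $$\exp\Big(\sum_{k\ge1}t_k\Lambda^k\Big)U\exp\Big(-\sum_{k\ge1}\bar t_k\Lambda^{-k}\Big)=W^{-1}\bar W,$$ where $W=1+w_1\Lambda^{-1}+w_2\Lambda^{-2}+\cdots$ and $\bar W=\bar w_0+\bar w_1\Lambda+\bar w_2\Lambda^2+\cdots$ with $w_n,\bar w_n$ diagonal matrices depending on $(\boldsymbol t,\bar{\boldsymbol t})$ and $\bar w_0$ invertible. The Lax operators are $L=W\Lambda W^{-1}$ and $\bar L^{-1}=\bar W\Lambda^{-1}\bar W^{-1}$. They satisfy the Lax equations $\partial L/\partial t_k=[B_k,L]$, $\partial L/\partial\bar t_k=[\bar B_k,L]$, $\partial\bar L^{-1}/\partial t_k=[B_k,\bar L^{-1}]$, $\partial\bar L^{-1}/\partial\bar t_k=[\bar B_k,\bar L^{-1}]$, with $B_k=(L^k)_{\ge0}$ (upper triangular part, diagonal included) and $\bar B_k=(\bar L^{-k})_{<0}$ (strictly lower triangular part). Time dependence is understood formally (power series in $\boldsymbol t,\bar{\boldsymbol t}$ around $\boldsymbol t=\bar{\boldsymbol t}=\boldsymbol 0$). The bi-graded Toda hierarchy of bi-degree $(a,b)$ is the reduction of the 2D Toda hierarchy defined by $L^a=D^{-1}\bar L^{-b}$, $D$ a non-zero constant. The rational reduction of bi-degree $(a,b)$ is the reduction defined by $L^a=BC^{-1}$,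 $\bar L^{-b}=DCB^{-1}$, where $D$ is a non-zero constant, $B=\Lambda^a+\beta_1\Lambda^{a-1}+\cdots+\beta_a$ and $C=1+\gamma_1\Lambda^{-1}+\cdots+\gamma_b\Lambda^{-b}$ with $\beta_i,\gamma_j$ diagonal matrices; here $B^{-1}=\beta_a^{-1}-\beta_{a-1}\beta_a^{-1}\Lambda\beta_a^{-1}+\cdots$ is a power series in $\Lambda$ and $C^{-1}=1-\gamma_1\Lambda^{-1}+\cdots$ is a power series in $\Lambda^{-1}$.
   Formalization: The product W^{-1}Wbar diverges at higher orders in the times, so the factorization is literal only at t=tbar=0; at formal times it is stated as (exp(xi)U exp(-xibar))Wbar^{-1}=W^{-1} and W exp(xi)U=Wbar exp(xibar). *)

theory Defs
  imports
    "HOL-Analysis.Analysis"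
    "HOL-Library.Multiset"
    "HOL-Computational_Algebra.Formal_Power_Series"
begin

section \<open>Matrices indexed by the integers\<close>

type_synonym cmat = "int \<Rightarrow> int \<Rightarrow> complex"

definition mconv :: "cmat \<Rightarrow> cmat \<Rightarrow> bool" where
  "mconv A B \<longleftrightarrow> (\<forall>i j. (\<lambda>k. A i k * B k j) summable_on UNIV)"

text \<open>The product is meaningful only when \<^const>\<open>mconv\<close> holds; for complex-valued families
  summability is absolute summability.\<close>

definition mmul :: "cmat \<Rightarrow> cmat \<Rightarrow> cmat" where
  "mmul A B = (\<lambda>i j. \<Sum>\<^sub>\<infinity>k. A i k * B k j)"

definition mdiag :: "(int \<Rightarrow> complex) \<Rightarrow> cmat" where
  "mdiag d = (\<lambda>i j. if i = j then d i else 0)"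

text \<open>\<open>\<Lambda>\<^sup>n\<close> for an integer \<open>n\<close>; \<open>Lam 0\<close> is the unit matrix.\<close>

definition Lam :: "int \<Rightarrow> cmat" where
  "Lam n = (\<lambda>i j. of_bool (j = i + n))"

primrec mprod :: "cmat list \<Rightarrow> cmat" where
  "mprod [] = Lam 0"
| "mprod (A # As) = mmul A (mprod As)"

definition pow_Delta :: "complex \<Rightarrow> cmat" where
  "pow_Delta u = mdiag (\<lambda>n. u powi n)"

text \<open>Below, \<open>lq\<close> is the chosen branch of \<open>log q\<close>, so that \<open>q\<^sup>c\<close> means \<open>exp (c * lq)\<close>.\<close>

definition qpow_Delta_sq :: "complex \<Rightarrow> complex \<Rightarrow> cmat" where
  "qpow_Delta_sq lq c = mdiag (\<lambda>n. exp (c * (of_int n)\<^sup>2 * lq))"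

text \<open>The power series \<open>\<Prod>i\<ge>1. (1 - q^(i-1/2) X)^(-1)\<close> and \<open>\<Prod>i\<ge>1. (1 + q^(i-1/2) X)\<close>. The infinite
  products converge coefficientwise in the topology of the complex numbers, and not in the
  \<open>X\<close>-adic topology that the library puts on \<^typ>\<open>complex fps\<close>.\<close>

definition Gam_ser :: "complex \<Rightarrow> complex fps" where
  "Gam_ser lq = Abs_fps (\<lambda>n. lim (\<lambda>N. fps_nth
     (\<Prod>i=1..N. inverse (1 - fps_const (exp ((of_nat i - 1/2) * lq)) * fps_X)) n))"

definition Gam'_ser :: "complex \<Rightarrow> complex fps" where
  "Gam'_ser lq = Abs_fps (\<lambda>n. lim (\<lambda>N. fps_nth
     (\<Prod>i=1..N. 1 + fps_const (exp ((of_nat i - 1/2) * lq)) * fps_X) n))"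

text \<open>\<open>f(\<Lambda>)\<close> and \<open>f(\<Lambda>^(-1))\<close>.\<close>

definition ser_up :: "complex fps \<Rightarrow> cmat" where
  "ser_up f = (\<lambda>i j. if i \<le> j then fps_nth f (nat (j - i)) else 0)"

definition ser_down :: "complex fps \<Rightarrow> cmat" where
  "ser_down f = (\<lambda>i j. if j \<le> i then fps_nth f (nat (i - j)) else 0)"


section \<open>Generating matrices of the orbifold melting crystal models\<close>

definition U_first ::
  "nat \<Rightarrow> nat \<Rightarrow> complex \<Rightarrow> (nat \<Rightarrow> complex) \<Rightarrow> complex \<Rightarrow> (nat \<Rightarrow> complex) \<Rightarrow> cmat" where
  "U_first a b lq P Q R =
    (let G = [ser_down (Gam_ser lq), ser_up (Gam_ser lq)] in
     mprod ([qpow_Delta_sq lq (1 / (2 * of_nat a))] @ G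
       @ concat (map (\<lambda>i. pow_Delta (P i) # G) [1..<a])
       @ (pow_Delta Q # G)
       @ concat (map (\<lambda>j. pow_Delta (R j) # G) (rev [1..<b]))
       @ [qpow_Delta_sq lq (1 / (2 * of_nat b))]))"

definition U_second ::
  "nat \<Rightarrow> nat \<Rightarrow> complex \<Rightarrow> (nat \<Rightarrow> complex) \<Rightarrow> complex \<Rightarrow> (nat \<Rightarrow> complex) \<Rightarrow> cmat" where
  "U_second a b lq P Q R =
    (let G = [ser_down (Gam_ser lq), ser_up (Gam_ser lq)];
         G' = [ser_down (Gam'_ser lq), ser_up (Gam'_ser lq)] in
     mprod ([qpow_Delta_sq lq (1 / (2 * of_nat a))] @ G
       @ concat (map (\<lambda>i. pow_Delta (P i) # G) [1..<a])
       @ (pow_Delta Q # G')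
       @ concat (map (\<lambda>j. pow_Delta (R j) # G') (rev [1..<b]))
       @ [qpow_Delta_sq lq (- 1 / (2 * of_nat b))]))"

text \<open>The accumulated parameters \<open>Q\<^sup>(\<^sup>k\<^sup>)\<close>, \<open>1 \<le> k \<le> a + b\<close>. For \<open>k = a + j\<close> the last product runs over
  \<open>R\<close> with indices from \<open>b - j + 1\<close> to \<open>b - 1\<close>. For \<open>0 < |q| < 1\<close>, all the matrix products involved converge if
  \<open>|Q\<^sup>(\<^sup>k\<^sup>) / Q\<^sup>(\<^sup>l\<^sup>)| < |q|^(-1)\<close> for all \<open>k\<close>, \<open>l\<close>.\<close>

definition Qacc ::
  "nat \<Rightarrow> nat \<Rightarrow> (nat \<Rightarrow> complex) \<Rightarrow> complex \<Rightarrow> (nat \<Rightarrow> complex) \<Rightarrow> nat \<Rightarrow> complex" where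
  "Qacc a b P Q R k =
    (if k \<le> a then \<Prod>i\<in>{1..<k}. P i
     else (\<Prod>i\<in>{1..<a}. P i) * Q * (\<Prod>i\<in>{b - (k - a) + 1..<b}. R i))"


section \<open>Formal power series in the times with matrix coefficients\<close>

text \<open>\<open>Tpos k\<close> stands for \<open>t\<close> with index \<open>k + 1\<close>, \<open>Tneg k\<close> for \<open>tbar\<close> with index
  \<open>k + 1\<close>. A multiset of times is a monomial, and \<open>A m\<close> is the coefficient of the monomial \<open>m\<close> (without factorials).\<close>

datatype time = Tpos nat | Tneg nat

type_synonym tmat = "time multiset \<Rightarrow> cmat"

definition tconst :: "cmat \<Rightarrow> tmat" where
  "tconst A = (\<lambda>m i j. if m = {#} then A i j else 0)"

abbreviation tLam :: "int \<Rightarrow> tmat" where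
  "tLam n \<equiv> tconst (Lam n)"

abbreviation tone :: tmat where
  "tone \<equiv> tLam 0"

definition tdiag :: "(time multiset \<Rightarrow> int \<Rightarrow> complex) \<Rightarrow> tmat" where
  "tdiag d = (\<lambda>m. mdiag (d m))"

definition tconv :: "tmat \<Rightarrow> tmat \<Rightarrow> bool" where
  "tconv A B \<longleftrightarrow> (\<forall>p r. mconv (A p) (B r))"

definition tmul :: "tmat \<Rightarrow> tmat \<Rightarrow> tmat" where
  "tmul A B = (\<lambda>m i j. \<Sum>p | p \<subseteq># m. mmul (A p) (B (m - p)) i j)"

primrec tpow :: "tmat \<Rightarrow> nat \<Rightarrow> tmat" where
  "tpow A 0 = tone"
| "tpow A (Suc n) = tmul A (tpow A n)"

definition tscale :: "complex \<Rightarrow> tmat \<Rightarrow> tmat" where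
  "tscale c A = (\<lambda>m i j. c * A m i j)"

definition tcomm :: "tmat \<Rightarrow> tmat \<Rightarrow> tmat" where
  "tcomm A B = (\<lambda>m i j. tmul A B m i j - tmul B A m i j)"

definition tderiv :: "time \<Rightarrow> tmat \<Rightarrow> tmat" where
  "tderiv v A = (\<lambda>m i j. of_nat (Suc (count m v)) * A (add_mset v m) i j)"

definition upper_part :: "tmat \<Rightarrow> tmat" where
  "upper_part A = (\<lambda>m i j. if i \<le> j then A m i j else 0)"

definition strict_lower_part :: "tmat \<Rightarrow> tmat" where
  "strict_lower_part A = (\<lambda>m i j. if j < i then A m i j else 0)"

text \<open>Used for series without constant term only, where each coefficient of the exponential
  series is a finite sum.\<close>

definition texp :: "tmat \<Rightarrow> tmat" where
  "texp X = (\<lambda>m i j. \<Sum>n. tpow X n m i j / fact n)"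

text \<open>\<open>\<Sum>k\<ge>1. t\<^sub>k \<Lambda>\<^sup>k\<close> and \<open>\<Sum>k\<ge>1. tbar\<^sub>k \<Lambda>^(-k)\<close>.\<close>

definition xi :: tmat where
  "xi = (\<lambda>m i j. of_bool (\<exists>k. m = {#Tpos k#} \<and> j = i + int (Suc k)))"

definition xibar :: tmat where
  "xibar = (\<lambda>m i j. of_bool (\<exists>k. m = {#Tneg k#} \<and> j = i - int (Suc k)))"


section \<open>The 2D Toda hierarchy\<close>

definition is_lower :: "tmat \<Rightarrow> bool" where
  "is_lower A \<longleftrightarrow> (\<forall>m i j. i < j \<longrightarrow> A m i j = 0)"

definition is_upper :: "tmat \<Rightarrow> bool" where
  "is_upper A \<longleftrightarrow> (\<forall>m i j. j < i \<longrightarrow> A m i j = 0)"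

text \<open>Among lower triangular matrices a two-sided inverse is unique; so it is among upper
  triangular ones. All sums in these products are finite.\<close>

definition lower_inverse :: "tmat \<Rightarrow> tmat \<Rightarrow> bool" where
  "lower_inverse A X \<longleftrightarrow> is_lower X \<and> tmul A X = tone \<and> tmul X A = tone"

definition upper_inverse :: "tmat \<Rightarrow> tmat \<Rightarrow> bool" where
  "upper_inverse A X \<longleftrightarrow> is_upper X \<and> tmul A X = tone \<and> tmul X A = tone"

text \<open>\<open>W = 1 + w\<^sub>1 \<Lambda>^(-1) + \<cdots>\<close>.\<close>

definition dressing_W :: "tmat \<Rightarrow> bool" where
  "dressing_W W \<longleftrightarrow> is_lower W \<and> (\<forall>m i. W m i i = tone m i i)"

text \<open>A formal power series is invertible iff its constant term is nonzero.\<close>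

definition dressing_Wbar :: "tmat \<Rightarrow> bool" where
  "dressing_Wbar Wb \<longleftrightarrow> is_upper Wb \<and> (\<forall>i. Wb {#} i i \<noteq> 0)"

text \<open>The factorization \<open>exp(\<xi>) U exp(-\<xi>bar) = W\<inverse> Wbar\<close>, where \<open>Wi\<close>, \<open>Wbi\<close> are the inverses of
  \<open>W\<close>, \<open>Wbar\<close>. The product \<open>W\<inverse> Wbar\<close> of a lower by an upper triangular matrix is an infinite sum. At
  time zero the factorization is required literally. For the matrices \<open>U\<close> of interest, however, the
  coefficients of \<open>W\<inverse> Wbar\<close> at higher monomials in the times diverge in general. Hence at arbitrary times the
  factorization is required in the two arrangements in which the infinite sums converge:
  with \<open>Wbar\<close> moved to the other side, and as the relation
  \<open>(W exp \<xi>) U = Wbar exp \<xi>bar\<close> between the wave matrices.\<close>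

definition toda_factorization :: "cmat \<Rightarrow> tmat \<Rightarrow> tmat \<Rightarrow> tmat \<Rightarrow> tmat \<Rightarrow> bool" where
  "toda_factorization U W Wi Wb Wbi \<longleftrightarrow>
     dressing_W W \<and> lower_inverse W Wi \<and> dressing_Wbar Wb \<and> upper_inverse Wb Wbi \<and>
     (mconv (Wi {#}) (Wb {#}) \<and> mmul (Wi {#}) (Wb {#}) = U) \<and>
     (let V = tmul (tmul (texp xi) (tconst U)) (texp (tscale (- 1) xibar)) in
        tconv V Wbi \<and> tmul V Wbi = Wi) \<and>
     (tconv (tmul W (texp xi)) (tconst U) \<and>
        tmul (tmul W (texp xi)) (tconst U) = tmul Wb (texp xibar))"

text \<open>Throughout, \<open>Li\<close> is the Lax operator \<open>Lbar^(-1)\<close>, so that \<open>Lbar^(-k)\<close> is the \<open>k\<close>-th power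
  of \<open>Li\<close>.\<close>

definition toda_lax :: "tmat \<Rightarrow> tmat \<Rightarrow> bool" where
  "toda_lax L Li \<longleftrightarrow> (\<forall>k.
     (let Bk = upper_part (tpow L (Suc k)); Bbark = strict_lower_part (tpow Li (Suc k)) in
      tderiv (Tpos k) L = tcomm Bk L \<and> tderiv (Tneg k) L = tcomm Bbark L \<and>
      tderiv (Tpos k) Li = tcomm Bk Li \<and> tderiv (Tneg k) Li = tcomm Bbark Li))"

definition toda_solution_from :: "cmat \<Rightarrow> tmat \<Rightarrow> tmat \<Rightarrow> bool" where
  "toda_solution_from U L Li \<longleftrightarrow>
     (\<exists>W Wi Wb Wbi. toda_factorization U W Wi Wb Wbi \<and>
        L = tmul (tmul W (tLam 1)) Wi \<and> Li = tmul (tmul Wb (tLam (- 1))) Wbi) \<and>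
     toda_lax L Li"

text \<open>\<open>B = \<Lambda>\<^sup>a + \<beta>\<^sub>1 \<Lambda>^(a-1) + \<cdots> + \<beta>\<^sub>a\<close> and \<open>C = 1 + \<gamma>\<^sub>1 \<Lambda>^(-1) + \<cdots> + \<gamma>\<^sub>b \<Lambda>^(-b)\<close>, the coefficients depending on
  the times.\<close>

definition B_form :: "nat \<Rightarrow> tmat \<Rightarrow> bool" where
  "B_form a B \<longleftrightarrow> (\<exists>\<beta>. B = (\<lambda>m i j. tLam (int a) m i j +
      (\<Sum>s=1..a. tmul (tdiag (\<beta> s)) (tLam (int a - int s)) m i j)))"

definition C_form :: "nat \<Rightarrow> tmat \<Rightarrow> bool" where
  "C_form b C \<longleftrightarrow> (\<exists>\<gamma>. C = (\<lambda>m i j. tone m i j +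
      (\<Sum>s=1..b. tmul (tdiag (\<gamma> s)) (tLam (- int s)) m i j)))"

end

theory Submission
  imports Defs "HOL-Library.Function_Algebras"
begin

text \<open>Write \<open>x\<^sub>k\<close> for \<open>Q\<^sup>(\<^sup>k\<^sup>)\<close>. Moving all powers \<open>u\<^sup>\<Delta>\<close> to the right turns the Gamma factors into commuting
  Laurent series in \<open>\<Lambda>\<close>, all absolutely convergent on a common circle; hence at time zero
  \<open>U = W\<^sub>0\<^sup>-\<^sup>1 V\<^sub>0\<close> with \<open>W\<^sub>0\<^sup>-\<^sup>1\<close> and \<open>V\<^sub>0\<close> conjugates by Gaussian factors of products of the series in \<open>x\<^sub>k \<Lambda>\<^sup>-\<^sup>1\<close>
  and \<open>\<Lambda> / x\<^sub>k\<close>. The functional equations of the series under \<open>X \<mapsto> q X\<close> produce band matrices \<open>B\<^sub>0\<close> and \<open>C\<^sub>0\<close>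
  that factorize the initial Lax operators.

  At arbitrary times put \<open>W = G W\<^sub>0 exp(-\<xi>)\<close> and \<open>V = G V\<^sub>0 exp(-\<xi>bar)\<close>, where \<open>G\<close> is a power series in the
  times whose coefficients are band matrices, determined monomial by monomial by the triangularity of \<open>W\<close>
  and \<open>V\<close>. Since \<open>G\<close> is banded, every infinite sum reduces to one at time zero, and \<open>\<partial>G G\<^sup>-\<^sup>1\<close> yields the
  Lax equations. Starting a second solution, with series \<open>G'\<close>, from initial data shifted by \<open>B\<^sub>0\<close> and \<open>C\<^sub>0\<close>
  gives the factors at all times: \<open>B = G B\<^sub>0 G'\<^sup>-\<^sup>1\<close>, and \<open>C\<close> is \<open>G' C\<^sub>0 G\<^sup>-\<^sup>1\<close> in the bi-graded and \<open>G C\<^sub>0 G'\<^sup>-\<^sup>1\<close> in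
  the rational case.\<close>

section \<open>Matrices with one-sided support\<close>

text \<open>The Gaussian factors are the reason why finite bands appear. Translating the index by
  \<open>a\<close> changes \<open>q^(n^2/2a)\<close> only by a constant and by \<open>q^n\<close>,
  so conjugating \<open>\<Lambda>^a\<close> by this factor leaves \<open>\<Lambda>^a\<close> times a
  power \<open>q^\<Delta>\<close>, up to a constant, and moving that through a series in \<Lambda>
  dilates its argument by \<open>q\<close> or its inverse. One vertex series changes under this
  dilation by a single linear factor; the \<open>a\<close> series of the first group thus produce a
  polynomial of degree \<open>a\<close>, the \<open>b\<close> series of the second group one of
  degree \<open>b\<close>. The primed series carry the linear factor on the other side of the
  functional equation, and their Gaussian has the opposite sign: therefore \<open>C\<close>
  multiplies in the first model and divides in the second. The main obstacle is that products of
  bilateral matrices need neither converge nor associate. Hence \<open>W\<close> and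
  \<open>Wbar\<close> at later times are not sought by factorizing an evolved \<open>U\<close>; the
  unknown is their common left factor.\<close>

lemma sum_fun_apply: "sum f S x = (\<Sum>a\<in>S. f a x)"
  by (induction S rule: infinite_finite_induct) auto

lemma summable_on_finite_sum:
  fixes f :: "'a \<Rightarrow> 'b \<Rightarrow> complex"
  assumes "\<And>x. x \<in> S \<Longrightarrow> f x summable_on T"
  shows "(\<lambda>k. \<Sum>x\<in>S. f x k) summable_on T"
  using assms by (induction S rule: infinite_finite_induct) (auto intro: summable_on_add)

lemma infsum_finite_sum:
  fixes f :: "'a \<Rightarrow> 'b \<Rightarrow> complex"
  assumes "\<And>x. x \<in> S \<Longrightarrow> f x summable_on T"
  shows "(\<Sum>\<^sub>\<infinity>k\<in>T. \<Sum>x\<in>S. f x k) = (\<Sum>x\<in>S. \<Sum>\<^sub>\<infinity>k\<in>T. f x k)"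
  using assms
  by (induction S rule: infinite_finite_induct)
     (auto simp: infsum_add summable_on_finite_sum)

text \<open>The sign \<open>s\<close> lets one proof serve both triangular types: \<open>s = 1\<close> bounds the support from above
  (lower triangular type), \<open>s = -1\<close> from below.\<close>

definition supp_le :: "int \<Rightarrow> int \<Rightarrow> cmat \<Rightarrow> bool" where
  "supp_le s N A \<longleftrightarrow> (\<forall>i j. N < s * (j - i) \<longrightarrow> A i j = 0)"

definition one_sided :: "int \<Rightarrow> cmat \<Rightarrow> bool" where
  "one_sided s A \<longleftrightarrow> (\<exists>N. supp_le s N A)"

definition row_finite :: "cmat \<Rightarrow> bool" where
  "row_finite A \<longleftrightarrow> (\<forall>i. finite {k. A i k \<noteq> 0})"

definition col_finite :: "cmat \<Rightarrow> bool" where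
  "col_finite A \<longleftrightarrow> (\<forall>j. finite {k. A k j \<noteq> 0})"

definition banded :: "cmat \<Rightarrow> bool" where
  "banded A \<longleftrightarrow> one_sided 1 A \<and> one_sided (-1) A"

abbreviation sgn1 :: "int \<Rightarrow> bool" where
  "sgn1 s \<equiv> \<bar>s\<bar> = 1"

lemma supp_leD: "supp_le s N A \<Longrightarrow> N < s * (j - i) \<Longrightarrow> A i j = 0"
  by (simp add: supp_le_def)

lemma supp_le_mono: "supp_le s N A \<Longrightarrow> N \<le> M \<Longrightarrow> supp_le s M A"
  by (auto simp: supp_le_def)

lemma supp_le_one_sided: "supp_le s N A \<Longrightarrow> one_sided s A"
  by (auto simp: one_sided_def)

lemma supp_le_sgn_cases:
  assumes "sgn1 s" shows "s = 1 \<or> s = -1"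
  using assms by auto

lemma banded_row_finite:
  assumes "banded A" shows "row_finite A"
proof -
  obtain N M where N: "supp_le 1 N A" and M: "supp_le (-1) M A"
    using assms by (auto simp: banded_def one_sided_def)
  have "{k. A i k \<noteq> 0} \<subseteq> {i - M..i + N}" for i
    using supp_leD[OF N, of _ i] supp_leD[OF M, of _ i] by (force simp: not_less)
  thus ?thesis unfolding row_finite_def by (meson finite_atLeastAtMost_int finite_subset)
qed

lemma banded_col_finite:
  assumes "banded A" shows "col_finite A"
proof -
  obtain N M where N: "supp_le 1 N A" and M: "supp_le (-1) M A"
    using assms by (auto simp: banded_def one_sided_def)
  have "{k. A k j \<noteq> 0} \<subseteq> {j - N..j + M}" for j
    using supp_leD[OF N, of j] supp_leD[OF M, of j] by (force simp: not_less)
  thus ?thesis unfolding col_finite_def by (meson finite_atLeastAtMost_int finite_subset)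
qed

section \<open>Convergence of matrix products\<close>

lemma mconv_finite:
  assumes "\<And>i j. finite {k. A i k * B k j \<noteq> 0}"
  shows "mconv A B"
  unfolding mconv_def using assms
  by (auto intro!: finite_nonzero_values_imp_summable_on)

lemma mconv_row_finite: "row_finite A \<Longrightarrow> mconv A B"
  by (intro mconv_finite) (auto simp: row_finite_def elim!: finite_subset[rotated])

lemma mconv_col_finite: "col_finite B \<Longrightarrow> mconv A B"
  by (intro mconv_finite) (auto simp: col_finite_def elim!: finite_subset[rotated])

lemma mconv_one_sided:
  assumes s: "sgn1 s" and "one_sided s A" "one_sided s B"
  shows "mconv A B"
proof (rule mconv_finite)
  fix i j
  obtain N M where N: "supp_le s N A" and M: "supp_le s M B"
    using assms by (auto simp: one_sided_def)
  let ?K = "\<bar>i\<bar> + \<bar>j\<bar> + \<bar>N\<bar> + \<bar>M\<bar>"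
  have "{k. A i k * B k j \<noteq> 0} \<subseteq> {-?K..?K}"
  proof
    fix k assume "k \<in> {k. A i k * B k j \<noteq> 0}"
    hence "s * (k - i) \<le> N" "s * (j - k) \<le> M"
      using supp_leD[OF N, of k i] supp_leD[OF M, of j k] by force+
    thus "k \<in> {-?K..?K}" using supp_le_sgn_cases[OF s] by auto
  qed
  thus "finite {k. A i k * B k j \<noteq> 0}" by (rule finite_subset) simp
qed

text \<open>Every single summand of an entry beyond the sum of the two bounds vanishes, so the
  bounds add without any appeal to convergence.\<close>

lemma supp_le_mmul:
  assumes "supp_le s N A" "supp_le s M B"
  shows "supp_le s (N + M) (mmul A B)"
  unfolding supp_le_def
proof (intro allI impI)
  fix i j assume *: "N + M < s * (j - i)"
  have "A i k * B k j = 0" for k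
  proof (cases "N < s * (k - i)")
    case False
    moreover have "s * (j - i) = s * (k - i) + s * (j - k)" by (simp add: algebra_simps)
    ultimately have "M < s * (j - k)" using * by linarith
    thus ?thesis using supp_leD[OF assms(2)] by simp
  qed (use supp_leD[OF assms(1)] in simp)
  thus "mmul A B i j = 0" unfolding mmul_def by (intro infsum_0) blast
qed

lemma one_sided_mmul: "one_sided s A \<Longrightarrow> one_sided s B \<Longrightarrow> one_sided s (mmul A B)"
  unfolding one_sided_def using supp_le_mmul by blast

lemma supp_le_zero [simp]: "supp_le s N 0" by (simp add: supp_le_def)

lemma supp_le_uminus: "supp_le s N A \<Longrightarrow> supp_le s N (- A)"
  by (simp add: supp_le_def)

lemma supp_le_add: "supp_le s N A \<Longrightarrow> supp_le s N B \<Longrightarrow> supp_le s N (A + B)"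
  by (simp add: supp_le_def)

lemma supp_le_sum: "(\<And>x. x \<in> S \<Longrightarrow> supp_le s N (A x)) \<Longrightarrow> supp_le s N (\<Sum>x\<in>S. A x)"
  by (induction S rule: infinite_finite_induct) (auto intro: supp_le_add)

lemma one_sided_zero [simp]: "one_sided s 0"
  using supp_le_zero one_sided_def by blast

lemma one_sided_uminus: "one_sided s A \<Longrightarrow> one_sided s (- A)"
  unfolding one_sided_def using supp_le_uminus by blast

lemma one_sided_add: "one_sided s A \<Longrightarrow> one_sided s B \<Longrightarrow> one_sided s (A + B)"
  unfolding one_sided_def
  by (metis linorder_linear supp_le_add supp_le_mono)

lemma one_sided_scale: "one_sided s A \<Longrightarrow> one_sided s (\<lambda>i j. c * A i j)"
  by (auto simp: one_sided_def supp_le_def)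

lemma one_sided_sum: "(\<And>x. x \<in> S \<Longrightarrow> one_sided s (A x)) \<Longrightarrow> one_sided s (\<Sum>x\<in>S. A x)"
  by (induction S rule: infinite_finite_induct) (auto intro: one_sided_add)

lemma supp_le_Lam: "supp_le s (s * n) (Lam n)"
  by (auto simp: supp_le_def Lam_def)

lemma one_sided_Lam [simp]: "one_sided s (Lam n)"
  using supp_le_Lam one_sided_def by blast

lemma banded_Lam [simp]: "banded (Lam n)" by (simp add: banded_def)

lemma banded_one_sided: "banded A \<Longrightarrow> sgn1 s \<Longrightarrow> one_sided s A"
  by (auto simp: banded_def dest!: supp_le_sgn_cases)

lemma bandedI: "(\<And>s. sgn1 s \<Longrightarrow> one_sided s A) \<Longrightarrow> banded A"
  by (simp add: banded_def)

lemma mconv_banded_left: "banded A \<Longrightarrow> mconv A B"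
  by (simp add: banded_row_finite mconv_row_finite)

lemma mconv_banded_right: "banded B \<Longrightarrow> mconv A B"
  by (simp add: banded_col_finite mconv_col_finite)

section \<open>Shifts and linearity of the matrix product\<close>

lemma mmul_Lam_left [simp]: "mmul (Lam n) A = (\<lambda>i j. A (i + n) j)"
proof (intro ext)
  fix i j
  have "mmul (Lam n) A i j = infsum (\<lambda>k. Lam n i k * A k j) {i + n}"
    unfolding mmul_def by (rule infsum_cong_neutral) (auto simp: Lam_def)
  thus "mmul (Lam n) A i j = A (i + n) j" by (simp add: Lam_def)
qed

lemma mmul_Lam_right [simp]: "mmul A (Lam n) = (\<lambda>i j. A i (j - n))"
proof (intro ext)
  fix i j
  have "mmul A (Lam n) i j = infsum (\<lambda>k. A i k * Lam n k j) {j - n}"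
    unfolding mmul_def by (rule infsum_cong_neutral) (auto simp: Lam_def)
  thus "mmul A (Lam n) i j = A i (j - n)" by (simp add: Lam_def)
qed

lemma mmul_one_left: "mmul (Lam 0) A = A" by simp

lemma mmul_one_right: "mmul A (Lam 0) = A" by simp

lemma mmul_add_left:
  "mconv A C \<Longrightarrow> mconv B C \<Longrightarrow> mmul (A + B) C = mmul A C + mmul B C"
  by (auto simp: mmul_def mconv_def fun_eq_iff ring_distribs infsum_add)

lemma mmul_add_right:
  "mconv A B \<Longrightarrow> mconv A C \<Longrightarrow> mmul A (B + C) = mmul A B + mmul A C"
  by (auto simp: mmul_def mconv_def fun_eq_iff ring_distribs infsum_add)

lemma mmul_uminus_left: "mmul (- A) B = - mmul A B"
  by (simp add: mmul_def fun_eq_iff infsum_uminus)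

lemma mmul_uminus_right: "mmul A (- B) = - mmul A B"
  by (simp add: mmul_def fun_eq_iff infsum_uminus)

lemma mmul_zero_left [simp]: "mmul 0 B = 0" by (simp add: mmul_def fun_eq_iff)

lemma mmul_zero_right [simp]: "mmul A 0 = 0" by (simp add: mmul_def fun_eq_iff)

lemma mmul_scale_left: "mmul (\<lambda>i j. c * A i j) B = (\<lambda>i j. c * mmul A B i j)"
  by (simp add: mmul_def infsum_cmult_right' mult.assoc)

lemma mmul_scale_right: "mmul A (\<lambda>i j. c * B i j) = (\<lambda>i j. c * mmul A B i j)"
  by (simp add: mmul_def infsum_cmult_right' mult.left_commute)

lemma mconv_scale_left: "mconv A B \<Longrightarrow> mconv (\<lambda>i j. c * A i j) B"
  by (simp add: mconv_def mult.assoc summable_on_cmult_right)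

lemma mconv_scale_right: "mconv A B \<Longrightarrow> mconv A (\<lambda>i j. c * B i j)"
  by (simp add: mconv_def mult.left_commute[of _ c] summable_on_cmult_right)

lemma mconv_zero [simp]: "mconv 0 A" "mconv A 0"
  by (simp_all add: mconv_def)

lemma mconv_sum_left: "(\<And>x. x \<in> S \<Longrightarrow> mconv (A x) C) \<Longrightarrow> mconv (\<Sum>x\<in>S. A x) C"
  by (auto simp: mconv_def sum_fun_apply sum_distrib_right intro!: summable_on_finite_sum)

lemma mconv_sum_right: "(\<And>x. x \<in> S \<Longrightarrow> mconv C (A x)) \<Longrightarrow> mconv C (\<Sum>x\<in>S. A x)"
  by (auto simp: mconv_def sum_fun_apply sum_distrib_left intro!: summable_on_finite_sum)

lemma mmul_sum_left:
  "(\<And>x. x \<in> S \<Longrightarrow> mconv (A x) C) \<Longrightarrow> mmul (\<Sum>x\<in>S. A x) C = (\<Sum>x\<in>S. mmul (A x) C)"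
  by (auto simp: mconv_def mmul_def fun_eq_iff sum_fun_apply sum_distrib_right infsum_finite_sum)

lemma mmul_sum_right:
  "(\<And>x. x \<in> S \<Longrightarrow> mconv C (A x)) \<Longrightarrow> mmul C (\<Sum>x\<in>S. A x) = (\<Sum>x\<in>S. mmul C (A x))"
  by (auto simp: mconv_def mmul_def fun_eq_iff sum_fun_apply sum_distrib_left infsum_finite_sum)

text \<open>One bracketing of a bilateral product may converge while the other diverges or differs,
  so convergence of all intermediate products travels together with the associative law.\<close>

definition massoc :: "cmat \<Rightarrow> cmat \<Rightarrow> cmat \<Rightarrow> bool" where
  "massoc A B C \<longleftrightarrow> mconv A B \<and> mconv B C \<and> mconv (mmul A B) C \<and> mconv A (mmul B C) \<and>
     mmul (mmul A B) C = mmul A (mmul B C)"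

text \<open>A row-finite left factor makes the outer sum finite, and a finite sum may be exchanged
  with the convergent sum in \<open>mmul B C\<close>. This lets a band matrix be multiplied onto
  genuinely infinite products.\<close>

lemma massoc_row_finite:
  assumes A: "row_finite A" and BC: "mconv B C"
  shows "massoc A B C"
proof -
  define K where "K i = {k. A i k \<noteq> 0}" for i
  have fin: "finite (K i)" for i using A by (simp add: K_def row_finite_def)
  have mul: "mmul A X i j = (\<Sum>k\<in>K i. A i k * X k j)" for X i j
  proof -
    have "mmul A X i j = infsum (\<lambda>k. A i k * X k j) (K i)"
      unfolding mmul_def by (rule infsum_cong_neutral) (auto simp: K_def)
    thus ?thesis using fin by simp
  qed
  have sm: "(\<lambda>l. B k l * C l j) summable_on UNIV" for k j using BC by (simp add: mconv_def)
  have eq: "mmul A B i l * C l j = (\<Sum>k\<in>K i. A i k * (B k l * C l j))" for i l j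
    by (simp add: mul sum_distrib_right mult.assoc)
  have "mconv (mmul A B) C"
    unfolding mconv_def eq by (auto intro!: summable_on_finite_sum summable_on_cmult_right sm)
  moreover have "mmul (mmul A B) C i j = mmul A (mmul B C) i j" for i j
  proof -
    have "mmul (mmul A B) C i j = (\<Sum>\<^sub>\<infinity>l. \<Sum>k\<in>K i. A i k * (B k l * C l j))"
      by (simp add: mmul_def[of "mmul A B"] eq)
    also have "\<dots> = (\<Sum>k\<in>K i. \<Sum>\<^sub>\<infinity>l. A i k * (B k l * C l j))"
      by (rule infsum_finite_sum) (auto intro!: summable_on_cmult_right sm)
    also have "\<dots> = mmul A (mmul B C) i j"
      unfolding mul[of "mmul B C"] unfolding mmul_def[of B C] by (simp only: infsum_cmult_right')
    finally show ?thesis .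
  qed
  ultimately show ?thesis unfolding massoc_def
    using mconv_row_finite[OF A] BC by (simp add: fun_eq_iff)
qed

lemma massoc_col_finite:
  assumes C: "col_finite C" and AB: "mconv A B"
  shows "massoc A B C"
proof -
  define K where "K j = {k. C k j \<noteq> 0}" for j
  have fin: "finite (K i)" for i using C by (simp add: K_def col_finite_def)
  have mul: "mmul X C i j = (\<Sum>k\<in>K j. X i k * C k j)" for X i j
  proof -
    have "mmul X C i j = infsum (\<lambda>k. X i k * C k j) (K j)"
      unfolding mmul_def by (rule infsum_cong_neutral) (auto simp: K_def)
    thus ?thesis using fin by simp
  qed
  have sm: "(\<lambda>l. A k l * B l j) summable_on UNIV" for k j using AB by (simp add: mconv_def)
  have eq: "A i l * mmul B C l j = (\<Sum>k\<in>K j. (A i l * B l k) * C k j)" for i l j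
    by (simp add: mul sum_distrib_left mult.assoc)
  have "mconv A (mmul B C)"
    unfolding mconv_def eq by (auto intro!: summable_on_finite_sum summable_on_cmult_left sm)
  moreover have "mmul (mmul A B) C i j = mmul A (mmul B C) i j" for i j
  proof -
    have "mmul A (mmul B C) i j = (\<Sum>\<^sub>\<infinity>l. \<Sum>k\<in>K j. (A i l * B l k) * C k j)"
      by (simp add: mmul_def[of A "mmul B C"] eq)
    also have "\<dots> = (\<Sum>k\<in>K j. \<Sum>\<^sub>\<infinity>l. (A i l * B l k) * C k j)"
      by (rule infsum_finite_sum) (auto intro!: summable_on_cmult_left sm)
    also have "\<dots> = mmul (mmul A B) C i j"
      unfolding mul[of "mmul A B"] unfolding mmul_def[of A B] by (simp only: infsum_cmult_left')
    finally show ?thesis by simp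
  qed
  ultimately show ?thesis unfolding massoc_def
    using mconv_col_finite[OF C] AB by (simp add: fun_eq_iff)
qed

text \<open>Supports bounded on the same side confine both summation indices to a finite box, so the
  double sum is finite.\<close>

lemma massoc_one_sided:
  assumes s: "sgn1 s" and A: "one_sided s A" and B: "one_sided s B" and C: "one_sided s C"
  shows "massoc A B C"
proof -
  have "mmul (mmul A B) C i j = mmul A (mmul B C) i j" for i j
  proof -
    obtain N M R where N: "supp_le s N A" and M: "supp_le s M B" and R: "supp_le s R C"
      using A B C by (auto simp: one_sided_def)
    let ?K = "\<bar>i\<bar> + \<bar>j\<bar> + \<bar>N\<bar> + \<bar>M\<bar> + \<bar>R\<bar>"
    let ?f = "\<lambda>l k. A i k * B k l * C l j"
    have "{x. (\<lambda>(l,k). ?f l k) x \<noteq> 0} \<subseteq> {-?K..?K} \<times> {-?K..?K}"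
    proof
      fix x assume x: "x \<in> {x. (\<lambda>(l,k). ?f l k) x \<noteq> 0}"
      obtain l k where [simp]: "x = (l, k)" by (cases x)
      have "s * (k - i) \<le> N" "s * (l - k) \<le> M" "s * (j - l) \<le> R"
        using x supp_leD[OF N, of k i] supp_leD[OF M, of l k] supp_leD[OF R, of j l]
        by force+
      thus "x \<in> {-?K..?K} \<times> {-?K..?K}" using supp_le_sgn_cases[OF s] by auto
    qed
    hence "finite {x. (\<lambda>(l,k). ?f l k) x \<noteq> 0}" by (rule finite_subset) simp
    hence sm: "(\<lambda>(l,k). ?f l k) summable_on UNIV \<times> UNIV"
      by (intro finite_nonzero_values_imp_summable_on) simp
    have "mmul (mmul A B) C i j = (\<Sum>\<^sub>\<infinity>l. \<Sum>\<^sub>\<infinity>k. ?f l k)"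
      by (simp add: mmul_def infsum_cmult_left')
    also have "\<dots> = (\<Sum>\<^sub>\<infinity>k. \<Sum>\<^sub>\<infinity>l. ?f l k)"
      by (rule infsum_swap_banach[OF sm])
    also have "\<dots> = mmul A (mmul B C) i j"
      by (simp add: mmul_def infsum_cmult_right' mult.assoc)
    finally show ?thesis .
  qed
  thus ?thesis unfolding massoc_def using assms
    by (auto simp: fun_eq_iff intro!: mconv_one_sided one_sided_mmul)
qed

section \<open>Power series in the times\<close>

lemma finite_submultisets [simp]: "finite {p. p \<subseteq># m}"
proof (induction m)
  case (add x m)
  have "{p. p \<subseteq># add_mset x m} \<subseteq> {p. p \<subseteq># m} \<union> add_mset x ` {p. p \<subseteq># m}"
  proof
    fix p assume p: "p \<in> {p. p \<subseteq># add_mset x m}"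
    show "p \<in> {p. p \<subseteq># m} \<union> add_mset x ` {p. p \<subseteq># m}"
    proof (cases "x \<in># p")
      case True
      then obtain r where r: "p = add_mset x r" by (metis insert_DiffM)
      thus ?thesis using p by auto
    next
      case False
      thus ?thesis using p
        by (metis UnCI diff_single_trivial mem_Collect_eq subset_eq_diff_conv
            add_mset_add_single)
    qed
  qed
  thus ?case using add finite_subset by blast
qed simp

lemma finite_proper_submultisets [simp]: "finite {p. p \<subset># m}"
  by (rule finite_subset[OF _ finite_submultisets[of m]]) (auto simp: subset_mset_def)

lemma submultisets_insert: "{p. p \<subseteq># m} = insert m {p. p \<subset># m}"
  by (auto simp: subset_mset_def)

lemma tmul_apply: "tmul A B m = (\<Sum>p | p \<subseteq># m. mmul (A p) (B (m - p)))"
  by (simp add: tmul_def fun_eq_iff sum_fun_apply)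

lemma tmul_apply_flip: "tmul A B m = (\<Sum>p | p \<subseteq># m. mmul (A (m - p)) (B p))"
  unfolding tmul_apply
  by (rule sum.reindex_bij_witness[of _ "\<lambda>p. m - p" "\<lambda>p. m - p"])
     (auto simp: diff_diff_eq subset_mset.diff_diff_right)

text \<open>The remaining sum involves \<open>A\<close> only at proper submonomials of
  \<open>m\<close>; this is the shape in which recursions over the monomials are solved.\<close>

lemma tmul_split_right:
  "tmul A B m = mmul (A m) (B {#}) + (\<Sum>p | p \<subset># m. mmul (A p) (B (m - p)))"
  unfolding tmul_apply submultisets_insert by (subst sum.insert) auto

lemma tmul_split_left:
  "tmul A B m = mmul (A {#}) (B m) + (\<Sum>p | p \<subset># m. mmul (A (m - p)) (B p))"
  unfolding tmul_apply_flip submultisets_insert by (subst sum.insert) auto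

lemma tmul_empty [simp]: "tmul A B {#} = mmul (A {#}) (B {#})"
  by (simp add: tmul_apply)

lemma tconst_apply: "tconst A m = (if m = {#} then A else 0)"
  by (auto simp: tconst_def fun_eq_iff)

lemma tconst_empty [simp]: "tconst A {#} = A"
  by (simp add: tconst_apply)

lemma tmul_tconst_right: "tmul A (tconst B) = (\<lambda>m. mmul (A m) B)"
proof
  fix m
  have "(\<Sum>p | p \<subset># m. mmul (A p) (tconst B (m - p))) = 0"
  proof (rule sum.neutral, safe)
    fix p assume p: "p \<subset># m"
    hence "m - p \<noteq> {#}"
      by (metis Diff_eq_empty_iff_mset subset_mset.antisym subset_mset.less_imp_le subset_mset.less_irrefl)
    thus "mmul (A p) (tconst B (m - p)) = 0" by (simp add: tconst_apply)
  qed
  thus "tmul A (tconst B) m = mmul (A m) B" by (simp add: tmul_split_right)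
qed

lemma tmul_tconst_left: "tmul (tconst A) B = (\<lambda>m. mmul A (B m))"
proof
  fix m
  have "(\<Sum>p | p \<subset># m. mmul (tconst A (m - p)) (B p)) = 0"
  proof (rule sum.neutral, safe)
    fix p assume p: "p \<subset># m"
    hence "m - p \<noteq> {#}"
      by (metis Diff_eq_empty_iff_mset subset_mset.antisym subset_mset.less_imp_le subset_mset.less_irrefl)
    thus "mmul (tconst A (m - p)) (B p) = 0" by (simp add: tconst_apply)
  qed
  thus "tmul (tconst A) B m = mmul A (B m)" by (simp add: tmul_split_left)
qed

lemma tmul_tconst: "tmul (tconst A) (tconst B) = tconst (mmul A B)"
  by (auto simp: tmul_tconst_left tconst_apply fun_eq_iff)

lemma tmul_tone_left [simp]: "tmul tone A = A"
  by (simp add: tmul_tconst_left)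

lemma tmul_tone_right [simp]: "tmul A tone = A"
  by (simp add: tmul_tconst_right)

lemma tmul_tLam_right: "tmul A (tLam n) = (\<lambda>m i j. A m i (j - n))"
  by (simp add: tmul_tconst_right)

lemma tmul_tLam_left: "tmul (tLam n) A = (\<lambda>m i j. A m (i + n) j)"
  by (simp add: tmul_tconst_left)

lemma tLam_add: "tmul (tLam n) (tLam k) = tLam (n + k)"
  unfolding tmul_tconst mmul_Lam_left by (simp add: Lam_def add.assoc)

definition tassoc :: "tmat \<Rightarrow> tmat \<Rightarrow> tmat \<Rightarrow> bool" where
  "tassoc A B C \<longleftrightarrow> (\<forall>p r s. massoc (A p) (B r) (C s))"

text \<open>Both bracketings sum over the ordered decompositions of \<open>m\<close> into three
  monomials; the pair \<open>(p, r)\<close> corresponds to \<open>(r, p - r)\<close>.\<close>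

lemma tassoc_eq:
  assumes "tassoc A B C"
  shows "tmul (tmul A B) C = tmul A (tmul B C)"
proof
  fix m
  have a: "mmul (mmul (A p) (B r)) (C s) = mmul (A p) (mmul (B r) (C s))"
    "mconv (A p) (mmul (B r) (C s))" "mconv (mmul (A p) (B r)) (C s)" for p r s
    using assms by (auto simp: tassoc_def massoc_def)
  have "tmul (tmul A B) C m =
     (\<Sum>p | p \<subseteq># m. \<Sum>r | r \<subseteq># p. mmul (A r) (mmul (B (p - r)) (C (m - p))))"
    unfolding tmul_apply by (intro sum.cong refl) (simp add: mmul_sum_left a)
  also have "\<dots> = (\<Sum>r | r \<subseteq># m. \<Sum>s | s \<subseteq># m - r. mmul (A r) (mmul (B s) (C (m - r - s))))"
  proof -
    define F where "F r p s = mmul (A r) (mmul (B p) (C s))" for r p s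
    have "(\<Sum>p | p \<subseteq># m. \<Sum>r | r \<subseteq># p. F r (p - r) (m - p)) =
      (\<Sum>(p,r)\<in>(SIGMA p:{p. p \<subseteq># m}. {r. r \<subseteq># p}). F r (p - r) (m - p))"
      by (rule sum.Sigma) auto
    also have "\<dots> = (\<Sum>(r,s)\<in>(SIGMA r:{r. r \<subseteq># m}. {s. s \<subseteq># m - r}). F r s (m - r - s))"
    proof (rule sum.reindex_bij_witness[of _ "\<lambda>(r,s). (r + s, r)" "\<lambda>(p,r). (r, p - r)"], goal_cases)
      case (1 x) thus ?case by (auto simp: subset_mset.add_diff_inverse)
    next
      case (2 x)
      thus ?case
        by (auto intro: subset_mset.order_trans)
          (metis subset_eq_diff_conv subset_mset.diff_add subset_mset.order_trans)
    next
      case (3 x) thus ?case by auto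
    next
      case (4 x)
      thus ?case
        by (auto simp: subset_mset.le_diff_conv2 union_commute)
    next
      case (5 x)
      thus ?case by (auto simp: diff_diff_eq subset_mset.add_diff_inverse)
    qed
    also have "\<dots> = (\<Sum>r | r \<subseteq># m. \<Sum>s | s \<subseteq># m - r. F r s (m - r - s))"
      by (rule sum.Sigma[symmetric]) auto
    finally show ?thesis unfolding F_def .
  qed
  also have "\<dots> = tmul A (tmul B C) m"
    unfolding tmul_apply by (intro sum.cong refl) (simp add: mmul_sum_right a)
  finally show "tmul (tmul A B) C m = tmul A (tmul B C) m" .
qed

lemma tassoc_tconv:
  assumes "tassoc A B C"
  shows "tconv (tmul A B) C" "tconv A (tmul B C)"
  using assms unfolding tconv_def tassoc_def massoc_def tmul_apply
  by (auto intro!: mconv_sum_left mconv_sum_right)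

text \<open>The bound may depend on the monomial, as it must for the exponentials of the
  flows.\<close>

definition t_one_sided :: "int \<Rightarrow> tmat \<Rightarrow> bool" where
  "t_one_sided s A \<longleftrightarrow> (\<forall>m. one_sided s (A m))"

definition t_banded :: "tmat \<Rightarrow> bool" where
  "t_banded A \<longleftrightarrow> (\<forall>m. banded (A m))"

lemma t_banded_iff: "t_banded A \<longleftrightarrow> (\<forall>s. sgn1 s \<longrightarrow> t_one_sided s A)"
  unfolding t_banded_def t_one_sided_def
  by (metis banded_one_sided bandedI)

lemma t_banded_one_sided: "t_banded A \<Longrightarrow> sgn1 s \<Longrightarrow> t_one_sided s A"
  by (simp add: t_banded_iff)

lemma tassoc_one_sided:
  "sgn1 s \<Longrightarrow> t_one_sided s A \<Longrightarrow> t_one_sided s B \<Longrightarrow> t_one_sided s C \<Longrightarrow> tassoc A B C"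
  by (simp add: tassoc_def t_one_sided_def massoc_one_sided)

lemma tassoc_banded_left: "t_banded A \<Longrightarrow> tconv B C \<Longrightarrow> tassoc A B C"
  by (simp add: tassoc_def t_banded_def tconv_def massoc_row_finite banded_row_finite)

lemma tassoc_banded_right: "t_banded C \<Longrightarrow> tconv A B \<Longrightarrow> tassoc A B C"
  by (simp add: tassoc_def t_banded_def tconv_def massoc_col_finite banded_col_finite)

lemmas tmul_assoc = tassoc_eq[OF tassoc_one_sided]

lemma tconv_one_sided: "sgn1 s \<Longrightarrow> t_one_sided s A \<Longrightarrow> t_one_sided s B \<Longrightarrow> tconv A B"
  by (simp add: tconv_def t_one_sided_def mconv_one_sided)

lemma tconv_banded_left: "t_banded A \<Longrightarrow> tconv A B"
  by (simp add: tconv_def t_banded_def mconv_banded_left)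

lemma tconv_banded_right: "t_banded B \<Longrightarrow> tconv A B"
  by (simp add: tconv_def t_banded_def mconv_banded_right)

lemma t_one_sided_tmul [intro]: "t_one_sided s A \<Longrightarrow> t_one_sided s B \<Longrightarrow> t_one_sided s (tmul A B)"
  by (auto simp: t_one_sided_def tmul_apply intro!: one_sided_sum one_sided_mmul)

lemma t_banded_tmul [intro]: "t_banded A \<Longrightarrow> t_banded B \<Longrightarrow> t_banded (tmul A B)"
  by (auto simp: t_banded_iff)

lemma t_one_sided_add [intro]: "t_one_sided s A \<Longrightarrow> t_one_sided s B \<Longrightarrow> t_one_sided s (A + B)"
  by (auto simp: t_one_sided_def intro!: one_sided_add)

lemma t_one_sided_uminus [intro]: "t_one_sided s A \<Longrightarrow> t_one_sided s (- A)"
  by (auto simp: t_one_sided_def intro!: one_sided_uminus)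

lemma t_one_sided_diff [intro]: "t_one_sided s A \<Longrightarrow> t_one_sided s B \<Longrightarrow> t_one_sided s (A - B)"
  using t_one_sided_add[of s A "- B"] by auto

lemma t_one_sided_tconst [intro]: "one_sided s A \<Longrightarrow> t_one_sided s (tconst A)"
  by (simp add: t_one_sided_def tconst_apply)

lemma t_banded_tconst [intro]: "banded A \<Longrightarrow> t_banded (tconst A)"
  by (auto simp: t_banded_iff banded_one_sided)

lemma tscale_apply: "tscale c A m = (\<lambda>i j. c * A m i j)"
  by (simp add: tscale_def)

lemma t_one_sided_tscale [intro]: "t_one_sided s A \<Longrightarrow> t_one_sided s (tscale c A)"
  by (simp add: t_one_sided_def tscale_apply one_sided_scale)

lemma tderiv_apply: "tderiv v A m = (\<lambda>i j. of_nat (Suc (count m v)) * A (add_mset v m) i j)"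
  by (simp add: tderiv_def)

lemma t_one_sided_tderiv [intro]: "t_one_sided s A \<Longrightarrow> t_one_sided s (tderiv v A)"
  by (simp add: t_one_sided_def tderiv_apply one_sided_scale del: of_nat_Suc)

lemma tmul_add_left:
  "tconv A C \<Longrightarrow> tconv B C \<Longrightarrow> tmul (A + B) C = tmul A C + tmul B C"
  by (auto simp: fun_eq_iff[of "tmul (A + B) C"] tmul_apply tconv_def mmul_add_left sum.distrib)

lemma tmul_add_right:
  "tconv A B \<Longrightarrow> tconv A C \<Longrightarrow> tmul A (B + C) = tmul A B + tmul A C"
  by (auto simp: fun_eq_iff[of "tmul A (B + C)"] tmul_apply tconv_def mmul_add_right sum.distrib)

lemma tmul_uminus_left: "tmul (- A) B = - tmul A B"
  by (auto simp: fun_eq_iff[of "tmul (- A) B"] tmul_apply mmul_uminus_left sum_negf)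

lemma tmul_uminus_right: "tmul A (- B) = - tmul A B"
  by (auto simp: fun_eq_iff[of "tmul A (- B)"] tmul_apply mmul_uminus_right sum_negf)

lemma tmul_diff_left:
  assumes "sgn1 s" "t_one_sided s A" "t_one_sided s B" "t_one_sided s C"
  shows "tmul (A - B) C = tmul A C - tmul B C"
  using tmul_add_left[of A C "- B"] assms
  by (simp add: tmul_uminus_left tconv_one_sided t_one_sided_uminus)

lemma tmul_diff_right:
  assumes "sgn1 s" "t_one_sided s A" "t_one_sided s B" "t_one_sided s C"
  shows "tmul A (B - C) = tmul A B - tmul A C"
  using tmul_add_right[of A B "- C"] assms
  by (simp add: tmul_uminus_right tconv_one_sided t_one_sided_uminus)

lemma tmul_tscale_left: "tmul (tscale c A) B = tscale c (tmul A B)"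
  by (simp add: tmul_def tscale_def mmul_scale_left sum_distrib_left)

lemma tmul_tscale_right: "tmul A (tscale c B) = tscale c (tmul A B)"
  by (simp add: tmul_def tscale_def mmul_scale_right sum_distrib_left)

lemma tscale_tscale: "tscale c (tscale d A) = tscale (c * d) A"
  by (simp add: tscale_def mult.assoc)

lemma tscale_one [simp]: "tscale 1 A = A"
  by (simp add: tscale_def)

lemma tcomm_eq: "tcomm A B = tmul A B - tmul B A"
  by (simp add: tcomm_def fun_eq_iff)

section \<open>Leibniz rule for the time derivatives\<close>

lemma sum_submultisets_add:
  fixes f :: "'a multiset \<Rightarrow> 'b::comm_monoid_add"
  assumes "\<And>p. p \<subseteq># add_mset v m \<Longrightarrow> v \<notin># p \<Longrightarrow> f p = 0"
  shows "(\<Sum>p | p \<subseteq># add_mset v m. f p) = (\<Sum>p | p \<subseteq># m. f (add_mset v p))"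
proof -
  have "(\<Sum>p | p \<subseteq># add_mset v m. f p) = (\<Sum>p | p \<subseteq># add_mset v m \<and> v \<in># p. f p)"
    using assms by (intro sum.mono_neutral_right) auto
  also have "\<dots> = (\<Sum>p | p \<subseteq># m. f (add_mset v p))"
    by (rule sum.reindex_bij_witness[of _ "add_mset v" "\<lambda>p. p - {#v#}"])
       (auto simp: subset_eq_diff_conv)
  finally show ?thesis .
qed

text \<open>The factor \<open>Suc (count m v)\<close> is the multiplicity of \<open>v\<close> in
  \<open>add_mset v m\<close>. It splits additively over a submultiset and its complement, and the
  two shares give the two terms of the Leibniz rule.\<close>

lemma tderiv_tmul:
  assumes "tconv A B"
  shows "tderiv v (tmul A B) = tmul (tderiv v A) B + tmul A (tderiv v B)"
proof -
  define F where "F p r i j = mmul (A p) (B r) i j" for p r i j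
  have "tderiv v (tmul A B) m i j = tmul (tderiv v A) B m i j + tmul A (tderiv v B) m i j" for m i j
  proof -
    have "tderiv v (tmul A B) m i j =
        (\<Sum>p | p \<subseteq># add_mset v m. of_nat (Suc (count m v)) * F p (add_mset v m - p) i j)"
      by (simp add: tderiv_def tmul_def F_def sum_distrib_left)
    also have "\<dots> = (\<Sum>p | p \<subseteq># add_mset v m. of_nat (count p v) * F p (add_mset v m - p) i j
        + of_nat (count (add_mset v m - p) v) * F p (add_mset v m - p) i j)"
    proof (intro sum.cong refl, goal_cases)
      case (1 p)
      hence "count p v \<le> Suc (count m v)"
        by (metis mem_Collect_eq mset_subset_eq_count count_add_mset)
      hence "Suc (count m v) = count p v + count (add_mset v m - p) v" by simp
      thus ?case by (metis of_nat_add ring_distribs(2))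
    qed
    also have "\<dots> = (\<Sum>p | p \<subseteq># add_mset v m. of_nat (count p v) * F p (add_mset v m - p) i j)
       + (\<Sum>p | p \<subseteq># add_mset v m. of_nat (count (add_mset v m - p) v) * F p (add_mset v m - p) i j)"
      by (rule sum.distrib)
    also have "(\<Sum>p | p \<subseteq># add_mset v m. of_nat (count p v) * F p (add_mset v m - p) i j) =
       tmul (tderiv v A) B m i j"
      by (subst sum_submultisets_add)
         (auto simp: tmul_def tderiv_apply mmul_scale_left F_def not_in_iff simp del: of_nat_Suc)
    also have "(\<Sum>p | p \<subseteq># add_mset v m. of_nat (count (add_mset v m - p) v) * F p (add_mset v m - p) i j)
       = (\<Sum>p | p \<subseteq># add_mset v m. of_nat (count p v) * F (add_mset v m - p) p i j)"
      by (rule sum.reindex_bij_witness[of _ "\<lambda>p. add_mset v m - p" "\<lambda>p. add_mset v m - p"])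
         (auto simp: subset_mset.diff_diff_right)
    also have "\<dots> = (\<Sum>p | p \<subseteq># m. of_nat (count (add_mset v p) v) * F (m - p) (add_mset v p) i j)"
      by (subst sum_submultisets_add) (auto simp: not_in_iff)
    also have "\<dots> = tmul A (tderiv v B) m i j"
      by (auto simp: tmul_apply_flip sum_fun_apply tderiv_apply mmul_scale_right F_def simp del: of_nat_Suc)
    finally show ?thesis .
  qed
  thus ?thesis by (simp add: fun_eq_iff)
qed

lemma tderiv_tconst [simp]: "tderiv v (tconst A) = 0"
  by (auto simp: tderiv_def fun_eq_iff tconst_def)

text \<open>Every nonempty monomial contains some \<open>v\<close>, and its coefficient reappears in
  \<open>tderiv v A\<close> with a nonzero integer factor.\<close>

lemma tderiv_zero_imp_const:
  assumes "\<And>v. tderiv v A = 0"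
  shows "A = tconst (A {#})"
proof
  fix m
  show "A m = tconst (A {#}) m"
  proof (cases m)
    case (add v r)
    have "of_nat (Suc (count r v)) * A (add_mset v r) i j = 0" for i j
      using fun_cong[OF fun_cong[OF fun_cong[OF assms[of v], of r], of i], of j]
      by (simp add: tderiv_def del: of_nat_Suc)
    hence "A m i j = 0" for i j
      using add by (simp del: of_nat_Suc)
    thus ?thesis using add by (simp add: tconst_apply fun_eq_iff)
  qed simp
qed

text \<open>This is the equation \<open>tmul A X = tone\<close> at \<open>m\<close> solved for
  \<open>X m\<close>, under a unit constant term of \<open>A\<close>.\<close>

function rinv_series :: "tmat \<Rightarrow> tmat" where
  "rinv_series A m = (if m = {#} then Lam 0
     else - (\<Sum>p | p \<subset># m. mmul (A (m - p)) (rinv_series A p)))"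
  by auto
termination
  by (relation "Wellfounded.measure (size \<circ> snd)") (auto simp: mset_subset_size)

declare rinv_series.simps [simp del]

lemma rinv_series_empty [simp]: "rinv_series A {#} = Lam 0"
  by (simp add: rinv_series.simps)

lemma rinv_series_banded:
  assumes "t_banded A"
  shows "t_banded (rinv_series A)"
proof -
  have "one_sided s (rinv_series A m)" if s: "sgn1 s" for s m
  proof (induction "size m" arbitrary: m rule: less_induct)
    case less
    have "one_sided s (A p)" for p using assms s by (simp add: t_banded_def banded_one_sided)
    thus ?case using less
      by (subst rinv_series.simps)
         (auto intro!: one_sided_uminus one_sided_sum one_sided_mmul mset_subset_size)
  qed
  thus ?thesis by (simp add: t_banded_iff t_one_sided_def)
qed

lemma tmul_rinv_series:
  assumes "A {#} = Lam 0"
  shows "tmul A (rinv_series A) = tone"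
proof
  fix m
  show "tmul A (rinv_series A) m = tone m"
  proof (cases "m = {#}")
    case False
    have "tmul A (rinv_series A) m = rinv_series A m
        + (\<Sum>p | p \<subset># m. mmul (A (m - p)) (rinv_series A p))"
      by (simp only: tmul_split_left assms mmul_one_left)
    also have "\<dots> = 0"
      by (subst rinv_series.simps) (simp only: False if_False left_minus)
    finally show ?thesis using False by (simp add: tconst_apply)
  qed (simp add: assms)
qed

text \<open>A right inverse \<open>X\<close> again has unit constant term, hence a right inverse
  \<open>Y\<close> of its own; associativity of band series gives \<open>Y = A\<close>, so
  \<open>X\<close> is two-sided.\<close>

lemma banded_inverse_exists:
  assumes "t_banded A" "A {#} = Lam 0"
  obtains X where "t_banded X" "tmul A X = tone" "tmul X A = tone" "X {#} = Lam 0"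
proof -
  define X where "X = rinv_series A"
  define Y where "Y = rinv_series X"
  have X: "t_banded X" "tmul A X = tone" "X {#} = Lam 0"
    unfolding X_def using assms by (auto simp: rinv_series_banded tmul_rinv_series)
  have Y: "t_banded Y" "tmul X Y = tone"
    unfolding Y_def using X by (auto simp: rinv_series_banded tmul_rinv_series)
  have "A = tmul A (tmul X Y)" using Y by simp
  also have "\<dots> = tmul (tmul A X) Y"
    by (rule tmul_assoc[symmetric, of 1]) (use X Y assms in \<open>auto simp: t_banded_iff\<close>)
  finally have "A = Y" using X by simp
  thus thesis using that X Y by auto
qed

section \<open>Exponentials of the time flows\<close>

text \<open>The coefficient of the monomial \<open>m\<close> in
  \<open>exp (\<Sum>v. c v * v)\<close> for scalar variables \<open>v\<close>.\<close>

definition monomial_coeff :: "(time \<Rightarrow> complex) \<Rightarrow> time multiset \<Rightarrow> complex" where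
  "monomial_coeff c m = (\<Prod>v\<in>#m. c v) / (\<Prod>v\<in>set_mset m. fact (count m v))"

text \<open>The exponent of \<Lambda> attached to a time in the flows. Since powers of \<Lambda>
  commute, a monomial carries the single power given by the sum of its degrees.\<close>

primrec time_degree :: "time \<Rightarrow> int" where
  "time_degree (Tpos k) = int (Suc k)"
| "time_degree (Tneg k) = - int (Suc k)"

primrec pos_ind :: "time \<Rightarrow> complex" where
  "pos_ind (Tpos k) = 1"
| "pos_ind (Tneg k) = 0"

primrec neg_ind :: "time \<Rightarrow> complex" where
  "neg_ind (Tpos k) = 0"
| "neg_ind (Tneg k) = 1"

text \<open>\<open>time_lin c\<close> is \<open>\<Sum>v. c v \<cdot> v \<cdot> \<Lambda>^(time_degree v)\<close>, so that \<open>\<xi>\<close> and \<open>\<xi>bar\<close> are special cases.\<close>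

definition time_lin :: "(time \<Rightarrow> complex) \<Rightarrow> tmat" where
  "time_lin c = (\<lambda>m i j. if size m = 1 then (\<Prod>v\<in>#m. c v) * Lam (\<Sum>v\<in>#m. time_degree v) i j else 0)"

definition time_exp :: "(time \<Rightarrow> complex) \<Rightarrow> tmat" where
  "time_exp c = (\<lambda>m i j. monomial_coeff c m * Lam (\<Sum>v\<in>#m. time_degree v) i j)"

lemma monomial_coeff_empty [simp]: "monomial_coeff c {#} = 1"
  by (simp add: monomial_coeff_def)

lemma monomial_coeff_add:
  "of_nat (Suc (count m v)) * monomial_coeff c (add_mset v m) = c v * monomial_coeff c m"
proof -
  define f where "f r = (\<Prod>w\<in>set_mset m - {v}. fact (count r w) :: complex)" for r
  have f: "f (add_mset v m) = f m" unfolding f_def by (intro prod.cong) auto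
  have "(\<Prod>w\<in>set_mset (add_mset v m). fact (count (add_mset v m) w) :: complex)
      = fact (Suc (count m v)) * f m"
    unfolding f[symmetric] unfolding f_def
    by (simp only: set_mset_add_mset_insert prod.insert_remove finite_set_mset count_add_mset if_True refl)
  moreover have "(\<Prod>w\<in>set_mset m. fact (count m w) :: complex) = fact (count m v) * f m"
    unfolding f_def
    by (cases "v \<in># m") (simp_all add: prod.remove not_in_iff)
  moreover have "f m \<noteq> 0" by (simp add: f_def)
  ultimately show ?thesis
    unfolding monomial_coeff_def by (simp add: field_simps del: of_nat_Suc)
qed

lemma Lam_shift: "Lam n (i + k) j = Lam (k + n) i j" "Lam n i (j - k) = Lam (n + k) i j"
  by (auto simp: Lam_def)

text \<open>This is the multinomial theorem. In the induction step the first factor takes one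
  variable \<open>v\<close> out of \<open>m\<close>, with weight \<open>count m v\<close>, and these
  weights add up to the size of \<open>m\<close>.\<close>

lemma tpow_time_lin:
  "tpow (time_lin c) N m =
     (if size m = N then (\<lambda>i j. fact N * monomial_coeff c m * Lam (\<Sum>v\<in>#m. time_degree v) i j) else 0)"
proof (induction N arbitrary: m)
  case 0
  show ?case by (auto simp: tconst_apply fun_eq_iff)
next
  case (Suc N)
  have lin0: "time_lin c p = 0" if "size p \<noteq> 1" for p
    using that by (simp add: time_lin_def fun_eq_iff)
  have lin1: "time_lin c {#v#} = (\<lambda>i j. c v * Lam (time_degree v) i j)" for v
    by (simp add: time_lin_def)
  have "tpow (time_lin c) (Suc N) m =
      (\<Sum>p | p \<subseteq># m. mmul (time_lin c p) (tpow (time_lin c) N (m - p)))"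
    by (simp add: tmul_apply)
  also have "\<dots> = (\<Sum>p\<in>(\<lambda>v. {#v#}) ` set_mset m. mmul (time_lin c p) (tpow (time_lin c) N (m - p)))"
  proof (rule sum.mono_neutral_right)
    show "\<forall>p\<in>{p. p \<subseteq># m} - (\<lambda>v. {#v#}) ` set_mset m.
        mmul (time_lin c p) (tpow (time_lin c) N (m - p)) = 0"
    proof
      fix p assume p: "p \<in> {p. p \<subseteq># m} - (\<lambda>v. {#v#}) ` set_mset m"
      have "size p \<noteq> 1"
      proof
        assume "size p = 1"
        then obtain v where "p = {#v#}" using size_1_singleton_mset by blast
        thus False using p by auto
      qed
      thus "mmul (time_lin c p) (tpow (time_lin c) N (m - p)) = 0" by (simp add: lin0)
    qed
  qed auto
  also have "\<dots> = (\<Sum>v\<in>set_mset m. mmul (time_lin c {#v#}) (tpow (time_lin c) N (m - {#v#})))"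
    by (subst sum.reindex) (auto simp: inj_on_def)
  also have "\<dots> = (if size m = Suc N then
      (\<lambda>i j. fact (Suc N) * monomial_coeff c m * Lam (\<Sum>v\<in>#m. time_degree v) i j) else 0)"
  proof (cases "size m = Suc N")
    case False
    have "tpow (time_lin c) N (m - {#v#}) = 0" if "v \<in># m" for v
      using that False unfolding Suc by (metis insert_DiffM size_add_mset)
    thus ?thesis using False by simp
  next
    case True
    have "mmul (time_lin c {#v#}) (tpow (time_lin c) N (m - {#v#})) i j =
       of_nat (count m v) * (fact N * monomial_coeff c m * Lam (\<Sum>v\<in>#m. time_degree v) i j)"
      if v: "v \<in># m" for v i j
    proof -
      obtain r where r: "m = add_mset v r" using v by (metis insert_DiffM)
      have "mmul (time_lin c {#v#}) (tpow (time_lin c) N (m - {#v#})) i j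
        = c v * monomial_coeff c r * fact N * Lam (\<Sum>v\<in>#m. time_degree v) i j"
        using True by (simp add: lin1 Suc r mmul_scale_left Lam_shift mult_ac)
      also have "c v * monomial_coeff c r = of_nat (count m v) * monomial_coeff c m"
        using monomial_coeff_add[of r v c] by (simp add: r)
      finally show ?thesis by (simp add: mult_ac)
    qed
    hence "(\<Sum>v\<in>set_mset m. mmul (time_lin c {#v#}) (tpow (time_lin c) N (m - {#v#}))) i j =
       of_nat (\<Sum>v\<in>set_mset m. count m v) *
         (fact N * monomial_coeff c m * Lam (\<Sum>v\<in>#m. time_degree v) i j)" for i j
      unfolding sum_fun_apply of_nat_sum sum_distrib_right by (intro sum.cong) auto
    moreover have "(\<Sum>v\<in>set_mset m. count m v) = Suc N"
      using True by (simp add: size_multiset_overloaded_eq)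
    ultimately show ?thesis using True by (simp add: fun_eq_iff mult_ac)
  qed
  finally show ?case .
qed

lemma texp_time_lin: "texp (time_lin c) = time_exp c"
proof (intro ext)
  fix m i j
  have "(\<Sum>n. tpow (time_lin c) n m i j / fact n) =
        (\<Sum>n\<in>{size m}. tpow (time_lin c) n m i j / fact n)"
    by (rule suminf_finite) (auto simp: tpow_time_lin)
  thus "texp (time_lin c) m i j = time_exp c m i j"
    by (simp add: texp_def time_exp_def tpow_time_lin)
qed

lemma xi_eq: "xi = time_lin pos_ind"
proof (intro ext)
  fix m i j
  show "xi m i j = time_lin pos_ind m i j"
  proof (cases "size m = 1")
    case True
    then obtain v where "m = {#v#}" using size_1_singleton_mset by blast
    thus ?thesis by (cases v) (auto simp: xi_def time_lin_def Lam_def)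
  qed (auto simp: xi_def time_lin_def)
qed

lemma xibar_eq: "xibar = time_lin neg_ind"
proof (intro ext)
  fix m i j
  show "xibar m i j = time_lin neg_ind m i j"
  proof (cases "size m = 1")
    case True
    then obtain v where "m = {#v#}" using size_1_singleton_mset by blast
    thus ?thesis by (cases v) (auto simp: xibar_def time_lin_def Lam_def)
  qed (auto simp: xibar_def time_lin_def)
qed

lemma minus_xibar_eq: "tscale (- 1) xibar = time_lin (\<lambda>v. - neg_ind v)"
proof (intro ext)
  fix m i j
  show "tscale (- 1) xibar m i j = time_lin (\<lambda>v. - neg_ind v) m i j"
  proof (cases "size m = 1")
    case True
    then obtain v where "m = {#v#}" using size_1_singleton_mset by blast
    thus ?thesis by (simp add: xibar_eq tscale_def time_lin_def)
  qed (auto simp: tscale_def xibar_eq time_lin_def)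
qed

lemma texp_xi: "texp xi = time_exp pos_ind"
  by (simp add: xi_eq texp_time_lin)

lemma texp_xibar: "texp xibar = time_exp neg_ind"
  by (simp add: xibar_eq texp_time_lin)

lemma texp_minus_xibar: "texp (tscale (- 1) xibar) = time_exp (\<lambda>v. - neg_ind v)"
  by (simp add: minus_xibar_eq texp_time_lin)

lemma time_exp_empty [simp]: "time_exp c {#} = Lam 0"
  by (simp add: time_exp_def)

lemma t_banded_time_exp [simp]: "t_banded (time_exp c)"
  unfolding t_banded_iff t_one_sided_def time_exp_def by (auto intro!: one_sided_scale)

lemma tLam_time_exp_commute: "tmul (tLam k) (time_exp c) = tmul (time_exp c) (tLam k)"
  unfolding tmul_tLam_left tmul_tLam_right by (auto simp: time_exp_def Lam_def fun_eq_iff)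

lemma tderiv_time_exp: "tderiv v (time_exp c) = tscale (c v) (tmul (tLam (time_degree v)) (time_exp c))"
proof (intro ext)
  fix m i j
  have "tderiv v (time_exp c) m i j =
     (of_nat (Suc (count m v)) * monomial_coeff c (add_mset v m)) * Lam (\<Sum>v\<in>#add_mset v m. time_degree v) i j"
    by (simp add: tderiv_def time_exp_def mult_ac del: of_nat_Suc)
  thus "tderiv v (time_exp c) m i j = tscale (c v) (tmul (tLam (time_degree v)) (time_exp c)) m i j"
    unfolding monomial_coeff_add tmul_tLam_left tscale_def
    by (simp add: time_exp_def Lam_shift mult_ac)
qed

text \<open>All time derivatives vanish: powers of \<Lambda> commute with the exponentials, and the
  contributions of \<open>c v\<close> and \<open>- c v\<close> cancel. The product therefore equals
  its constant term.\<close>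

lemma tmul_time_exp_inverse: "tmul (time_exp c) (time_exp (\<lambda>v. - c v)) = tone"
proof -
  let ?E = "time_exp c" and ?F = "time_exp (\<lambda>v. - c v)"
  note os = t_banded_one_sided[OF t_banded_time_exp, of 1]
  note osL = t_one_sided_tconst[OF one_sided_Lam]
  have "tderiv v (tmul ?E ?F) = 0" for v
  proof -
    let ?L = "tLam (time_degree v)"
    have "tderiv v (tmul ?E ?F) =
        tmul (tscale (c v) (tmul ?L ?E)) ?F + tmul ?E (tscale (- c v) (tmul ?L ?F))"
      by (subst tderiv_tmul) (simp_all add: tconv_banded_left tderiv_time_exp)
    also have "tmul ?E (tscale (- c v) (tmul ?L ?F)) = tscale (- c v) (tmul (tmul ?L ?E) ?F)"
      using tmul_assoc[of 1 ?E ?L ?F] os osL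
      by (simp add: tmul_tscale_right tLam_time_exp_commute)
    also have "tmul (tscale (c v) (tmul ?L ?E)) ?F + \<dots> = 0"
      unfolding tmul_tscale_left by (simp add: tscale_def fun_eq_iff)
    finally show ?thesis .
  qed
  from tderiv_zero_imp_const[OF this] show ?thesis by simp
qed

lemma tmul_time_exp_inverse': "tmul (time_exp (\<lambda>v. - c v)) (time_exp c) = tone"
  using tmul_time_exp_inverse[of "\<lambda>v. - c v"] by simp

section \<open>Evolution of a factorized initial matrix\<close>

lemma tmul_cancel_left:
  assumes "sgn1 s" "tmul P Q = tone" "t_one_sided s P" "t_one_sided s Q" "t_one_sided s A"
  shows "tmul P (tmul Q A) = A"
  using tmul_assoc[of s P Q A] assms by simp

lemma dressed_inverse:
  assumes s: "sgn1 s"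
    and G: "t_one_sided s G" "t_one_sided s Gi" "tmul G Gi = tone" "tmul Gi G = tone"
    and E: "t_one_sided s E" "t_one_sided s X" "tmul E X = tone" "tmul X E = tone"
    and M: "one_sided s M0" "one_sided s M0i" "mmul M0 M0i = Lam 0" "mmul M0i M0 = Lam 0"
    and W: "W = tmul (tmul G (tconst M0)) X"
    and Wi: "Wi = tmul E (tmul (tconst M0i) Gi)"
  shows "tmul W Wi = tone" "tmul Wi W = tone" "tmul W E = tmul G (tconst M0)"
    "t_one_sided s W" "t_one_sided s Wi"
proof -
  have c: "tmul (tconst M0) (tconst M0i) = tone" "tmul (tconst M0i) (tconst M0) = tone"
    using M by (simp_all add: tmul_tconst del: mmul_Lam_left mmul_Lam_right)
  have oM: "t_one_sided s (tconst M0)" "t_one_sided s (tconst M0i)" using M by auto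
  note os = G(1,2) E(1,2) oM t_one_sided_tmul
  note can = tmul_cancel_left[OF s G(3)] tmul_cancel_left[OF s G(4)]
    tmul_cancel_left[OF s E(3)] tmul_cancel_left[OF s E(4)] tmul_cancel_left[OF s c(1)]
    tmul_cancel_left[OF s c(2)]
  show "tmul W Wi = tone" "tmul Wi W = tone" "tmul W E = tmul G (tconst M0)"
    unfolding W Wi by (simp_all add: tmul_assoc[OF s] os can G E c)
  show "t_one_sided s W" "t_one_sided s Wi" unfolding W Wi using os by auto
qed

text \<open>At each monomial, \<open>tmul M Mi = tone\<close> expresses \<open>M {#}\<close> times
  \<open>Mi m\<close> through coefficients of \<open>Mi\<close> at smaller monomials; the triangular
  matrix \<open>M0i\<close> then carries the support bound over to \<open>Mi m\<close>.\<close>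

lemma inverse_supp_le:
  assumes "\<And>m. supp_le s 0 (M m)" "sgn1 s"
    and "supp_le s 0 M0i" "mmul M0i (M {#}) = Lam 0"
    and "t_one_sided s Mi" "tmul M Mi = tone"
  shows "supp_le s 0 (Mi m)"
proof (induction "size m" arbitrary: m rule: less_induct)
  case less
  define S where "S = (\<Sum>p | p \<subset># m. mmul (M (m - p)) (Mi p))"
  have S: "supp_le s 0 S"
    unfolding S_def using supp_le_mmul[OF assms(1) less] mset_subset_size
    by (auto intro!: supp_le_sum)
  have "mmul (M {#}) (Mi m) + S = tone m"
    using assms(6) tmul_split_left[of M Mi m] by (simp add: S_def)
  hence eq: "mmul (M {#}) (Mi m) = tone m + - S" by (simp add: eq_diff_eq)
  have "supp_le s 0 (tone m)" by (auto simp: tconst_apply supp_le_def Lam_def)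
  hence supp: "supp_le s 0 (tone m + - S)" using S supp_le_add supp_le_uminus by blast
  have "massoc M0i (M {#}) (Mi m)"
    using assms by (intro massoc_one_sided[of s]) (auto simp: one_sided_def t_one_sided_def)
  hence "Mi m = mmul M0i (mmul (M {#}) (Mi m))"
    unfolding massoc_def by (metis assms(4) mmul_one_left)
  thus ?case using supp_le_mmul[OF assms(3) supp] by (simp add: eq)
qed

text \<open>Right multiplication by the triangular \<open>M0\<close> does not enlarge the support in
  direction \<open>s\<close>. The bound may thus be imposed after multiplying by \<open>M0i\<close>,
  where \<open>G m\<close> is a bare summand; this is how \<open>gauge\<close> prescribes its
  entries.\<close>

lemma dressed_supp_le:
  assumes s: "sgn1 s" and os: "t_one_sided s G" "t_one_sided s X" "one_sided s M0i"
    and M0: "supp_le s 0 M0" "mmul M0 M0i = Lam 0" "mmul M0i M0 = Lam 0" and X: "X {#} = Lam 0"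
    and supp: "supp_le s N (G m + mmul (\<Sum>p | p \<subset># m. mmul (mmul (G p) M0) (X (m - p))) M0i)"
  shows "supp_le s N (tmul (tmul G (tconst M0)) X m)"
proof -
  let ?S = "\<Sum>p | p \<subset># m. mmul (mmul (G p) M0) (X (m - p))"
  let ?M = "tmul (tmul G (tconst M0)) X m"
  have o: "one_sided s (G p)" "one_sided s (X p)" "one_sided s M0" for p
    using os M0 by (auto simp: t_one_sided_def intro: supp_le_one_sided)
  have S: "one_sided s ?S" using o by (intro one_sided_sum one_sided_mmul)
  have M: "?M = mmul (G m) M0 + ?S"
    unfolding tmul_split_right[of "tmul G (tconst M0)" X m]
    by (simp add: tmul_tconst_right X mmul_one_right)
  hence "mmul ?M M0i = mmul (mmul (G m) M0) M0i + mmul ?S M0i"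
    using S o os s by (simp add: mmul_add_left mconv_one_sided[of s] one_sided_mmul)
  moreover have "massoc (G m) M0 M0i"
    using o os s by (intro massoc_one_sided[of s])
  ultimately have eq: "mmul ?M M0i = G m + mmul ?S M0i"
    using M0 by (simp add: massoc_def)
  have "supp_le s (N + 0) (mmul (mmul ?M M0i) M0)"
    using supp unfolding eq by (intro supp_le_mmul M0)
  moreover have "massoc ?M M0i M0"
    unfolding M using o os S s by (intro massoc_one_sided[of s] one_sided_add one_sided_mmul)
  ultimately show ?thesis using M0 by (simp add: massoc_def)
qed

text \<open>The upper half comes from a matrix with support bounded above and the lower half from
  one with support bounded below, so each half meets finitely many diagonals. This is what makes
  \<open>gauge\<close> banded.\<close>

lemma banded_splice:
  assumes "one_sided 1 A" "one_sided (-1) B"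
  shows "banded (\<lambda>i j. if i \<le> j then A i j else B i j)"
proof -
  obtain N M where N: "supp_le 1 N A" and M: "supp_le (-1) M B"
    using assms by (auto simp: one_sided_def)
  have "supp_le 1 (max N 0) (\<lambda>i j. if i \<le> j then A i j else B i j)"
    using supp_leD[OF N] by (auto simp: supp_le_def)
  moreover have "supp_le (-1) (max M 0) (\<lambda>i j. if i \<le> j then A i j else B i j)"
    using supp_leD[OF M] by (auto simp: supp_le_def)
  ultimately show ?thesis by (auto simp: banded_def one_sided_def)
qed

text \<open>The coefficient at each monomial is forced by splitting into triangular parts: \<open>G W\<^sub>0 X\<close> must have
  no further diagonal or upper entries, and \<open>G V\<^sub>0 Y\<close> no lower ones. Both prescriptions involve finite sums only,
  so no convergence enters.\<close>

function gauge :: "cmat \<Rightarrow> cmat \<Rightarrow> cmat \<Rightarrow> cmat \<Rightarrow> tmat \<Rightarrow> tmat \<Rightarrow> tmat" where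
  "gauge W0 W0i V0 V0i X Y m = (if m = {#} then Lam 0 else (\<lambda>i j.
     if i \<le> j
     then - mmul (\<Sum>p | p \<subset># m. mmul (mmul (gauge W0 W0i V0 V0i X Y p) W0) (X (m - p))) W0i i j
     else - mmul (\<Sum>p | p \<subset># m. mmul (mmul (gauge W0 W0i V0 V0i X Y p) V0) (Y (m - p))) V0i i j))"
  by auto
termination
  by (relation "Wellfounded.measure (\<lambda>(W0, W0i, V0, V0i, X, Y, m). size m)")
     (auto simp: mset_subset_size)

declare gauge.simps [simp del]

lemma gauge_empty [simp]: "gauge W0 W0i V0 V0i X Y {#} = Lam 0"
  by (simp add: gauge.simps)

text \<open>The last two equations are the dynamics: both wave matrices arise from their initial
  values through the same left factor \<open>G\<close>, in a form free of infinite sums.\<close>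

definition evolution ::
  "cmat \<Rightarrow> cmat \<Rightarrow> tmat \<Rightarrow> tmat \<Rightarrow> tmat \<Rightarrow> tmat \<Rightarrow> tmat \<Rightarrow> tmat \<Rightarrow> bool" where
  "evolution W0 V0 G Gi W Wi V Vi \<longleftrightarrow>
     t_banded G \<and> t_banded Gi \<and> tmul G Gi = tone \<and> tmul Gi G = tone \<and>
     one_sided 1 W0 \<and> one_sided (-1) V0 \<and>
     dressing_W W \<and> lower_inverse W Wi \<and> dressing_Wbar V \<and> upper_inverse V Vi \<and>
     W {#} = W0 \<and> V {#} = V0 \<and>
     tmul W (time_exp pos_ind) = tmul G (tconst W0) \<and>
     tmul V (time_exp neg_ind) = tmul G (tconst V0)"

locale factorized_initial =
  fixes W0 W0i V0 V0i :: cmat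
  assumes W0: "supp_le 1 0 W0" "\<And>i. W0 i i = 1" and W0i: "supp_le 1 0 W0i"
    and V0: "supp_le (-1) 0 V0" "\<And>i. V0 i i \<noteq> 0" and V0i: "supp_le (-1) 0 V0i"
    and W0_inv: "mmul W0 W0i = Lam 0" "mmul W0i W0 = Lam 0"
    and V0_inv: "mmul V0 V0i = Lam 0" "mmul V0i V0 = Lam 0"
begin

abbreviation "X \<equiv> time_exp (\<lambda>v. - pos_ind v)"
abbreviation "Y \<equiv> time_exp (\<lambda>v. - neg_ind v)"
abbreviation "G \<equiv> gauge W0 W0i V0 V0i X Y"

lemma one_sided_initial:
  "one_sided 1 W0" "one_sided 1 W0i" "one_sided (-1) V0" "one_sided (-1) V0i"
  using W0 W0i V0 V0i supp_le_one_sided by blast+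

lemma one_sided_time_exp: "sgn1 s \<Longrightarrow> one_sided s (time_exp c m)"
  using t_banded_one_sided[OF t_banded_time_exp] by (simp add: t_one_sided_def)

lemma t_banded_gauge: "t_banded G"
  unfolding t_banded_def
proof
  fix m show "banded (G m)"
  proof (induction "size m" arbitrary: m rule: less_induct)
    case less
    have s: "one_sided s (G p)" if "p \<subset># m" "sgn1 s" for p s
      using less[OF mset_subset_size[OF that(1)]] that by (simp add: banded_one_sided)
    show ?case
    proof (cases "m = {#}")
      case False
      have "banded (\<lambda>i j. if i \<le> j
         then (- mmul (\<Sum>p | p \<subset># m. mmul (mmul (G p) W0) (X (m - p))) W0i) i j
         else (- mmul (\<Sum>p | p \<subset># m. mmul (mmul (G p) V0) (Y (m - p))) V0i) i j)"
        by (intro banded_splice one_sided_uminus one_sided_mmul one_sided_sum s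
              one_sided_time_exp one_sided_initial) auto
      thus ?thesis by (subst gauge.simps) (simp add: False cong: if_cong)
    qed simp
  qed
qed

definition "W = tmul (tmul G (tconst W0)) X"
definition "V = tmul (tmul G (tconst V0)) Y"

lemma W_empty: "W {#} = W0" and V_empty: "V {#} = V0"
  by (simp_all add: W_def V_def tmul_tconst_right)

text \<open>The bound \<open>- 1\<close> instead of \<open>0\<close> removes the diagonal too. It
  encodes the unit diagonal of \<open>W\<close>, while that of \<open>V\<close> stays free, and it
  is why \<open>gauge\<close> treats \<open>i = j\<close> together with the upper half.\<close>

lemma W_supp:
  assumes "m \<noteq> {#}" shows "supp_le 1 (- 1) (W m)"
  unfolding W_def
proof (rule dressed_supp_le[where s = 1 and M0i = W0i])
  show "supp_le 1 (- 1)
     (G m + mmul (\<Sum>p | p \<subset># m. mmul (mmul (G p) W0) (X (m - p))) W0i)"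
    unfolding supp_le_def using assms by (simp add: gauge.simps[of _ _ _ _ _ _ m])
qed (use t_banded_one_sided[OF t_banded_gauge] t_banded_one_sided[OF t_banded_time_exp]
    one_sided_initial W0 W0_inv in auto)

lemma V_supp: "supp_le (-1) 0 (V m)"
proof (cases "m = {#}")
  case False
  show ?thesis
    unfolding V_def
  proof (rule dressed_supp_le[where s = "-1" and M0i = V0i])
    show "supp_le (-1) 0
       (G m + mmul (\<Sum>p | p \<subset># m. mmul (mmul (G p) V0) (Y (m - p))) V0i)"
      unfolding supp_le_def using False by (simp add: gauge.simps[of _ _ _ _ _ _ m])
  qed (use t_banded_one_sided[OF t_banded_gauge] t_banded_one_sided[OF t_banded_time_exp]
      one_sided_initial V0 V0_inv in auto)
qed (simp add: V_empty V0)

lemma evolution_exists: "\<exists>G Gi W Wi V Vi. evolution W0 V0 G Gi W Wi V Vi"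
proof -
  obtain Gi where Gi: "t_banded Gi" "tmul G Gi = tone" "tmul Gi G = tone"
    using banded_inverse_exists[OF t_banded_gauge] by auto
  define Wi where "Wi = tmul (time_exp pos_ind) (tmul (tconst W0i) Gi)"
  define Vi where "Vi = tmul (time_exp neg_ind) (tmul (tconst V0i) Gi)"
  note b = t_banded_one_sided
  have DW: "tmul W Wi = tone" "tmul Wi W = tone" "tmul W (time_exp pos_ind) = tmul G (tconst W0)"
    "t_one_sided 1 W" "t_one_sided 1 Wi"
    using dressed_inverse[OF _ b b Gi(2,3) b b _ _ _ _ _ _ W_def Wi_def, of 1]
      t_banded_gauge Gi one_sided_initial W0_inv tmul_time_exp_inverse tmul_time_exp_inverse'
    by auto
  have DV: "tmul V Vi = tone" "tmul Vi V = tone" "tmul V (time_exp neg_ind) = tmul G (tconst V0)"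
    "t_one_sided (-1) V" "t_one_sided (-1) Vi"
    using dressed_inverse[OF _ b b Gi(2,3) b b _ _ _ _ _ _ V_def Vi_def, of "-1"]
      t_banded_gauge Gi one_sided_initial V0_inv tmul_time_exp_inverse tmul_time_exp_inverse'
    by auto
  have Ws: "supp_le 1 0 (W m)" for m
    using W_supp[of m] W0 by (cases "m = {#}") (auto simp: W_empty intro: supp_le_mono)
  have Wis: "supp_le 1 0 (Wi m)" for m
    by (rule inverse_supp_le[OF Ws]) (use DW W0i W0_inv in \<open>auto simp: W_empty\<close>)
  have Vis: "supp_le (-1) 0 (Vi m)" for m
    by (rule inverse_supp_le[OF V_supp]) (use DV V0i V0_inv in \<open>auto simp: V_empty\<close>)
  have "dressing_W W"
    unfolding dressing_W_def is_lower_def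
  proof (intro conjI allI impI)
    show "W m i j = 0" if "i < j" for m i j using supp_leD[OF Ws] that by auto
    show "W m i i = tone m i i" for m i
    proof (cases "m = {#}")
      case False thus ?thesis using supp_leD[OF W_supp[OF False], of i i] by (simp add: tconst_apply)
    qed (simp add: W_empty W0 Lam_def)
  qed
  moreover have "lower_inverse W Wi"
    unfolding lower_inverse_def is_lower_def using DW supp_leD[OF Wis] by auto
  moreover have "dressing_Wbar V"
    unfolding dressing_Wbar_def is_upper_def using supp_leD[OF V_supp] by (auto simp: V_empty V0)
  moreover have "upper_inverse V Vi"
    unfolding upper_inverse_def is_upper_def using DV supp_leD[OF Vis] by auto
  ultimately have "evolution W0 V0 G Gi W Wi V Vi"
    unfolding evolution_def using t_banded_gauge Gi DW DV one_sided_initial W_empty V_empty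
    by simp
  thus ?thesis by blast
qed

end

section \<open>From an evolution to the factorization problem\<close>

lemma is_lower_supp: "is_lower A \<longleftrightarrow> (\<forall>m. supp_le 1 0 (A m))"
  by (auto simp: is_lower_def supp_le_def)

lemma is_upper_supp: "is_upper A \<longleftrightarrow> (\<forall>m. supp_le (-1) 0 (A m))"
  by (auto simp: is_upper_def supp_le_def)

lemma t_one_sided_supp: "\<forall>m. supp_le s N (A m) \<Longrightarrow> t_one_sided s A"
  by (auto simp: t_one_sided_def one_sided_def)

lemma supp_le_tmul:
  "\<forall>m. supp_le s N (A m) \<Longrightarrow> \<forall>m. supp_le s M (B m) \<Longrightarrow> \<forall>m. supp_le s (N + M) (tmul A B m)"
  unfolding tmul_apply by (intro allI supp_le_sum supp_le_mmul) auto

lemma supp_le_scale: "supp_le s N A \<Longrightarrow> supp_le s N (\<lambda>i j. c * A i j)"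
  by (simp add: supp_le_def)

lemma supp_le_tLam: "\<forall>m. supp_le s (s * n) (tLam n m)"
  using supp_le_Lam by (simp add: tconst_apply)

lemma evolutionD:
  assumes "evolution W0 V0 G Gi W Wi V Vi"
  shows "t_banded G" "t_banded Gi" "tmul G Gi = tone" "tmul Gi G = tone"
    "one_sided 1 W0" "one_sided (-1) V0"
    "tmul W Wi = tone" "tmul Wi W = tone" "tmul V Vi = tone" "tmul Vi V = tone"
    "\<forall>m. supp_le 1 0 (W m)" "\<forall>m. supp_le 1 0 (Wi m)"
    "\<forall>m. supp_le (-1) 0 (V m)" "\<forall>m. supp_le (-1) 0 (Vi m)"
    "\<And>m i. W m i i = tone m i i" "W {#} = W0" "V {#} = V0"
    "tmul W (time_exp pos_ind) = tmul G (tconst W0)"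
    "tmul V (time_exp neg_ind) = tmul G (tconst V0)"
    "t_one_sided 1 W" "t_one_sided 1 Wi" "t_one_sided (-1) V" "t_one_sided (-1) Vi"
  using assms unfolding evolution_def dressing_W_def dressing_Wbar_def lower_inverse_def
    upper_inverse_def is_lower_supp is_upper_supp
  by (auto intro: t_one_sided_supp)

lemma inverse_unique:
  assumes "sgn1 s" "t_one_sided s M" "t_one_sided s Mi" "t_one_sided s Z"
    and "tmul Mi M = tone" "tmul M Z = tone"
  shows "Mi = Z"
  using tmul_cancel_left[of s Mi M Z] assms by simp

text \<open>A power of \<Lambda> between two factors merely translates the summation index, so both
  bracketings are the same series.\<close>

lemma massoc_Lam_mid:
  assumes "mconv A (mmul (Lam n) B)"
  shows "massoc A (Lam n) B"
proof -
  have re: "(\<lambda>k. A i (k - n) * B k j) summable_on UNIV \<longleftrightarrow> (\<lambda>l. A i l * B (l + n) j) summable_on UNIV"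
    "(\<Sum>\<^sub>\<infinity>k. A i (k - n) * B k j) = (\<Sum>\<^sub>\<infinity>l. A i l * B (l + n) j)" for i j
    by (rule summable_on_reindex_bij_witness[of _ "\<lambda>l. l + n" "\<lambda>k. k - n"], auto)
       (rule infsum_reindex_bij_witness[of _ "\<lambda>l. l + n" "\<lambda>k. k - n"], auto)
  have "mconv A (\<lambda>i j. B (i + n) j)" using assms by simp
  moreover from this have "mconv (\<lambda>i j. A i (j - n)) B"
    by (simp add: mconv_def re)
  moreover have "mmul (\<lambda>i j. A i (j - n)) B = mmul A (\<lambda>i j. B (i + n) j)"
    by (simp add: mmul_def re)
  ultimately show ?thesis
    unfolding massoc_def by (simp add: mconv_banded_left mconv_banded_right)
qed

lemma massoc_scale_mid: "massoc A B C \<Longrightarrow> massoc A (\<lambda>i j. c * B i j) C"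
  by (auto simp: massoc_def mmul_scale_left mmul_scale_right intro: mconv_scale_left mconv_scale_right)

lemma massoc_scale_right: "massoc A B C \<Longrightarrow> massoc A B (\<lambda>i j. c * C i j)"
  by (auto simp: massoc_def mmul_scale_left mmul_scale_right intro: mconv_scale_left mconv_scale_right)

lemma massoc_zero_left: "mconv B C \<Longrightarrow> massoc 0 B C"
  by (simp add: massoc_def)

lemma degree_neg:
  assumes "\<And>v. v \<in># m \<Longrightarrow> c v \<noteq> 0" "\<And>k. c (Tpos k) = 0"
  shows "\<exists>k::nat. (\<Sum>v\<in>#m. time_degree v) = - int k"
  using assms(1)
proof (induction m)
  case (add v m)
  then obtain k where k: "(\<Sum>v\<in>#m. time_degree v) = - int k" by auto
  obtain l where "v = Tneg l" using add.prems[of v] assms(2) by (cases v) auto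
  hence "(\<Sum>v\<in>#add_mset v m. time_degree v) = - int (k + Suc l)" using k by simp
  thus ?case by blast
qed simp

text \<open>A monomial containing a time with \<open>c v = 0\<close> has coefficient zero; the
  others consist of \<open>Tneg\<close> variables only. In the exponentials of \<open>xibar\<close>
  the matrix \<open>U\<close> therefore meets only powers \<open>\<Lambda>^(-k)\<close> with
  \<open>k \<ge> 0\<close>.\<close>

lemma time_exp_neg_cases:
  assumes "\<And>k. c (Tpos k) = 0"
  obtains d and k :: nat where "time_exp c m = (\<lambda>i j. d * Lam (- int k) i j)"
proof (cases "\<exists>v\<in>#m. c v = 0")
  case True
  hence "monomial_coeff c m = 0"
    by (auto simp: monomial_coeff_def prod_mset_zero_iff)
  thus thesis using that[of 0 0] by (simp add: time_exp_def fun_eq_iff)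
next
  case False
  then obtain k :: nat where "(\<Sum>v\<in>#m. time_degree v) = - int k"
    using degree_neg[of m c] assms by blast
  thus thesis using that by (simp add: time_exp_def)
qed

theorem evolution_toda_factorization:
  assumes ev: "evolution W0 V0 G Gi W Wi V Vi"
    and inv: "mmul W0 W0i = Lam 0" "one_sided 1 W0i" "mmul V0 V0i = Lam 0" "one_sided (-1) V0i"
    and U: "mconv W0i V0" "mmul W0i V0 = U" "mconv W0 U" "mmul W0 U = V0"
    and UV: "\<And>k::nat. mconv U (mmul (Lam (- int k)) V0i)" "mmul U V0i = W0i"
  shows "toda_factorization U W Wi V Vi"
proof -
  note evD = evolutionD[OF ev]
  define E Eb Y where "E = time_exp pos_ind" and "Eb = time_exp neg_ind"
    and "Y = time_exp (\<lambda>v. - neg_ind v)"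
  have bE: "t_banded E" "t_banded Eb" "t_banded Y" by (simp_all add: E_def Eb_def Y_def)
  have EbY: "tmul Y Eb = tone" by (simp add: Eb_def Y_def tmul_time_exp_inverse')
  note b = t_banded_one_sided
  have s1: "sgn1 1" "sgn1 (-1)" by simp_all
  have oW: "t_one_sided 1 (tconst W0)" "t_one_sided 1 (tconst W0i)" using evD inv by auto
  have oV: "t_one_sided (-1) (tconst V0)" "t_one_sided (-1) (tconst V0i)" using evD inv by auto
  have cW: "tmul (tconst W0) (tconst W0i) = tone" using inv by (simp add: tmul_tconst del: mmul_Lam_left mmul_Lam_right)
  have cV: "tmul (tconst V0) (tconst V0i) = tone" using inv by (simp add: tmul_tconst del: mmul_Lam_left mmul_Lam_right)

  \<comment> \<open>\<open>evolution\<close> only says that \<open>Wi\<close> is an inverse;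
    uniqueness among one-sided series gives it this explicit form, and likewise for
    \<open>Vi\<close> below.\<close>
  let ?ZW = "tmul E (tmul (tconst W0i) Gi)"
  have oZW: "t_one_sided 1 ?ZW" using bE(1) oW evD(2) b[OF _ s1(1)] by auto
  have "tmul W ?ZW = tmul (tmul W E) (tmul (tconst W0i) Gi)"
    by (rule tmul_assoc[OF s1(1), symmetric]) (use evD bE oW b[OF _ s1(1)] in auto)
  also have "\<dots> = tmul G (tmul (tconst W0) (tmul (tconst W0i) Gi))"
    unfolding E_def evD(18)
    by (rule tmul_assoc[OF s1(1)]) (use evD bE oW b[OF _ s1(1)] in auto)
  also have "\<dots> = tone"
    using tmul_cancel_left[OF s1(1) cW oW, of Gi] b[OF _ s1(1)] evD by simp
  finally have Wi_eq: "Wi = ?ZW"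
    using inverse_unique[OF s1(1), of W Wi ?ZW] evD oZW by simp

  let ?T = "tmul Eb (tconst V0i)"
  let ?ZV = "tmul ?T Gi"
  have oZV: "t_one_sided (-1) ?ZV" using bE(2) oV evD(2) b[OF _ s1(2)] by auto
  have ZV_eq: "?ZV = tmul Eb (tmul (tconst V0i) Gi)"
    by (rule tmul_assoc[OF s1(2)]) (use evD bE oV b[OF _ s1(2)] in auto)
  have "tmul V ?ZV = tmul (tmul V Eb) (tmul (tconst V0i) Gi)"
    unfolding ZV_eq by (rule tmul_assoc[OF s1(2), symmetric]) (use evD bE oV b[OF _ s1(2)] in auto)
  also have "\<dots> = tmul G (tmul (tconst V0) (tmul (tconst V0i) Gi))"
    unfolding Eb_def evD(19)
    by (rule tmul_assoc[OF s1(2)]) (use evD bE oV b[OF _ s1(2)] in auto)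
  also have "\<dots> = tone"
    using tmul_cancel_left[OF s1(2) cV oV, of Gi] b[OF _ s1(2)] evD by simp
  finally have Vi_eq: "Vi = ?ZV"
    using inverse_unique[OF s1(2), of V Vi ?ZV] evD oZV by simp

  have Wi0: "Wi {#} = W0i"
  proof -
    have "massoc (Wi {#}) W0 W0i"
      using evD(5,21) inv by (intro massoc_one_sided[of 1]) (auto simp: t_one_sided_def)
    moreover have "mmul (Wi {#}) W0 = Lam 0"
      using fun_cong[OF evD(8), of "{#}"] evD(16) by simp
    ultimately show ?thesis using inv(1) unfolding massoc_def
      by (metis mmul_one_left mmul_one_right)
  qed

  have first: "tconv (tmul (tmul E (tconst U)) Y) Vi \<and> tmul (tmul (tmul E (tconst U)) Y) Vi = Wi"
  proof -
    \<comment> \<open>Coefficientwise both exponentials are scalar multiples of powers of \<Lambda>,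
      so the only infinite sums here are those of \<open>U\<close> against
      \<open>\<Lambda>^(-(k + l)) V0i\<close>, which \<open>UV(1)\<close> controls.\<close>
    have UT: "massoc U (Y r) (?T s)" for r s
    proof -
      obtain d l where d: "Eb s = (\<lambda>i j. d * Lam (- int l) i j)"
        unfolding Eb_def by (rule time_exp_neg_cases[of neg_ind s]) auto
      hence T: "?T s = (\<lambda>i j. d * mmul (Lam (- int l)) V0i i j)"
        unfolding tmul_tconst_right by (simp only: mmul_scale_left)
      obtain e k where Y: "Y r = (\<lambda>i j. e * Lam (- int k) i j)"
        unfolding Y_def by (rule time_exp_neg_cases[of "\<lambda>v. - neg_ind v" r]) auto
      have "mmul (Lam (- int k)) (mmul (Lam (- int l)) V0i) = mmul (Lam (- int (k + l))) V0i"
        by (simp add: algebra_simps)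
      hence "massoc U (Lam (- int k)) (mmul (Lam (- int l)) V0i)"
        using massoc_Lam_mid[of U "- int k" "mmul (Lam (- int l)) V0i"] UV(1)[of "k + l"] by (simp only:)
      thus ?thesis unfolding T Y by (intro massoc_scale_mid massoc_scale_right)
    qed
    have "tassoc (tconst U) Y ?T"
      unfolding tassoc_def
    proof (intro allI)
      fix p r s show "massoc (tconst U p) (Y r) (?T s)"
        using UT[of r s] bE by (auto simp: tconst_apply t_banded_def mconv_banded_left massoc_zero_left)
    qed
    note 1 = tassoc_eq[OF this] tassoc_tconv[OF this]
    have "tmul Y ?T = tconst V0i"
      by (rule tmul_cancel_left[OF s1(2) EbY]) (use bE oV b[OF _ s1(2)] in auto)
    hence 2: "tmul (tmul (tconst U) Y) ?T = tconst W0i"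
      using 1(1) UV(2) by (simp add: tmul_tconst)
    have "tassoc (tmul (tconst U) Y) ?T Gi"
      by (rule tassoc_banded_right[OF evD(2) 1(2)])
    note 3 = tassoc_eq[OF this] tassoc_tconv[OF this]
    have "tassoc E (tmul (tconst U) Y) Vi"
      using 3 unfolding Vi_eq by (intro tassoc_banded_left bE) simp
    note 4 = tassoc_eq[OF this] tassoc_tconv[OF this]
    have "tassoc E (tconst U) Y"
      by (intro tassoc_banded_left bE tconv_banded_right)
    note 5 = tassoc_eq[OF this]
    have "tmul (tmul (tconst U) Y) Vi = tmul (tconst W0i) Gi"
      using 3(1) 2 by (simp add: Vi_eq)
    thus ?thesis using 4 by (simp add: 5 Wi_eq)
  qed
  have second: "tconv (tmul W E) (tconst U) \<and> tmul (tmul W E) (tconst U) = tmul V Eb"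
  proof -
    have "tconv (tconst W0) (tconst U)" using U by (simp add: tconv_def tconst_apply)
    hence "tassoc G (tconst W0) (tconst U)" by (intro tassoc_banded_left evD)
    note 1 = tassoc_eq[OF this] tassoc_tconv[OF this]
    have WE: "tmul W E = tmul G (tconst W0)" unfolding E_def by (rule evD)
    have VEb: "tmul V Eb = tmul G (tconst V0)" unfolding Eb_def by (rule evD)
    show ?thesis unfolding WE VEb using 1 U(4) by (simp add: tmul_tconst)
  qed
  show ?thesis
    unfolding toda_factorization_def Let_def texp_xi texp_xibar texp_minus_xibar
      E_def[symmetric] Eb_def[symmetric] Y_def[symmetric]
    using first second ev U Wi0 evD(17) by (simp add: evolution_def)
qed

section \<open>Lax equations\<close>

lemma tpow_dressed:
  assumes s: "sgn1 s" and os: "t_one_sided s M" "t_one_sided s Mi"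
    and inv: "tmul M Mi = tone" "tmul Mi M = tone"
  shows "tpow (tmul (tmul M (tLam r)) Mi) n = tmul (tmul M (tLam (r * int n))) Mi"
proof (induction n)
  case 0 show ?case using inv by simp
next
  case (Suc n)
  have oL: "t_one_sided s (tLam k)" for k by (intro t_one_sided_tconst one_sided_Lam)
  note o = os oL t_one_sided_tmul
  let ?L = "tLam r" and ?Ln = "tLam (r * int n)"
  have "tpow (tmul (tmul M ?L) Mi) (Suc n) = tmul (tmul (tmul M ?L) Mi) (tmul (tmul M ?Ln) Mi)"
    by (simp only: tpow.simps Suc)
  also have "\<dots> = tmul M (tmul ?L (tmul ?Ln Mi))"
    by (simp add: tmul_assoc[OF s] o tmul_cancel_left[OF s inv(2)])
  also have "\<dots> = tmul (tmul M (tmul ?L ?Ln)) Mi"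
    by (simp add: tmul_assoc[OF s] o)
  also have "tmul ?L ?Ln = tLam (r * int (Suc n))"
    by (simp add: tLam_add algebra_simps)
  finally show ?case .
qed

text \<open>Differentiating \<open>M exp = G M0\<close> and cancelling the exponential gives
  \<open>\<partial>M = A M - c(v) M \<Lambda>^d\<close> with \<open>A = \<partial>G G^-1\<close>. In
  the derivative of \<open>M \<Lambda>^r M^-1\<close> the second term drops out because powers of
  \<Lambda> commute. The same \<open>A\<close> thus governs the lower and the upper factor.\<close>

lemma dressed_derivative:
  assumes s: "sgn1 s"
    and G: "t_one_sided s G" "t_one_sided s Gi" "tmul G Gi = tone" "tmul Gi G = tone"
    and M: "t_one_sided s M" "t_one_sided s Mi" "tmul M Mi = tone" "tmul Mi M = tone"
    and M0: "one_sided s M0" "tmul M (time_exp c) = tmul G (tconst M0)"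
  shows "tmul (tderiv v M) Mi =
      tmul (tderiv v G) Gi - tscale (c v) (tmul (tmul M (tLam (time_degree v))) Mi)" (is ?A)
    and "tderiv v (tmul (tmul M (tLam r)) Mi) =
      tcomm (tmul (tderiv v G) Gi) (tmul (tmul M (tLam r)) Mi)" (is ?B)
proof -
  define E X where "E = time_exp c" and "X = time_exp (\<lambda>v. - c v)"
  define L where "L = tLam (time_degree v)"
  define A where "A = tmul (tderiv v G) Gi"
  have oE: "t_one_sided s E" "t_one_sided s X"
    unfolding E_def X_def using s by (auto intro: t_banded_one_sided)
  have EX: "tmul E X = tone" by (simp add: E_def X_def tmul_time_exp_inverse)
  have oM0: "t_one_sided s (tconst M0)" using M0 by auto
  have oL: "t_one_sided s (tLam k)" for k by (intro t_one_sided_tconst one_sided_Lam)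
  have oA: "t_one_sided s A" unfolding A_def using G by auto
  note o = G(1,2) M(1,2) oE oM0 oL oA t_one_sided_tmul t_one_sided_tderiv t_one_sided_tscale
    t_one_sided_diff
  note assoc = tmul_assoc[OF s]
  have DG: "tmul A (tmul M E) = tmul (tderiv v G) (tconst M0)"
    unfolding E_def M0(2) A_def by (simp add: assoc o tmul_cancel_left[OF s G(4)])
  have DE: "tderiv v E = tscale (c v) (tmul L E)" by (simp add: E_def L_def tderiv_time_exp)
  have "tderiv v (tmul M E) = tderiv v (tmul G (tconst M0))" by (simp add: E_def M0)
  moreover have "tderiv v (tmul M E) = tmul (tderiv v M) E + tscale (c v) (tmul M (tmul L E))"
    by (subst tderiv_tmul) (simp_all add: tconv_one_sided[OF s] o DE tmul_tscale_right)
  moreover have "tderiv v (tmul G (tconst M0)) = tmul (tderiv v G) (tconst M0)"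
    by (subst tderiv_tmul) (auto simp: tconv_one_sided[OF s] o tmul_apply fun_eq_iff sum_fun_apply)
  ultimately have "tmul (tderiv v M) E = tmul A (tmul M E) - tscale (c v) (tmul M (tmul L E))"
    using DG by (simp add: eq_diff_eq)
  also have "\<dots> = tmul (tmul A M - tscale (c v) (tmul M L)) E"
    by (simp add: tmul_diff_left[OF s] o assoc L_def tmul_tscale_left)
  finally have "tmul (tmul (tderiv v M) E) X = tmul (tmul (tmul A M - tscale (c v) (tmul M L)) E) X"
    by simp
  hence d1: "tderiv v M = tmul A M - tscale (c v) (tmul M L)"
    by (simp add: assoc o EX L_def)
  show ?A
    unfolding d1 A_def[symmetric] L_def[symmetric]
    by (simp add: tmul_diff_left[OF s] o assoc L_def tmul_tscale_left M)
  have "tmul (tderiv v M) Mi + tmul M (tderiv v Mi) = tderiv v (tmul M Mi)"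
    by (subst tderiv_tmul) (simp_all add: tconv_one_sided[OF s] o)
  hence "tmul M (tderiv v Mi) = - tmul (tderiv v M) Mi"
    by (simp add: M eq_neg_iff_add_eq_0 add.commute)
  hence "tmul Mi (tmul M (tderiv v Mi)) = - tmul Mi (tmul (tderiv v M) Mi)"
    by (simp add: tmul_uminus_right)
  hence d2: "tderiv v Mi = - tmul Mi (tmul (tderiv v M) Mi)"
    using tmul_cancel_left[OF s M(4), of "tderiv v Mi"] o by simp
  let ?R = "tLam r"
  have "tderiv v (tmul (tmul M ?R) Mi) = tmul (tderiv v M) (tmul ?R Mi) + tmul M (tmul ?R (tderiv v Mi))"
    by (simp add: tderiv_tmul tconv_one_sided[OF s] o assoc)
       (simp add: tmul_apply fun_eq_iff sum_fun_apply)
  also have "\<dots> = tmul A (tmul M (tmul ?R Mi)) - tmul M (tmul ?R (tmul Mi A))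
     + (tscale (c v) (tmul M (tmul ?R (tmul L Mi))) - tscale (c v) (tmul M (tmul L (tmul ?R Mi))))"
    unfolding d2 unfolding d1
    by (simp add: tmul_diff_left[OF s] tmul_diff_right[OF s] o assoc L_def tmul_tscale_left
          tmul_tscale_right M tmul_cancel_left[OF s M(4)] tmul_uminus_right)
  also have "tmul ?R (tmul L Mi) = tmul L (tmul ?R Mi)"
    unfolding L_def by (simp add: assoc[symmetric] o tLam_add add.commute)
  finally have "tderiv v (tmul (tmul M ?R) Mi) =
      tmul A (tmul M (tmul ?R Mi)) - tmul M (tmul ?R (tmul Mi A))"
    by (simp only: diff_self add_0_right)
  moreover have "tmul A (tmul M (tmul ?R Mi)) = tmul A (tmul (tmul M ?R) Mi)"
    "tmul M (tmul ?R (tmul Mi A)) = tmul (tmul (tmul M ?R) Mi) A"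
    by (simp_all add: assoc o)
  ultimately show ?B
    unfolding tcomm_eq A_def[symmetric] by (simp only:)
qed

text \<open>Since \<open>\<partial>W W^-1\<close> is strictly lower and
  \<open>\<partial>V V^-1\<close> upper triangular, the two expressions for \<open>A v\<close>
  determine its entries on and above the diagonal from \<open>L\<close> and those below it from
  \<open>Li\<close>. For \<open>Tpos\<close> the latter vanish, for \<open>Tneg\<close> the former,
  which leaves exactly the generators of the Lax equations.\<close>

theorem evolution_toda_lax:
  assumes ev: "evolution W0 V0 G Gi W Wi V Vi"
  shows "toda_lax (tmul (tmul W (tLam 1)) Wi) (tmul (tmul V (tLam (- 1))) Vi)"
proof -
  note evD = evolutionD[OF ev]
  note b = t_banded_one_sided
  define L Li where "L = tmul (tmul W (tLam 1)) Wi" and "Li = tmul (tmul V (tLam (- 1))) Vi"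
  define A where "A v = tmul (tderiv v G) Gi" for v
  have s1: "sgn1 1" "sgn1 (-1)" by simp_all
  note dW = dressed_derivative[OF s1(1) b[OF evD(1) s1(1)] b[OF evD(2) s1(1)] evD(3,4) evD(20,21,7,8,5,18)]
  note dV = dressed_derivative[OF s1(2) b[OF evD(1) s1(2)] b[OF evD(2) s1(2)] evD(3,4) evD(22,23,9,10,6,19)]
  have LA: "tderiv v L = tcomm (A v) L" and LiA: "tderiv v Li = tcomm (A v) Li" for v
    unfolding L_def Li_def A_def by (rule dW dV)+
  have Lk: "tpow L k = tmul (tmul W (tLam (int k))) Wi" for k
    unfolding L_def using tpow_dressed[of 1 W Wi 1 k] evD by simp
  have Lik: "tpow Li k = tmul (tmul V (tLam (- int k))) Vi" for k
    unfolding Li_def using tpow_dressed[of "-1" V Vi "-1" k] evD by simp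
  have up: "A v m i j = pos_ind v * tmul (tmul W (tLam (time_degree v))) Wi m i j" if "i \<le> j" for v m i j
  proof -
    \<comment> \<open>The diagonal of \<open>W\<close> does not depend on the times, so
      differentiation removes it.\<close>
    have "supp_le 1 (-1) (tderiv v W r)" for r
      unfolding supp_le_def tderiv_apply
    proof (intro allI impI)
      fix i j :: int assume "- 1 < 1 * (j - i)"
      hence "W (add_mset v r) i j = 0"
        using supp_leD[OF evD(11)[rule_format], of j i "add_mset v r"] evD(15)[of "add_mset v r" i]
        by (cases "i = j") (auto simp: tconst_apply)
      thus "of_nat (Suc (count r v)) * W (add_mset v r) i j = 0" by simp
    qed
    hence "\<forall>m. supp_le 1 (-1 + 0) (tmul (tderiv v W) Wi m)"
      using evD(12) by (intro supp_le_tmul) auto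
    from supp_leD[OF this[rule_format], of j i m] that have "tmul (tderiv v W) Wi m i j = 0" by simp
    thus ?thesis by (simp add: dW(1) A_def tscale_def)
  qed
  have lo: "A v m i j = neg_ind v * tmul (tmul V (tLam (time_degree v))) Vi m i j" if "j < i" for v m i j
  proof -
    have "supp_le (-1) 0 (tderiv v V r)" for r
      unfolding tderiv_apply using evD(13) by (intro supp_le_scale) auto
    hence "\<forall>m. supp_le (-1) (0 + 0) (tmul (tderiv v V) Vi m)"
      using evD(14) by (intro supp_le_tmul) auto
    from supp_leD[OF this[rule_format], of j i m] that have "tmul (tderiv v V) Vi m i j = 0" by simp
    thus ?thesis by (simp add: dV(1) A_def tscale_def)
  qed
  have pos: "A (Tpos k) = upper_part (tpow L (Suc k))" for k
  proof (intro ext)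
    fix m i j
    show "A (Tpos k) m i j = upper_part (tpow L (Suc k)) m i j"
      using up[of i j "Tpos k" m] lo[of j i "Tpos k" m] unfolding Lk upper_part_def
      by (cases "i \<le> j") auto
  qed
  have neg: "A (Tneg k) = strict_lower_part (tpow Li (Suc k))" for k
  proof (intro ext)
    fix m i j
    show "A (Tneg k) m i j = strict_lower_part (tpow Li (Suc k)) m i j"
      using up[of i j "Tneg k" m] lo[of j i "Tneg k" m] unfolding Lik strict_lower_part_def
      by (cases "i \<le> j") auto
  qed
  show ?thesis
    unfolding toda_lax_def Let_def L_def[symmetric] Li_def[symmetric] pos[symmetric] neg[symmetric]
    using LA LiA by simp
qed

section \<open>Reductions\<close>

text \<open>Both evolved matrices carry the same exponential, which commutes with \<Lambda> and can
  be cancelled. A band relation at time zero therefore persists, with \<open>X0\<close> replaced by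
  \<open>G' X0 G^-1\<close>.\<close>

lemma transport:
  assumes s: "sgn1 s"
    and G: "t_banded G'" "t_banded Gi" "t_banded G" "tmul Gi G = tone"
    and M: "t_one_sided s M" "t_one_sided s M'" "one_sided s M0" "one_sided s M0'"
    and ME: "tmul M (time_exp c) = tmul G (tconst M0)" "tmul M' (time_exp c) = tmul G' (tconst M0')"
    and X0: "banded X0" "mmul X0 M0 = (\<lambda>i j. \<kappa> * mmul M0' (Lam r) i j)"
  shows "tmul (tmul G' (tmul (tconst X0) Gi)) M = tscale \<kappa> (tmul M' (tLam r))"
proof -
  define E F where "E = time_exp c" and "F = time_exp (\<lambda>v. - c v)"
  define Z where "Z = tmul G' (tmul (tconst X0) Gi)"
  have oE: "t_one_sided s E" "t_one_sided s F"
    unfolding E_def F_def using s by (auto intro: t_banded_one_sided)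
  have EF: "tmul E F = tone" by (simp add: E_def F_def tmul_time_exp_inverse)
  have oM0: "t_one_sided s (tconst M0)" "t_one_sided s (tconst M0')" "t_one_sided s (tconst X0)"
    using M X0 s by (auto intro: banded_one_sided)
  have oL: "t_one_sided s (tLam k)" for k by (intro t_one_sided_tconst one_sided_Lam)
  have oG: "t_one_sided s G'" "t_one_sided s Gi" "t_one_sided s G" "t_one_sided s Z"
    unfolding Z_def using G s oM0 by (auto intro: t_banded_one_sided)
  note o = M(1,2) oE oM0 oL oG t_one_sided_tmul t_one_sided_tscale
  note assoc = tmul_assoc[OF s]
  have comm: "tmul E (tLam r) = tmul (tLam r) E" by (simp add: E_def tLam_time_exp_commute)
  have "tmul (tmul Z M) E = tmul Z (tmul G (tconst M0))"
    using ME by (simp add: assoc o E_def[symmetric])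
  also have "\<dots> = tmul G' (tmul (tconst X0) (tconst M0))"
    unfolding Z_def by (simp add: assoc o tmul_cancel_left[OF s G(4)])
  also have "tmul (tconst X0) (tconst M0) = tscale \<kappa> (tmul (tconst M0') (tLam r))"
    unfolding tmul_tconst X0(2) by (auto simp: tconst_apply tscale_def fun_eq_iff)
  also have "tmul G' \<dots> = tscale \<kappa> (tmul (tmul G' (tconst M0')) (tLam r))"
    by (simp add: tmul_tscale_right assoc o)
  also have "tmul G' (tconst M0') = tmul M' E" by (simp add: ME E_def)
  also have "tmul (tmul M' E) (tLam r) = tmul M' (tmul (tLam r) E)"
    by (simp add: assoc o comm)
  also have "tscale \<kappa> \<dots> = tmul (tscale \<kappa> (tmul M' (tLam r))) E"
    by (simp add: tmul_tscale_left assoc o)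
  finally have "tmul (tmul (tmul Z M) E) F = tmul (tmul (tscale \<kappa> (tmul M' (tLam r))) E) F" by simp
  thus ?thesis by (simp add: assoc o EF Z_def[symmetric])
qed

lemma B_formI:
  assumes "\<forall>m. supp_le 1 (int a) (B m)" "\<forall>m. supp_le (-1) 0 (B m)"
    and "\<And>m i. B m i (i + int a) = tone m i i"
  shows "B_form a B"
  unfolding B_form_def
proof (intro exI ext)
  fix m i j
  define \<beta> where "\<beta> = (\<lambda>s m i. B m i (i + int a - int s))"
  have t: "tmul (tdiag (\<beta> s)) (tLam (int a - int s)) m i j =
      (if j = i + int a - int s then B m i j else 0)" for s
    unfolding tmul_tLam_right by (auto simp: tdiag_def mdiag_def \<beta>_def)
  have "(\<Sum>s=1..a. tmul (tdiag (\<beta> s)) (tLam (int a - int s)) m i j) =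
      (\<Sum>s\<in>{1..a} \<inter> {nat (i + int a - j)}. if j = i + int a - int s then B m i j else 0)"
    unfolding t by (rule sum.mono_neutral_right) auto
  also have "\<dots> = (if i \<le> j \<and> j < i + int a then B m i j else 0)"
    by (cases "nat (i + int a - j) \<in> {1..a}") auto
  finally have sum: "(\<Sum>s=1..a. tmul (tdiag (\<beta> s)) (tLam (int a - int s)) m i j) =
      (if i \<le> j \<and> j < i + int a then B m i j else 0)" .
  show "B m i j = tLam (int a) m i j +
      (\<Sum>s=1..a. tmul (tdiag (\<beta> s)) (tLam (int a - int s)) m i j)"
    unfolding sum
    using supp_leD[OF assms(1)[rule_format], of j i m] supp_leD[OF assms(2)[rule_format], of j i m]
      assms(3)[of m i]
    by (auto simp: tconst_apply Lam_def not_le not_less)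
qed

lemma C_formI:
  assumes "\<forall>m. supp_le 1 0 (C m)" "\<forall>m. supp_le (-1) (int b) (C m)"
    and "\<And>m i. C m i i = tone m i i"
  shows "C_form b C"
  unfolding C_form_def
proof (intro exI ext)
  fix m i j
  define \<gamma> where "\<gamma> = (\<lambda>s m i. C m i (i - int s))"
  have t: "tmul (tdiag (\<gamma> s)) (tLam (- int s)) m i j =
      (if j = i - int s then C m i j else 0)" for s
    unfolding tmul_tLam_right by (auto simp: tdiag_def mdiag_def \<gamma>_def)
  have "(\<Sum>s=1..b. tmul (tdiag (\<gamma> s)) (tLam (- int s)) m i j) =
      (\<Sum>s\<in>{1..b} \<inter> {nat (i - j)}. if j = i - int s then C m i j else 0)"
    unfolding t by (rule sum.mono_neutral_right) auto
  also have "\<dots> = (if i - int b \<le> j \<and> j < i then C m i j else 0)"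
    by (cases "nat (i - j) \<in> {1..b}") auto
  finally have sum: "(\<Sum>s=1..b. tmul (tdiag (\<gamma> s)) (tLam (- int s)) m i j) =
      (if i - int b \<le> j \<and> j < i then C m i j else 0)" .
  show "C m i j = tone m i j +
      (\<Sum>s=1..b. tmul (tdiag (\<gamma> s)) (tLam (- int s)) m i j)"
    unfolding sum
    using supp_leD[OF assms(1)[rule_format], of j i m] supp_leD[OF assms(2)[rule_format], of j i m]
      assms(3)[of m i]
    by (auto simp: tconst_apply Lam_def not_le not_less)
qed

lemma mmul_lower_diag:
  assumes "supp_le 1 0 A" "supp_le 1 0 B"
  shows "mmul A B i i = A i i * B i i"
proof -
  have "mmul A B i i = infsum (\<lambda>k. A i k * B k i) {i}"
    unfolding mmul_def
  proof (rule infsum_cong_neutral)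
    fix k assume "k \<in> UNIV - {i}"
    hence "i < k \<or> k < i" by auto
    thus "A i k * B k i = 0" using supp_leD[OF assms(1), of k i] supp_leD[OF assms(2), of i k] by auto
  qed auto
  thus ?thesis by simp
qed

lemma tmul_lower_diag:
  assumes "\<forall>m. supp_le 1 0 (A m)" "\<forall>m. supp_le 1 0 (B m)" "\<And>m i. A m i i = tone m i i"
  shows "tmul A B m i i = B m i i"
proof -
  have "tmul A B m i i = (\<Sum>p | p \<subseteq># m. A p i i * B (m - p) i i)"
    using assms by (simp add: tmul_apply sum_fun_apply mmul_lower_diag)
  also have "\<dots> = (\<Sum>p\<in>{{#}}. A p i i * B (m - p) i i)"
    by (rule sum.mono_neutral_right) (auto simp: assms(3) tconst_apply)
  finally show ?thesis by (simp add: assms(3) Lam_def)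
qed

lemma evolution_inverse_diag:
  assumes "evolution W0 V0 G Gi W Wi V Vi"
  shows "Wi m i i = tone m i i"
  using tmul_lower_diag[of W Wi m i] evolutionD[OF assms] by simp

lemma band_factor:
  assumes "t_one_sided s Z" "t_one_sided s M" "t_one_sided s Mi" "sgn1 s"
    and "tmul M Mi = tone" "tmul Z M = K"
  shows "Z = tmul K Mi"
  using tmul_assoc[of s Z M Mi] assms by simp

text \<open>One representation yields lower triangularity and the unit diagonal, the other at most
  \<open>b\<close> subdiagonals. Both are used because \<open>t_banded\<close> bounds the width only
  monomial by monomial.\<close>

lemma C_form_factor:
  assumes ev: "evolution W0 V0 G Gi W Wi V Vi" and ev': "evolution W0' V0' G' Gi' W' Wi' V' Vi'"
    and C_eq: "C = tmul W Wi'" "C = tmul (tscale d (tmul V (tLam (- int b)))) Vi'"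
  shows "C_form b C"
proof (rule C_formI)
  note evD = evolutionD[OF ev] and evD' = evolutionD[OF ev']
  show "\<forall>m. supp_le 1 0 (C m)"
    unfolding C_eq(1) using supp_le_tmul[OF evD(11) evD'(12)] by simp
  have "\<forall>m. supp_le (-1) (int b) (tscale d (tmul V (tLam (- int b))) m)"
    unfolding tscale_apply using supp_le_tmul[OF evD(13) supp_le_tLam[of "-1" "- int b"]]
    by (auto intro: supp_le_scale)
  from supp_le_tmul[OF this evD'(14)] show "\<forall>m. supp_le (-1) (int b) (C m)"
    unfolding C_eq(2) by simp
  show "C m i i = tone m i i" for m i
    unfolding C_eq(1) using tmul_lower_diag[of W Wi' m i] evD evD' evolution_inverse_diag[OF ev'] by simp
qed

text \<open>A second evolution, started from band multiples of the initial data of the first one, provides the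
  factors \<open>B\<close> and \<open>C\<close> at all times.\<close>

locale evolution_pair =
  fixes W0 V0 :: cmat and G Gi W Wi V Vi :: tmat
    and W0' V0' :: cmat and G' Gi' W' Wi' V' Vi' :: tmat
    and a b :: nat and B0 C0 :: cmat and D :: complex
  assumes ev: "evolution W0 V0 G Gi W Wi V Vi"
    and ev': "evolution W0' V0' G' Gi' W' Wi' V' Vi'"
    and band: "banded B0" "banded C0"
    and D: "D \<noteq> 0"
    and B0: "mmul B0 W0' = mmul W0 (Lam (int a))" "mmul B0 V0' = V0"
begin

abbreviation "L \<equiv> tmul (tmul W (tLam 1)) Wi"
abbreviation "Li \<equiv> tmul (tmul V (tLam (- 1))) Vi"

lemmas evD = evolutionD[OF ev]
lemmas evD' = evolutionD[OF ev']

lemma L_pow: "tpow L n = tmul (tmul W (tLam (int n))) Wi"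
  using tpow_dressed[of 1 W Wi 1 n] evD by simp

lemma Li_pow: "tpow Li n = tmul (tmul V (tLam (- int n))) Vi"
  using tpow_dressed[of "-1" V Vi "-1" n] evD by simp

definition "B = tmul G (tmul (tconst B0) Gi')"

lemma t_banded_B: "t_banded B"
  unfolding B_def using evD evD' band by blast

lemma B_W': "tmul B W' = tmul W (tLam (int a))"
  unfolding B_def
  using transport[of 1 G Gi' G' W' W W0' W0 pos_ind B0 1 "int a"] evD evD' B0 band by simp

lemma B_V': "tmul B V' = V"
  unfolding B_def
  using transport[of "-1" G Gi' G' V' V V0' V0 neg_ind B0 1 0] evD evD' B0 band by simp

text \<open>Resolving \<open>B\<close> through \<open>W'\<close> bounds it from above by the
  diagonal \<open>a\<close>; resolving it through \<open>V'\<close> excludes entries below the main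
  diagonal.\<close>

lemma B_eq: "B = tmul (tmul W (tLam (int a))) Wi'" "B = tmul V Vi'"
  by (rule band_factor[OF t_banded_one_sided[OF t_banded_B, of 1] evD'(20,21) _ evD'(7) B_W'], simp_all)
     (rule band_factor[OF t_banded_one_sided[OF t_banded_B, of "-1"] evD'(22,23) _ evD'(9) B_V'], simp_all)

lemma B_form: "B_form a B"
proof (rule B_formI)
  show "\<forall>m. supp_le 1 (int a) (B m)"
    unfolding B_eq(1)
    using supp_le_tmul[OF supp_le_tmul[OF evD(11) supp_le_tLam[of 1 "int a"]] evD'(12)] by simp
  show "\<forall>m. supp_le (-1) 0 (B m)"
    unfolding B_eq(2) using supp_le_tmul[OF evD(13) evD'(14)] by simp
  show "B m i (i + int a) = tone m i i" for m i
  proof -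
    \<comment> \<open>The leading coefficient is read off after the diagonal \<open>a\<close> has
      been shifted onto the main one, where \<open>tmul_lower_diag\<close> applies.\<close>
    have "B = tmul W (tmul (tLam (int a)) Wi')"
      unfolding B_eq(1) using evD evD' t_one_sided_tconst[OF one_sided_Lam]
      by (intro tmul_assoc[of 1]) auto
    hence "tmul B (tLam (- int a)) = tmul W (tmul (tmul (tLam (int a)) Wi') (tLam (- int a)))"
      using evD evD' t_one_sided_tconst[OF one_sided_Lam]
      by (simp add: tmul_assoc[of 1] t_one_sided_tmul)
    moreover have "supp_le 1 0 (tmul (tmul (tLam (int a)) Wi') (tLam (- int a)) m)" for m
      unfolding tmul_tLam_right tmul_tLam_left using evD'(12) by (auto simp: supp_le_def)
    moreover have "tmul (tmul (tLam (int a)) Wi') (tLam (- int a)) m i i = tone m i i" for m i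
      unfolding tmul_tLam_right tmul_tLam_left using evolution_inverse_diag[OF ev', of m "i + int a"]
      by (simp add: tconst_apply Lam_def)
    ultimately have "tmul B (tLam (- int a)) m i i = tone m i i"
      using tmul_lower_diag[of W "tmul (tmul (tLam (int a)) Wi') (tLam (- int a))" m i] evD by simp
    thus ?thesis by (simp add: tmul_tLam_right)
  qed
qed

text \<open>\<open>C\<close> takes the first solution to the second and \<open>B\<close> takes it
  back. The round trip \<open>B C\<close> acts on \<open>W\<close> as the right shift
  \<open>\<Lambda>^a\<close> and on \<open>V\<close> as a multiple of \<open>\<Lambda>^(-b)\<close>,
  hence equals both Lax expressions.\<close>

lemma bigraded_reduction:
  assumes C0: "mmul C0 W0 = W0'" "mmul C0 V0 = (\<lambda>i j. inverse D * mmul V0' (Lam (- int b)) i j)"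
  shows "\<exists>C. C_form b C \<and> tpow L a = tscale (inverse D) (tpow Li b) \<and>
    tscale (inverse D) (tpow Li b) = tmul B C"
proof -
  define C where "C = tmul G' (tmul (tconst C0) Gi)"
  have bC: "t_banded C" unfolding C_def using evD evD' band by blast
  have CW: "tmul C W = W'"
    unfolding C_def
    using transport[of 1 G' Gi G W W' W0 W0' pos_ind C0 1 0] evD evD' C0 band by simp
  have CV: "tmul C V = tscale (inverse D) (tmul V' (tLam (- int b)))"
    unfolding C_def
    using transport[of "-1" G' Gi G V V' V0 V0' neg_ind C0 "inverse D" "- int b"] evD evD' C0 band by simp
  have C_eq: "C = tmul W' Wi" "C = tmul (tscale (inverse D) (tmul V' (tLam (- int b)))) Vi"
    by (rule band_factor[OF t_banded_one_sided[OF bC, of 1] evD(20,21) _ evD(7) CW], simp_all)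
       (rule band_factor[OF t_banded_one_sided[OF bC, of "-1"] evD(22,23) _ evD(9) CV], simp_all)
  have "C_form b C" by (rule C_form_factor[OF ev' ev C_eq])
  moreover have "tpow L a = tmul B C"
    unfolding L_pow C_eq(1) B_W'[symmetric] using evD evD' t_banded_B
    by (intro tmul_assoc[of 1]) (auto intro: t_banded_one_sided)
  moreover have "tscale (inverse D) (tpow Li b) = tmul B C"
  proof -
    have oL: "t_one_sided (-1) (tLam k)" for k by (intro t_one_sided_tconst one_sided_Lam)
    have oB: "t_one_sided (-1) B" using t_banded_B by (auto intro: t_banded_one_sided)
    have "tmul B C = tscale (inverse D) (tmul B (tmul (tmul V' (tLam (- int b))) Vi))"
      unfolding C_eq(2) by (simp add: tmul_tscale_left tmul_tscale_right)
    also have "tmul B (tmul (tmul V' (tLam (- int b))) Vi) = tmul (tmul (tmul B V') (tLam (- int b))) Vi"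
      using evD evD' oL oB by (simp add: tmul_assoc[of "-1"] t_one_sided_tmul)
    finally show ?thesis by (simp add: Li_pow B_V')
  qed
  ultimately show ?thesis by auto
qed

text \<open>Here \<open>B\<close> and \<open>C\<close> both map the second solution to the first,
  \<open>B\<close> with a shift on \<open>W'\<close> and \<open>C\<close> with a shift on
  \<open>V'\<close>; so the Lax operators become quotients instead of products.\<close>

lemma rational_reduction:
  assumes C0: "mmul C0 W0' = W0" "mmul C0 V0' = (\<lambda>i j. inverse D * mmul V0 (Lam (- int b)) i j)"
  shows "\<exists>C Bi Ci. C_form b C \<and> upper_inverse B Bi \<and> lower_inverse C Ci \<and>
    tpow L a = tmul B Ci \<and> tpow Li b = tscale D (tmul C Bi)"
proof -
  define C where "C = tmul G (tmul (tconst C0) Gi')"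
  have bC: "t_banded C" unfolding C_def using evD evD' band by blast
  have CW: "tmul C W' = W"
    unfolding C_def
    using transport[of 1 G Gi' G' W' W W0' W0 pos_ind C0 1 0] evD evD' C0 band by simp
  have CV: "tmul C V' = tscale (inverse D) (tmul V (tLam (- int b)))"
    unfolding C_def
    using transport[of "-1" G Gi' G' V' V V0' V0 neg_ind C0 "inverse D" "- int b"] evD evD' C0 band by simp
  have C_eq: "C = tmul W Wi'" "C = tmul (tscale (inverse D) (tmul V (tLam (- int b)))) Vi'"
    by (rule band_factor[OF t_banded_one_sided[OF bC, of 1] evD'(20,21) _ evD'(7) CW], simp_all)
       (rule band_factor[OF t_banded_one_sided[OF bC, of "-1"] evD'(22,23) _ evD'(9) CV], simp_all)
  have "C_form b C" by (rule C_form_factor[OF ev ev' C_eq])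
  moreover have "lower_inverse C (tmul W' Wi)"
    unfolding lower_inverse_def is_lower_supp
  proof (intro conjI allI)
    show "supp_le 1 0 (tmul W' Wi m)" for m using supp_le_tmul[OF evD'(11) evD(12)] by simp
    show "tmul C (tmul W' Wi) = tone" "tmul (tmul W' Wi) C = tone"
      unfolding C_eq(1) using evD evD'
      by (simp_all add: tmul_assoc[of 1] t_one_sided_tmul tmul_cancel_left[of 1 Wi' W'] tmul_cancel_left[of 1 Wi W])
  qed
  moreover have "upper_inverse B (tmul V' Vi)"
    unfolding upper_inverse_def is_upper_supp
  proof (intro conjI allI)
    show "supp_le (-1) 0 (tmul V' Vi m)" for m using supp_le_tmul[OF evD'(13) evD(14)] by simp
    show "tmul B (tmul V' Vi) = tone" "tmul (tmul V' Vi) B = tone"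
      unfolding B_eq(2) using evD evD'
      by (simp_all add: tmul_assoc[of "-1"] t_one_sided_tmul tmul_cancel_left[of "-1" Vi' V'] tmul_cancel_left[of "-1" Vi V])
  qed
  moreover have "tpow L a = tmul B (tmul W' Wi)"
    unfolding L_pow B_W'[symmetric] using evD evD' t_banded_B
    by (intro tmul_assoc[of 1]) (auto intro: t_banded_one_sided)
  moreover have "tpow Li b = tscale D (tmul C (tmul V' Vi))"
  proof -
    have "tmul C (tmul V' Vi) = tmul (tmul C V') Vi"
      using evD evD' bC by (intro tmul_assoc[of "-1", symmetric]) (auto intro: t_banded_one_sided)
    thus ?thesis using D by (simp add: CV Li_pow tmul_tscale_left tscale_tscale)
  qed
  ultimately show ?thesis by blast
qed

end

section \<open>Bilateral sequences and their convolution\<close>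

definition conv :: "(int \<Rightarrow> complex) \<Rightarrow> (int \<Rightarrow> complex) \<Rightarrow> int \<Rightarrow> complex" where
  "conv f g n = (\<Sum>\<^sub>\<infinity>k. f k * g (n - k))"

definition shift :: "int \<Rightarrow> (int \<Rightarrow> complex) \<Rightarrow> int \<Rightarrow> complex" where
  "shift n f = (\<lambda>k. f (k - n))"

definition up_seq :: "complex fps \<Rightarrow> int \<Rightarrow> complex" where
  "up_seq F n = (if 0 \<le> n then fps_nth F (nat n) else 0)"

definition dn_seq :: "complex fps \<Rightarrow> int \<Rightarrow> complex" where
  "dn_seq F n = (if n \<le> 0 then fps_nth F (nat (- n)) else 0)"

text \<open>The Laurent series \<open>f(\<Lambda>)\<close> between two diagonal matrices, the common
  shape of the data at time zero.\<close>

definition toep :: "(int \<Rightarrow> complex) \<Rightarrow> (int \<Rightarrow> complex) \<Rightarrow> (int \<Rightarrow> complex) \<Rightarrow> cmat" where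
  "toep \<alpha> f \<beta> = (\<lambda>i j. \<alpha> i * f (j - i) * \<beta> j)"

definition fps_dil :: "complex \<Rightarrow> complex fps \<Rightarrow> complex fps" where
  "fps_dil c F = Abs_fps (\<lambda>n. c ^ n * fps_nth F n)"

lemma fps_dil_nth [simp]: "fps_nth (fps_dil c F) n = c ^ n * fps_nth F n"
  by (simp add: fps_dil_def)

lemma fps_dil_mult: "fps_dil c (F * G) = fps_dil c F * fps_dil c G"
proof (rule fps_ext)
  fix n
  have "c ^ n * (\<Sum>i=0..n. fps_nth F i * fps_nth G (n - i)) =
      (\<Sum>i=0..n. (c ^ i * fps_nth F i) * (c ^ (n - i) * fps_nth G (n - i)))"
    unfolding sum_distrib_left
    by (intro sum.cong refl) (simp add: power_add[symmetric] mult_ac)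
  thus "fps_nth (fps_dil c (F * G)) n = fps_nth (fps_dil c F * fps_dil c G) n"
    by (simp add: fps_mult_nth)
qed

lemma fps_dil_dil: "fps_dil c (fps_dil d F) = fps_dil (c * d) F"
  by (rule fps_ext) (simp add: power_mult_distrib)

lemma fps_dil_one [simp]: "fps_dil 1 F = F" "fps_dil c 1 = 1"
  by (auto intro!: fps_ext)

lemma fps_dil_linear:
  "fps_dil c (1 - fps_const d * fps_X) = 1 - fps_const (c * d) * fps_X"
  by (auto intro!: fps_ext simp: fps_X_def)

lemma fps_dil_const_mult: "fps_dil c (fps_const d * F) = fps_const d * fps_dil c F"
  by (auto intro!: fps_ext)

lemma powi_up_seq: "y \<noteq> 0 \<Longrightarrow> (\<lambda>n. y powi n * up_seq F n) = up_seq (fps_dil y F)"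
  by (auto simp: up_seq_def fun_eq_iff power_int_def)

lemma powi_dn_seq: "y \<noteq> 0 \<Longrightarrow> (\<lambda>n. y powi n * dn_seq F n) = dn_seq (fps_dil (inverse y) F)"
  by (auto simp: dn_seq_def fun_eq_iff power_int_def)

lemma conv_commute: "conv f g = conv g f"
proof
  fix n show "conv f g n = conv g f n"
    unfolding conv_def
    by (rule infsum_reindex_bij_witness[of _ "\<lambda>k. n - k" "\<lambda>k. n - k"]) auto
qed

lemma conv_shift_left: "conv (shift m f) g = shift m (conv f g)"
proof
  fix n
  show "conv (shift m f) g n = shift m (conv f g) n"
    unfolding conv_def shift_def
    by (rule infsum_reindex_bij_witness[of _ "\<lambda>k. k + m" "\<lambda>k. k - m"]) (auto simp: algebra_simps)
qed

lemma conv_shift_right: "conv f (shift m g) = shift m (conv f g)"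
  using conv_shift_left[of m g f] by (simp add: conv_commute)

lemma shift_shift: "shift m (shift n f) = shift (m + n) f"
  by (simp add: shift_def algebra_simps)

lemma shift_zero [simp]: "shift 0 f = f" by (simp add: shift_def)

lemma dn_seq_one: "dn_seq 1 = (\<lambda>k. of_bool (k = 0))"
  by (auto simp: dn_seq_def fun_eq_iff)

lemma up_seq_one: "up_seq 1 = (\<lambda>k. of_bool (k = 0))"
  by (auto simp: up_seq_def fun_eq_iff)

lemma conv_delta_left: "conv (\<lambda>k. of_bool (k = 0)) g = g"
proof
  fix n
  have "conv (\<lambda>k. of_bool (k = 0)) g n = infsum (\<lambda>k. of_bool (k = 0) * g (n - k)) {0}"
    unfolding conv_def by (rule infsum_cong_neutral) auto
  thus "conv (\<lambda>k. of_bool (k = 0)) g n = g n" by simp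
qed

lemma conv_up_seq: "conv (up_seq F) (up_seq G) = up_seq (F * G)"
proof
  fix n
  show "conv (up_seq F) (up_seq G) n = up_seq (F * G) n"
  proof (cases "0 \<le> n")
    case True
    have "conv (up_seq F) (up_seq G) n = infsum (\<lambda>k. up_seq F k * up_seq G (n - k)) {0..n}"
      unfolding conv_def by (rule infsum_cong_neutral) (auto simp: up_seq_def)
    also have "\<dots> = (\<Sum>k\<in>{0..n}. up_seq F k * up_seq G (n - k))" by simp
    also have "\<dots> = (\<Sum>k=0..nat n. fps_nth F k * fps_nth G (nat n - k))"
      by (rule sum.reindex_bij_witness[of _ int nat])
         (use True in \<open>auto simp: up_seq_def nat_diff_distrib\<close>)
    finally show ?thesis using True by (simp add: up_seq_def fps_mult_nth)
  next
    case False
    hence "conv (up_seq F) (up_seq G) n = infsum (\<lambda>k. 0) (UNIV :: int set)"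
      unfolding conv_def by (intro infsum_cong) (auto simp: up_seq_def)
    thus ?thesis using False by (simp add: up_seq_def)
  qed
qed

lemma dn_seq_reflect: "dn_seq F = (\<lambda>n. up_seq F (- n))"
  by (auto simp: dn_seq_def up_seq_def)

lemma conv_dn_seq: "conv (dn_seq F) (dn_seq G) = dn_seq (F * G)"
proof
  fix n
  have "conv (dn_seq F) (dn_seq G) n = conv (up_seq F) (up_seq G) (- n)"
    unfolding conv_def dn_seq_reflect
    by (rule infsum_reindex_bij_witness[of _ uminus uminus]) auto
  thus "conv (dn_seq F) (dn_seq G) n = dn_seq (F * G) n"
    by (simp add: conv_up_seq dn_seq_reflect)
qed

text \<open>This is the commutation rule of \<open>y^\<Delta>\<close> with \<Lambda>: a geometric
  diagonal factor between two series moves to the left at the price of dilating the left series by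
  \<open>y\<close>.\<close>

lemma toep_mult:
  assumes "y \<noteq> 0" "\<And>m. \<beta> m * \<gamma> m = \<kappa> * y powi m"
  shows "mmul (toep \<alpha> f \<beta>) (toep \<gamma> g \<delta>) =
      toep (\<lambda>i. \<kappa> * y powi i * \<alpha> i) (conv (\<lambda>n. y powi n * f n) g) \<delta>" (is ?A)
    and "(\<And>n. (\<lambda>k. y powi k * f k * g (n - k)) summable_on UNIV) \<Longrightarrow>
      mconv (toep \<alpha> f \<beta>) (toep \<gamma> g \<delta>)" (is "PROP _ \<Longrightarrow> ?B")
proof -
  have t: "toep \<alpha> f \<beta> i (k + i) * toep \<gamma> g \<delta> (k + i) j =
      (\<kappa> * y powi i * \<alpha> i * \<delta> j) * (y powi k * f k * g (j - i - k))" for i j k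
  proof -
    have "toep \<alpha> f \<beta> i (k + i) * toep \<gamma> g \<delta> (k + i) j =
       \<alpha> i * f k * (\<beta> (k + i) * \<gamma> (k + i)) * g (j - (k + i)) * \<delta> j"
      by (simp add: toep_def mult_ac)
    also have "\<beta> (k + i) * \<gamma> (k + i) = \<kappa> * (y powi k * y powi i)"
      using assms by (simp add: power_int_add)
    finally show ?thesis by (simp add: mult_ac diff_diff_eq add.commute)
  qed
  have "mmul (toep \<alpha> f \<beta>) (toep \<gamma> g \<delta>) i j =
      (\<Sum>\<^sub>\<infinity>k. (\<kappa> * y powi i * \<alpha> i * \<delta> j) * (y powi k * f k * g (j - i - k)))" for i j
    unfolding mmul_def t[symmetric]
    by (rule infsum_reindex_bij_witness[of _ "\<lambda>k. k + i" "\<lambda>k. k - i"]) auto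
  thus ?A unfolding infsum_cmult_right' by (simp add: fun_eq_iff toep_def conv_def mult_ac)
  assume s: "\<And>n. (\<lambda>k. y powi k * f k * g (n - k)) summable_on UNIV"
  have "(\<lambda>k. toep \<alpha> f \<beta> i k * toep \<gamma> g \<delta> k j) summable_on UNIV \<longleftrightarrow>
      (\<lambda>k. toep \<alpha> f \<beta> i (k + i) * toep \<gamma> g \<delta> (k + i) j) summable_on UNIV" for i j
    by (rule summable_on_reindex_bij_witness[of _ "\<lambda>k. k + i" "\<lambda>k. k - i"]) auto
  thus ?B unfolding mconv_def t by (auto intro!: summable_on_cmult_right s)
qed

lemma toep_mult_one:
  assumes "\<And>m. \<beta> m * \<gamma> m = 1"
  shows "mmul (toep \<alpha> f \<beta>) (toep \<gamma> g \<delta>) = toep \<alpha> (conv f g) \<delta>"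
    and "(\<And>n. (\<lambda>k. f k * g (n - k)) summable_on UNIV) \<Longrightarrow> mconv (toep \<alpha> f \<beta>) (toep \<gamma> g \<delta>)"
  using toep_mult(1)[of 1 \<beta> \<gamma> 1 \<alpha> f g \<delta>] assms
  by (simp, intro toep_mult(2)[of 1 \<beta> \<gamma> 1], simp_all)

lemma ser_up_toep: "ser_up F = toep (\<lambda>_. 1) (up_seq F) (\<lambda>_. 1)"
  by (auto simp: ser_up_def toep_def up_seq_def fun_eq_iff)

lemma ser_down_toep: "ser_down F = toep (\<lambda>_. 1) (dn_seq F) (\<lambda>_. 1)"
  by (auto simp: ser_down_def toep_def dn_seq_def fun_eq_iff)

lemma supp_le_toep_dn: "supp_le 1 0 (toep \<alpha> (dn_seq F) \<beta>)"
  by (auto simp: supp_le_def toep_def dn_seq_def)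

lemma supp_le_toep_up: "supp_le (-1) 0 (toep \<alpha> (up_seq F) \<beta>)"
  by (auto simp: supp_le_def toep_def up_seq_def)

text \<open>Absolute convergence of the Laurent series on the circle of radius \<open>r\<close>. For
  fixed \<open>r\<close> these sequences form a commutative algebra under \<open>conv\<close>, so
  upward and downward series can be mixed freely.\<close>

definition l1_seq :: "real \<Rightarrow> (int \<Rightarrow> complex) \<Rightarrow> bool" where
  "l1_seq r f \<longleftrightarrow> (\<lambda>n. norm (f n) * r powi n) summable_on UNIV"

lemma l1_seq_bound:
  assumes "l1_seq r f" "r > 0"
  obtains M where "\<And>n. norm (f n) \<le> M * r powi (- n)"
proof -
  define M where "M = (\<Sum>\<^sub>\<infinity>n. norm (f n) * r powi n)"
  have "norm (f n) \<le> M * r powi (- n)" for n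
  proof -
    have "(\<Sum>k\<in>{n}. norm (f k) * r powi k) \<le> M"
      unfolding M_def using assms
      by (intro finite_sum_le_infsum) (auto simp: l1_seq_def less_imp_le)
    hence "norm (f n) * r powi n * r powi (- n) \<le> M * r powi (- n)"
      using assms by (intro mult_right_mono) (auto simp: less_imp_le)
    thus ?thesis using assms by (simp add: power_int_minus mult.assoc)
  qed
  thus thesis using that by blast
qed

text \<open>In the variables \<open>(l, k - l)\<close> the family is the product of two summable
  ones.\<close>

lemma l1_seq_double:
  assumes f: "l1_seq r f" and g: "l1_seq r g" and r: "r > 0"
  shows "(\<lambda>(l, k). norm (f l) * norm (g (k - l)) * r powi k) summable_on UNIV \<times> UNIV"
proof -
  let ?F = "\<lambda>n. norm (f n) * r powi n" and ?G = "\<lambda>n. norm (g n) * r powi n"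
  have nn: "norm (?F n * c) = ?F n * norm c" for n and c :: real using r by (simp add: abs_mult)
  have e: "norm (case (x, y) of (l, m) \<Rightarrow> ?F l * ?G m) = ?F x * ?G y" for x y
    using r by (simp add: abs_mult)
  have "(\<lambda>x. norm (case x of (l, m) \<Rightarrow> ?F l * ?G m)) summable_on Sigma UNIV (\<lambda>_. UNIV)"
    unfolding Infinite_Sum.abs_summable_on_Sigma_iff
  proof (intro conjI ballI)
    show "(\<lambda>y. norm (case (x, y) of (l, m) \<Rightarrow> ?F l * ?G m)) summable_on UNIV" for x
      using g unfolding l1_seq_def e by (rule summable_on_cmult_right)
    have "(\<Sum>\<^sub>\<infinity>y. norm (case (x, y) of (l, m) \<Rightarrow> ?F l * ?G m)) = ?F x * (\<Sum>\<^sub>\<infinity>y. ?G y)" for x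
      unfolding e by (rule infsum_cmult_right')
    moreover have "(\<lambda>x. norm (?F x * (\<Sum>\<^sub>\<infinity>y. ?G y))) summable_on UNIV"
      unfolding nn using f unfolding l1_seq_def by (rule summable_on_cmult_left)
    ultimately show "(\<lambda>x. norm (\<Sum>\<^sub>\<infinity>y. norm (case (x, y) of (l, m) \<Rightarrow> ?F l * ?G m))) summable_on UNIV"
      by simp
  qed
  hence "(\<lambda>(l, m). ?F l * ?G m) summable_on UNIV \<times> UNIV"
    by (rule abs_summable_summable)
  also have "?this \<longleftrightarrow> ?thesis"
    by (rule summable_on_reindex_bij_witness[of _ "\<lambda>(l,k). (l, k - l)" "\<lambda>(l,m). (l, l + m)"])
       (use r in \<open>auto simp: power_int_add\<close>)
  finally show ?thesis .
qed

lemma conv_summable: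
  assumes f: "l1_seq r f" and g: "l1_seq r g" and r: "r > 0"
  shows "(\<lambda>k. f k * g (n - k)) summable_on UNIV"
proof -
  obtain M where M: "\<And>n. norm (g n) \<le> M * r powi (- n)" using l1_seq_bound[OF g r] by blast
  have "(\<lambda>k. norm (f k * g (n - k))) summable_on UNIV"
  proof (rule Infinite_Sum.abs_summable_on_comparison_test')
    show "(\<lambda>k. norm (f k) * r powi k * (M * r powi (- n))) summable_on UNIV"
      using f unfolding l1_seq_def by (rule summable_on_cmult_left)
    show "norm (f k * g (n - k)) \<le> norm (f k) * r powi k * (M * r powi (- n))" for k
    proof -
      have "norm (f k * g (n - k)) \<le> norm (f k) * (M * r powi (- (n - k)))"
        unfolding norm_mult by (intro mult_left_mono M) auto
      also have "r powi (- (n - k)) = r powi k * r powi (- n)"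
        using r by (simp flip: power_int_add)
      finally show ?thesis by (simp add: mult_ac)
    qed
  qed
  thus ?thesis by (rule abs_summable_summable)
qed

lemma l1_seq_conv:
  assumes f: "l1_seq r f" and g: "l1_seq r g" and r: "r > 0"
  shows "l1_seq r (conv f g)"
proof -
  have sw: "(\<lambda>(k, l). norm (f l) * norm (g (k - l)) * r powi k) summable_on UNIV \<times> UNIV"
    using l1_seq_double[OF assms]
    by (subst (asm) summable_on_reindex_bij_witness[of _ "\<lambda>(a,b). (b,a)" "\<lambda>(a,b). (b,a)" "UNIV \<times> UNIV"
          "\<lambda>(k, l). norm (f l) * norm (g (k - l)) * r powi k"]) auto
  have "(\<lambda>k. \<Sum>\<^sub>\<infinity>l. norm (f l) * norm (g (k - l)) * r powi k) summable_on UNIV"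
    using summable_on_Sigma_banach[OF sw] by simp
  hence "(\<lambda>k. norm (norm (conv f g k) * r powi k)) summable_on UNIV"
  proof (rule Infinite_Sum.abs_summable_on_comparison_test')
    fix k
    have "(\<lambda>l. norm (f l * g (k - l))) summable_on UNIV"
      using conv_summable[OF assms] unfolding summable_on_iff_abs_summable_on_complex .
    hence "norm (conv f g k) \<le> (\<Sum>\<^sub>\<infinity>l. norm (f l * g (k - l)))"
      unfolding conv_def by (rule norm_infsum_bound)
    thus "norm (norm (conv f g k) * r powi k) \<le> (\<Sum>\<^sub>\<infinity>l. norm (f l) * norm (g (k - l)) * r powi k)"
      using r by (simp add: abs_mult infsum_cmult_left' norm_mult)
  qed
  thus ?thesis using r by (simp add: l1_seq_def abs_mult)
qed

text \<open>For fixed \<open>n\<close> the value \<open>h (n - k)\<close> is at most a multiple of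
  \<open>r^k\<close>, so \<open>l1_seq_double\<close> dominates the double series and the sums may
  be interchanged.\<close>

lemma conv_assoc:
  assumes f: "l1_seq r f" and g: "l1_seq r g" and h: "l1_seq r h" and r: "r > 0"
  shows "conv (conv f g) h = conv f (conv g h)"
proof
  fix n
  let ?t = "\<lambda>l k. f l * g (k - l) * h (n - k)"
  obtain M where M: "\<And>n. norm (h n) \<le> M * r powi (- n)" using l1_seq_bound[OF h r] by blast
  have sm: "(\<lambda>(k, l). ?t l k) summable_on UNIV \<times> UNIV"
  proof -
    have "(\<lambda>x. norm ((\<lambda>(l, k). ?t l k) x)) summable_on UNIV \<times> UNIV"
    proof (rule Infinite_Sum.abs_summable_on_comparison_test')
      show "(\<lambda>x. (\<lambda>(l, k). norm (f l) * norm (g (k - l)) * r powi k) x * (M * r powi (- n)))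
          summable_on UNIV \<times> UNIV"
        by (rule summable_on_cmult_left, rule l1_seq_double[OF f g r])
      fix x :: "int \<times> int"
      obtain l k where x: "x = (l, k)" by (cases x)
      have "norm (?t l k) \<le> norm (f l) * norm (g (k - l)) * (M * r powi (- (n - k)))"
        unfolding norm_mult by (intro mult_left_mono M) auto
      also have "r powi (- (n - k)) = r powi k * r powi (- n)"
        using r by (simp flip: power_int_add)
      finally show "norm ((\<lambda>(l, k). ?t l k) x) \<le>
          (\<lambda>(l, k). norm (f l) * norm (g (k - l)) * r powi k) x * (M * r powi (- n))"
        by (simp add: x mult_ac)
    qed
    hence "(\<lambda>(l, k). ?t l k) summable_on UNIV \<times> UNIV" by (rule abs_summable_summable)
    thus ?thesis
      by (subst summable_on_reindex_bij_witness[of _ "\<lambda>(a,b). (b,a)" "\<lambda>(a,b). (b,a)" "UNIV \<times> UNIV"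
          "\<lambda>(l, k). ?t l k"]) auto
  qed
  have "conv (conv f g) h n = (\<Sum>\<^sub>\<infinity>k. \<Sum>\<^sub>\<infinity>l. ?t l k)"
    by (simp add: conv_def infsum_cmult_left')
  also have "\<dots> = (\<Sum>\<^sub>\<infinity>l. \<Sum>\<^sub>\<infinity>k. ?t l k)"
    by (rule infsum_swap_banach[OF sm])
  also have "\<dots> = (\<Sum>\<^sub>\<infinity>l. f l * conv g h (n - l))"
  proof (rule infsum_cong)
    fix l
    have "(\<Sum>\<^sub>\<infinity>k. ?t l k) = (\<Sum>\<^sub>\<infinity>m. f l * (g m * h (n - l - m)))"
      by (rule infsum_reindex_bij_witness[of _ "\<lambda>m. m + l" "\<lambda>k. k - l"]) (auto simp: algebra_simps)
    thus "(\<Sum>\<^sub>\<infinity>k. ?t l k) = f l * conv g h (n - l)"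
      by (simp add: infsum_cmult_right' conv_def)
  qed
  finally show "conv (conv f g) h n = conv f (conv g h) n" by (simp add: conv_def[of f])
qed

section \<open>Absolutely summable power series\<close>

definition fps_summable :: "real \<Rightarrow> complex fps \<Rightarrow> bool" where
  "fps_summable r F \<longleftrightarrow> summable (\<lambda>n. norm (fps_nth F n) * r ^ n)"

lemma fps_summable_mono:
  assumes "fps_summable r F" "0 \<le> s" "s \<le> r"
  shows "fps_summable s F"
  unfolding fps_summable_def
proof (rule summable_comparison_test')
  show "summable (\<lambda>n. norm (fps_nth F n) * r ^ n)" using assms by (simp add: fps_summable_def)
  show "norm (norm (fps_nth F n) * s ^ n) \<le> norm (fps_nth F n) * r ^ n" if "n \<ge> 0" for n
    using assms by (auto simp: abs_mult intro!: mult_left_mono power_mono)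
qed

lemma fps_summable_one: "fps_summable r 1"
  unfolding fps_summable_def by (rule summable_finite[of "{0}"]) auto

lemma fps_summable_dil: "fps_summable r (fps_dil c F) \<longleftrightarrow> fps_summable (norm c * r) F"
  unfolding fps_summable_def by (simp add: norm_mult norm_power power_mult_distrib mult_ac)

lemma fps_summable_mult:
  assumes "fps_summable r F" "fps_summable r G" "r \<ge> 0"
  shows "fps_summable r (F * G)"
proof -
  let ?a = "\<lambda>n. norm (fps_nth F n) * r ^ n" and ?b = "\<lambda>n. norm (fps_nth G n) * r ^ n"
  have "summable (\<lambda>n. \<Sum>i\<le>n. ?a i * ?b (n - i))"
    using assms by (intro summable_Cauchy_product) (auto simp: fps_summable_def abs_mult)
  thus ?thesis unfolding fps_summable_def
  proof (rule summable_comparison_test')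
    fix n :: nat
    have "norm (fps_nth (F * G) n) \<le> (\<Sum>i=0..n. norm (fps_nth F i) * norm (fps_nth G (n - i)))"
      unfolding fps_mult_nth by (rule sum_norm_le) (simp add: norm_mult)
    hence "norm (fps_nth (F * G) n) * r ^ n \<le>
        (\<Sum>i=0..n. norm (fps_nth F i) * norm (fps_nth G (n - i))) * r ^ n"
      using assms by (intro mult_right_mono) auto
    also have "\<dots> = (\<Sum>i\<le>n. ?a i * ?b (n - i))"
      unfolding sum_distrib_right atLeast0AtMost
    proof (intro sum.cong refl)
      fix i assume "i \<in> {..n}"
      hence "r ^ n = r ^ i * r ^ (n - i)" by (simp flip: power_add)
      thus "norm (fps_nth F i) * norm (fps_nth G (n - i)) * r ^ n = ?a i * ?b (n - i)"
        by (simp add: mult_ac)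
    qed
    finally show "norm (norm (fps_nth (F * G) n) * r ^ n) \<le> (\<Sum>i\<le>n. ?a i * ?b (n - i))"
      using assms by (simp add: abs_mult)
  qed
qed

lemma fps_summable_prod_list:
  "(\<And>F. F \<in> set Fs \<Longrightarrow> fps_summable r F) \<Longrightarrow> r \<ge> 0 \<Longrightarrow> fps_summable r (prod_list Fs)"
  by (induction Fs) (auto simp: fps_summable_one fps_summable_mult)

lemma fps_summable_ratio:
  assumes "\<And>n. fps_nth F (Suc n) = \<rho> n * fps_nth F n" "(\<lambda>n. norm (\<rho> n)) \<longlonglongrightarrow> l" "l * r < 1" "r \<ge> 0"
  shows "fps_summable r F"
proof -
  obtain c where c: "l * r < c" "c < 1" using assms(3) dense by blast
  have "(\<lambda>n. norm (\<rho> n) * r) \<longlonglongrightarrow> l * r" by (intro tendsto_intros assms)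
  hence "eventually (\<lambda>n. norm (\<rho> n) * r < c) sequentially" using c by (intro order_tendstoD)
  then obtain N where N: "\<And>n. n \<ge> N \<Longrightarrow> norm (\<rho> n) * r < c" by (auto simp: eventually_sequentially)
  show ?thesis unfolding fps_summable_def
  proof (rule summable_ratio_test[OF c(2), of N])
    fix n assume "n \<ge> N"
    have "norm (fps_nth F (Suc n)) * r ^ Suc n = (norm (\<rho> n) * r) * (norm (fps_nth F n) * r ^ n)"
      by (simp add: assms(1) norm_mult)
    also have "\<dots> \<le> c * (norm (fps_nth F n) * r ^ n)"
      using N[OF \<open>n \<ge> N\<close>] assms(4) by (intro mult_right_mono) auto
    finally show "norm (norm (fps_nth F (Suc n)) * r ^ Suc n) \<le> c * norm (norm (fps_nth F n) * r ^ n)"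
      using assms(4) by (simp add: abs_mult)
  qed
qed

lemma l1_seq_up:
  assumes "fps_summable r F" "r > 0"
  shows "l1_seq r (up_seq F)"
proof -
  have "(\<lambda>n. norm (fps_nth F n) * r ^ n) summable_on UNIV"
    using assms by (intro summable_nonneg_imp_summable_on) (auto simp: fps_summable_def less_imp_le)
  hence "(\<lambda>n. norm (up_seq F n) * r powi n) summable_on (int ` UNIV)"
    by (subst summable_on_reindex) (auto simp: o_def up_seq_def inj_on_def)
  also have "?this \<longleftrightarrow> l1_seq r (up_seq F)"
    unfolding l1_seq_def
    by (rule summable_on_cong_neutral) (auto simp: up_seq_def image_iff intro: nonneg_int_cases)
  finally show ?thesis .
qed

lemma l1_seq_dn:
  assumes "fps_summable (inverse r) F" "r > 0"
  shows "l1_seq r (dn_seq F)"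
proof -
  have "l1_seq (inverse r) (up_seq F)" using l1_seq_up[of "inverse r" F] assms by simp
  also have "?this \<longleftrightarrow> l1_seq r (dn_seq F)"
    unfolding l1_seq_def dn_seq_reflect
    by (rule summable_on_reindex_bij_witness[of _ uminus uminus])
       (auto simp: power_int_minus power_int_inverse)
  finally show ?thesis .
qed

section \<open>The series of the vertex operators\<close>

lemma fps_dil_inverse_linear:
  "fps_dil c (inverse (1 - fps_const d * fps_X)) = inverse (1 - fps_const (c * d) * fps_X)"
proof -
  have "inverse (1 - fps_const d * fps_X) * (1 - fps_const d * fps_X) = (1 :: complex fps)"
    by (rule inverse_mult_eq_1) simp
  hence "fps_dil c (inverse (1 - fps_const d * fps_X)) * (1 - fps_const (c * d) * fps_X) = 1"
    by (metis fps_dil_linear fps_dil_mult fps_dil_one(2))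
  thus ?thesis by (metis fps_inverse_unique mult.commute)
qed

text \<open>The truncation \<open>N\<close> enters only through \<open>\<rho>\<close>, so every
  coefficient converges by induction on its index, without estimates of the infinite product, and
  the recursion passes to the limit.\<close>

lemma lim_shifted_recursion:
  fixes p :: "nat \<Rightarrow> nat \<Rightarrow> complex"
  assumes "\<And>N. p N 0 = 1" "\<And>N n. d n * p N (Suc n) = \<rho> N n * p N n"
    and "\<And>n. d n \<noteq> 0" "\<And>n. (\<lambda>N. \<rho> N n) \<longlonglongrightarrow> l n"
  shows "lim (\<lambda>N. p N 0) = 1" "d n * lim (\<lambda>N. p N (Suc n)) = l n * lim (\<lambda>N. p N n)"
proof -
  have cv: "convergent (\<lambda>N. p N n)" for n
  proof (induction n)
    case (Suc n)
    have "p N (Suc n) = \<rho> N n * p N n / d n" for N using assms(2)[of n N] assms(3)[of n]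
      by (simp add: field_simps)
    moreover have "(\<lambda>N. \<rho> N n * p N n / d n) \<longlonglongrightarrow> l n * lim (\<lambda>N. p N n) / d n"
      using Suc assms by (intro tendsto_intros) (auto simp: convergent_LIMSEQ_iff)
    ultimately show ?case by (auto simp: convergent_def)
  qed (simp add: assms convergent_const)
  show "lim (\<lambda>N. p N 0) = 1" by (simp add: assms)
  have "(\<lambda>N. d n * p N (Suc n)) \<longlonglongrightarrow> d n * lim (\<lambda>N. p N (Suc n))"
    using cv by (intro tendsto_intros) (auto simp: convergent_LIMSEQ_iff)
  moreover have "(\<lambda>N. d n * p N (Suc n)) \<longlonglongrightarrow> l n * lim (\<lambda>N. p N n)"
    unfolding assms(2) using cv assms(4) by (intro tendsto_intros) (auto simp: convergent_LIMSEQ_iff)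
  ultimately show "d n * lim (\<lambda>N. p N (Suc n)) = l n * lim (\<lambda>N. p N n)" by (rule LIMSEQ_unique)
qed

locale nome =
  fixes q lq :: complex
  assumes q: "exp lq = q" and q_less: "norm q < 1"
begin

definition "sq = exp (lq / 2)"

lemma sq_sq: "sq * sq = q" and sq_nz: "sq \<noteq> 0" and q_nz: "q \<noteq> 0"
proof -
  show "sq * sq = q" unfolding sq_def using q by (simp flip: exp_add)
  show "sq \<noteq> 0" by (simp add: sq_def)
  show "q \<noteq> 0" using q by auto
qed

lemma norm_sq: "norm sq ^ 2 = norm q"
  using sq_sq by (metis norm_mult power2_eq_square)

lemma one_minus_q: "1 - q ^ Suc n \<noteq> 0"
proof
  assume "1 - q ^ Suc n = 0"
  hence "norm (q ^ Suc n) = 1" by simp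
  moreover have "norm (q ^ Suc n) < 1"
    unfolding norm_power using q_less q_nz by (intro power_Suc_less_one) simp_all
  ultimately show False by simp
qed

abbreviation "half_power i \<equiv> exp ((of_nat i - 1 / 2) * lq)"

lemma half_power_Suc: "half_power (Suc i) = q ^ i * sq"
proof -
  have "half_power (Suc i) = exp (of_nat i * lq + lq / 2)" by (simp add: algebra_simps)
  thus ?thesis using q by (simp add: exp_add sq_def exp_of_nat_mult)
qed

lemma q_pow_tendsto: "(\<lambda>N. q ^ N) \<longlonglongrightarrow> 0"
  using q_less by (rule LIMSEQ_power_zero)

lemma Gam_ser_rec:
  "fps_nth (Gam_ser lq) 0 = 1"
  "(1 - q ^ Suc n) * fps_nth (Gam_ser lq) (Suc n) = sq * fps_nth (Gam_ser lq) n"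
proof -
  define p where "p N = (\<Prod>i=1..N. inverse (1 - fps_const (half_power i) * fps_X))" for N
  \<comment> \<open>Replacing \<open>X\<close> by \<open>q X\<close> moves each factor of the finite
    product to the next one, so all factors cancel except the first and the one following the
    last.\<close>
  have fe: "p N * (1 - fps_const sq * fps_X) = fps_dil q (p N) * (1 - fps_const (q ^ N * sq) * fps_X)" for N
  proof (induction N)
    case (Suc N)
    let ?e = "1 - fps_const (q ^ N * sq) * fps_X"
    let ?e' = "1 - fps_const (q ^ Suc N * sq) * fps_X"
    have S: "p (Suc N) = p N * inverse ?e"
      by (simp add: p_def half_power_Suc del: of_nat_Suc)
    have e: "inverse ?e * ?e = 1" "inverse ?e' * ?e' = 1"
      by (rule inverse_mult_eq_1; simp)+
    have "p (Suc N) * (1 - fps_const sq * fps_X) = fps_dil q (p N) * (inverse ?e * ?e)"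
      unfolding S using Suc by (simp add: mult_ac)
    also have "\<dots> = fps_dil q (p N) * (inverse ?e' * ?e')" by (simp only: e)
    also have "\<dots> = fps_dil q (p (Suc N)) * ?e'"
      unfolding S fps_dil_mult fps_dil_inverse_linear by (simp add: mult_ac)
    finally show ?case .
  qed (simp add: p_def)
  have rec: "(1 - q ^ Suc n) * fps_nth (p N) (Suc n) = (sq - q ^ N * sq * q ^ n) * fps_nth (p N) n" for N n
    using arg_cong[OF fe[of N], of "\<lambda>F. fps_nth F (Suc n)"] by (simp add: algebra_simps)
  have p0: "fps_nth (p N) 0 = 1" for N
    by (induction N) (auto simp: p_def)
  have "(\<lambda>N. sq - q ^ N * sq * q ^ n) \<longlonglongrightarrow> sq - 0 * sq * q ^ n" for n
    by (intro tendsto_intros q_pow_tendsto)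
  hence l: "(\<lambda>N. sq - q ^ N * sq * q ^ n) \<longlonglongrightarrow> sq" for n by simp
  have G: "fps_nth (Gam_ser lq) n = lim (\<lambda>N. fps_nth (p N) n)" for n
    by (simp add: Gam_ser_def p_def)
  show "fps_nth (Gam_ser lq) 0 = 1"
    "(1 - q ^ Suc n) * fps_nth (Gam_ser lq) (Suc n) = sq * fps_nth (Gam_ser lq) n"
    unfolding G
    by (rule lim_shifted_recursion[of "\<lambda>N. fps_nth (p N)", OF p0 rec one_minus_q l])+
qed

lemma Gam'_ser_rec:
  "fps_nth (Gam'_ser lq) 0 = 1"
  "(1 - q ^ Suc n) * fps_nth (Gam'_ser lq) (Suc n) = sq * q ^ n * fps_nth (Gam'_ser lq) n"
proof -
  define p where "p N = (\<Prod>i=1..N. 1 + fps_const (half_power i) * fps_X)" for N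
  have dl: "fps_dil q (1 + fps_const d * fps_X) = 1 + fps_const (q * d) * fps_X" for d
    using fps_dil_linear[of q "- d"] by (simp flip: fps_const_neg)
  have fe: "fps_dil q (p N) * (1 + fps_const sq * fps_X) = p N * (1 + fps_const (q ^ N * sq) * fps_X)" for N
  proof (induction N)
    case (Suc N)
    have S: "p (Suc N) = p N * (1 + fps_const (q ^ N * sq) * fps_X)"
      by (simp add: p_def half_power_Suc del: of_nat_Suc)
    have "fps_dil q (p (Suc N)) * (1 + fps_const sq * fps_X) =
        (fps_dil q (p N) * (1 + fps_const sq * fps_X)) * (1 + fps_const (q ^ Suc N * sq) * fps_X)"
      unfolding S fps_dil_mult dl by (simp only: power_Suc mult_ac)
    thus ?case unfolding Suc S .
  qed (simp add: p_def)
  have rec: "(1 - q ^ Suc n) * fps_nth (p N) (Suc n) = (sq * q ^ n - q ^ N * sq) * fps_nth (p N) n" for N n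
    using arg_cong[OF fe[of N], of "\<lambda>F. fps_nth F (Suc n)"] by (simp add: algebra_simps)
  have p0: "fps_nth (p N) 0 = 1" for N
    by (induction N) (auto simp: p_def)
  have "(\<lambda>N. sq * q ^ n - q ^ N * sq) \<longlonglongrightarrow> sq * q ^ n - 0 * sq" for n
    by (intro tendsto_intros q_pow_tendsto)
  hence l: "(\<lambda>N. sq * q ^ n - q ^ N * sq) \<longlonglongrightarrow> sq * q ^ n" for n by simp
  have G: "fps_nth (Gam'_ser lq) n = lim (\<lambda>N. fps_nth (p N) n)" for n
    by (simp add: Gam'_ser_def p_def)
  show "fps_nth (Gam'_ser lq) 0 = 1"
    "(1 - q ^ Suc n) * fps_nth (Gam'_ser lq) (Suc n) = sq * q ^ n * fps_nth (Gam'_ser lq) n"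
    unfolding G
    by (rule lim_shifted_recursion[of "\<lambda>N. fps_nth (p N)", OF p0 rec one_minus_q l])+
qed

abbreviation "Gam \<equiv> Gam_ser lq"
abbreviation "Gam' \<equiv> Gam'_ser lq"
abbreviation "Gam_inv \<equiv> fps_dil (- 1) Gam'"
abbreviation "Gam'_inv \<equiv> fps_dil (- 1) Gam"

lemma Gam_dil: "fps_dil q Gam = (1 - fps_const sq * fps_X) * Gam"
proof (rule fps_ext)
  fix n show "fps_nth (fps_dil q Gam) n = fps_nth ((1 - fps_const sq * fps_X) * Gam) n"
    using Gam_ser_rec by (cases n) (simp_all add: algebra_simps)
qed

lemma Gam'_dil: "Gam' = (1 + fps_const sq * fps_X) * fps_dil q Gam'"
proof (rule fps_ext)
  fix n show "fps_nth Gam' n = fps_nth ((1 + fps_const sq * fps_X) * fps_dil q Gam') n"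
    using Gam'_ser_rec by (cases n) (simp_all add: algebra_simps)
qed

lemma Gam_inv_dil: "Gam_inv = (1 - fps_const sq * fps_X) * fps_dil q Gam_inv"
proof -
  have "fps_dil (- 1) (1 + fps_const sq * fps_X) = 1 - fps_const sq * fps_X"
    using fps_dil_linear[of "- 1" "- sq"] by (simp flip: fps_const_neg)
  hence "fps_dil (- 1) ((1 + fps_const sq * fps_X) * fps_dil q Gam') =
      (1 - fps_const sq * fps_X) * fps_dil q Gam_inv"
    by (simp add: fps_dil_mult fps_dil_dil)
  thus ?thesis using arg_cong[OF Gam'_dil, of "fps_dil (- 1)"] by (simp only:)
qed

lemma Gam'_inv_dil: "fps_dil q Gam'_inv = (1 + fps_const sq * fps_X) * Gam'_inv"
proof -
  have "fps_dil q Gam'_inv = fps_dil (- 1) (fps_dil q Gam)"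
    by (simp add: fps_dil_dil mult.commute)
  also have "\<dots> = fps_dil (- 1) (1 - fps_const sq * fps_X) * Gam'_inv"
    by (simp add: Gam_dil fps_dil_mult)
  finally show ?thesis by (simp add: fps_dil_linear flip: fps_const_neg)
qed

text \<open>No positive power of \<open>q\<close> equals 1, so every higher coefficient vanishes.
  The reciprocity of the two vertex series follows from this and their functional equations.\<close>

lemma fps_dil_q_invariant:
  assumes "fps_dil q H = H" "fps_nth H 0 = 1"
  shows "H = 1"
proof (rule fps_ext)
  fix n show "fps_nth H n = fps_nth 1 n"
  proof (cases n)
    case (Suc m)
    have "q ^ n * fps_nth H n = fps_nth H n"
      using arg_cong[OF assms(1), of "\<lambda>F. fps_nth F n"] by simp
    hence "(1 - q ^ n) * fps_nth H n = 0" by (simp add: algebra_simps)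
    thus ?thesis using one_minus_q[of m] Suc by simp
  qed (simp add: assms)
qed

lemma Gam_Gam_inv: "Gam * Gam_inv = 1"
proof (rule fps_dil_q_invariant)
  have "fps_dil q (Gam * Gam_inv) = Gam * ((1 - fps_const sq * fps_X) * fps_dil q Gam_inv)"
    by (simp add: fps_dil_mult Gam_dil mult_ac)
  thus "fps_dil q (Gam * Gam_inv) = Gam * Gam_inv" by (simp only: Gam_inv_dil[symmetric])
qed (simp add: Gam_ser_rec Gam'_ser_rec)

lemma Gam'_Gam'_inv: "Gam' * Gam'_inv = 1"
proof -
  have "fps_dil (- 1) (Gam * Gam_inv) = Gam'_inv * Gam'"
    by (simp add: fps_dil_mult fps_dil_dil)
  thus ?thesis by (simp add: Gam_Gam_inv mult.commute)
qed

text \<open>The ratio of successive coefficients tends to \<open>sq\<close>; the radius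
  \<open>1 / |sq|\<close> is the distance to the pole of the first factor of the product.\<close>

lemma fps_summable_Gam:
  assumes "norm sq * r < 1" "r \<ge> 0"
  shows "fps_summable r Gam"
proof (rule fps_summable_ratio)
  show "fps_nth Gam (Suc n) = sq / (1 - q ^ Suc n) * fps_nth Gam n" for n
    using Gam_ser_rec(2)[of n] one_minus_q[of n] by (simp add: field_simps)
  have "(\<lambda>n. norm (sq / (1 - q ^ Suc n))) \<longlonglongrightarrow> norm (sq / (1 - 0))"
    by (intro tendsto_intros LIMSEQ_Suc[OF q_pow_tendsto]) auto
  thus "(\<lambda>n. norm (sq / (1 - q ^ Suc n))) \<longlonglongrightarrow> norm sq" by simp
qed (use assms in auto)

text \<open>Here the ratio tends to zero and the series is entire, and so is \<open>Gam_inv\<close>;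
  this later admits arbitrarily large circles.\<close>

lemma fps_summable_Gam':
  assumes "r \<ge> 0"
  shows "fps_summable r Gam'"
proof (rule fps_summable_ratio)
  show "fps_nth Gam' (Suc n) = sq * q ^ n / (1 - q ^ Suc n) * fps_nth Gam' n" for n
    using Gam'_ser_rec(2)[of n] one_minus_q[of n] by (simp add: field_simps)
  have "(\<lambda>n. norm (sq * q ^ n / (1 - q ^ Suc n))) \<longlonglongrightarrow> norm (sq * 0 / (1 - 0))"
    by (intro tendsto_intros q_pow_tendsto LIMSEQ_Suc[OF q_pow_tendsto]) auto
  thus "(\<lambda>n. norm (sq * q ^ n / (1 - q ^ Suc n))) \<longlonglongrightarrow> 0" by simp
qed (use assms in auto)

end

section \<open>The initial data of the models\<close>

lemma Lam_zero_toep: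
  assumes "\<And>i. \<alpha> i * \<beta> i = 1"
  shows "toep \<alpha> (dn_seq 1) \<beta> = Lam 0" "toep \<alpha> (up_seq 1) \<beta> = Lam 0"
  using assms by (auto simp: toep_def dn_seq_one up_seq_one Lam_def fun_eq_iff)

lemma supp_le_toep_shift_dn: "supp_le 1 n (toep \<alpha> (shift n (dn_seq F)) \<beta>)"
  by (auto simp: supp_le_def toep_def shift_def dn_seq_def)

lemma supp_le_toep_shift_up: "supp_le (-1) n (toep \<alpha> (shift (- n) (up_seq F)) \<beta>)"
  by (auto simp: supp_le_def toep_def shift_def up_seq_def)

lemma powi_shift: "y \<noteq> 0 \<Longrightarrow> (\<lambda>n. y powi n * shift m f n) = (\<lambda>n. y powi m * shift m (\<lambda>k. y powi k * f k) n)"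
  by (auto simp: shift_def fun_eq_iff power_int_diff)

lemma conv_scale_left: "conv (\<lambda>n. c * f n) g = (\<lambda>n. c * conv f g n)"
  by (simp add: conv_def fun_eq_iff infsum_cmult_right' mult.assoc)

lemma l1_seq_powi:
  assumes "l1_seq r f" "w \<noteq> 0"
  shows "l1_seq (r / norm w) (\<lambda>k. w powi k * f k)"
proof -
  have "norm (w powi k * f k) * (r / norm w) powi k = norm (f k) * r powi k" for k
    using assms by (simp add: norm_mult norm_power_int power_int_divide_distrib)
  thus ?thesis using assms by (simp add: l1_seq_def)
qed

text \<open>The indices 1 and 2 refer to the factors with \<open>k \<le> a\<close> and with \<open>k > a\<close>; \<open>pr\<close> and \<open>cr\<close> are the reversed
  polynomials of \<open>p\<close> and \<open>c\<close>. The last condition bounds the rows of \<open>U \<Lambda>^(-l) V\<^sub>0\<^sup>-\<^sup>1\<close>, where a Gaussian factor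
  does not cancel completely.\<close>

locale model_data = nome +
  fixes a b :: nat and r :: real and y cb :: complex
    and Fm1 Fm2 N1 N2 Fp1 Fp2 Fpi1 Fpi2 p c pr pri cr :: "complex fps" and K1 :: complex
  assumes a: "a \<ge> 1" and b: "b \<ge> 1" and r: "r > 0" and y: "y \<noteq> 0"
    and N_inv: "N1 * Fm1 = 1" "N2 * Fm2 = 1" and N_0: "fps_nth N1 0 = 1" "fps_nth N2 0 = 1"
    and Fp_inv: "Fp1 * Fpi1 = 1" "Fp2 * Fpi2 = 1"
    and p_rev: "dn_seq p = shift (- int a) (up_seq pr)"
    and c_rev: "dn_seq c = shift (- int b) (up_seq cr)"
    and pri: "pr * pri = 1"
    and p_N1: "fps_dil (inverse q) N1 = p * N1"
    and pr_Fp1: "fps_dil q Fp1 = fps_const K1 * pr * Fp1" and K1: "K1 \<noteq> 0"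
    and sm_dn: "fps_summable (inverse r) (Fm1 * Fm2)" "fps_summable (inverse r) (N1 * N2)"
    and sm_up: "fps_summable r (Fp1 * Fp2)" "fps_summable r (Fpi1 * Fpi2)"
    and sm_shifted: "\<And>l::nat. fps_summable (r / norm (exp (2 * cb * of_nat l * lq))) (Fpi1 * Fpi2)"
begin

definition "ea i = exp (1 / (2 * of_nat a) * (of_int i)\<^sup>2 * lq)"
definition "eb i = y powi i * exp (cb * (of_int i)\<^sup>2 * lq)"
definition "h = exp (of_nat a / 2 * lq)"
definition "Fm = Fm1 * Fm2"
definition "N = N1 * N2"
definition "Fp = Fp1 * Fp2"
definition "Fpi = Fpi1 * Fpi2"
text \<open>The intermediate datum, halfway between \<open>N\<close> and its full dilation: the
  second group is already dilated, the first is not. \<open>B0\<close> completes the dilation of the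
  first group, \<open>C0\<close> accounts for that of the second.\<close>

definition "N' = N1 * fps_dil (inverse q) N2"
definition "Fm' = Fm1 * fps_dil (inverse q) Fm2"

definition "W0 = toep ea (dn_seq N) (\<lambda>i. inverse (ea i))"
definition "W0i = toep ea (dn_seq Fm) (\<lambda>i. inverse (ea i))"
definition "V0 = toep ea (up_seq Fp) eb"
definition "V0i = toep (\<lambda>i. inverse (eb i)) (up_seq Fpi) (\<lambda>i. inverse (ea i))"
definition "U = toep ea (conv (dn_seq Fm) (up_seq Fp)) eb"
definition "W0' = toep ea (dn_seq N') (\<lambda>i. inverse (ea i))"
definition "W0i' = toep ea (dn_seq Fm') (\<lambda>i. inverse (ea i))"
text \<open>Determined by \<open>B0 V0' = V0\<close>. The left diagonal compensates the one of
  \<open>B0\<close>, and \<open>pri\<close> appears dilated because this diagonal has to pass the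
  polynomial \<open>pr\<close>.\<close>

definition "V0' = toep (\<lambda>i. inverse h * inverse q powi i * ea i)
  (up_seq (fps_dil (inverse q) pri * Fp)) eb"
definition "V0i' = toep (\<lambda>i. inverse (eb i)) (up_seq (Fpi * fps_dil (inverse q) pr))
  (\<lambda>i. h * q powi i * inverse (ea i))"
definition "B0 = toep (\<lambda>i. h * q powi i * ea i) (up_seq pr) (\<lambda>i. inverse (ea i))"
definition "C0 = toep ea (dn_seq c) (\<lambda>i. inverse (ea i))"

lemma ea_nz [simp]: "ea i \<noteq> 0" by (simp add: ea_def)
lemma eb_nz [simp]: "eb i \<noteq> 0" using y by (simp add: eb_def)
lemma h_nz [simp]: "h \<noteq> 0" by (simp add: h_def)
lemma q_nz' [simp]: "q \<noteq> 0" by (rule q_nz)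

section \<open>Gaussian factors and the factorization at time zero\<close>

lemma q_powi: "q powi i = exp (of_int i * lq)"
  unfolding q[symmetric] exp_power_int by simp

lemma h_h: "h * h = q powi int a"
  unfolding h_def q_powi exp_add[symmetric]
  by (intro arg_cong[of _ _ exp]) (simp add: field_simps)

text \<open>Completing the square: \<open>n \<mapsto> n - a\<close> changes
  \<open>q^(n^2/2a)\<close> by the constant \<open>h = q^(a/2)\<close> and by a geometric sequence.
  The exponent \<open>1/2a\<close> makes its base exactly \<open>q\<close>, the step of the
  functional equations.\<close>

lemma ea_shift: "ea j * h = ea (j - int a) * q powi j"
  unfolding ea_def h_def q_powi exp_add[symmetric] using a
  by (intro arg_cong[of _ _ exp]) (simp add: field_simps power2_eq_square)

lemma inverses: "Fm * N = 1" "N * Fm = 1" "Fp * Fpi = 1" "Fpi * Fp = 1" "N' * Fm' = 1" "Fm' * N' = 1"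
proof -
  have d: "fps_dil (inverse q) N2 * fps_dil (inverse q) Fm2 = 1"
    by (simp add: N_inv flip: fps_dil_mult)
  have "N * Fm = (N1 * Fm1) * (N2 * Fm2)" by (simp add: N_def Fm_def mult_ac)
  thus 1: "N * Fm = 1" by (simp add: N_inv)
  have "Fp * Fpi = (Fp1 * Fpi1) * (Fp2 * Fpi2)" by (simp add: Fp_def Fpi_def mult_ac)
  thus 2: "Fp * Fpi = 1" by (simp add: Fp_inv)
  have "N' * Fm' = (N1 * Fm1) * (fps_dil (inverse q) N2 * fps_dil (inverse q) Fm2)"
    by (simp add: N'_def Fm'_def mult_ac)
  thus 3: "N' * Fm' = 1" by (simp add: N_inv d)
  from 1 2 3 show "Fm * N = 1" "Fpi * Fp = 1" "Fm' * N' = 1" by (simp_all add: mult.commute)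
qed

lemma l1_seqs: "l1_seq r (dn_seq Fm)" "l1_seq r (dn_seq N)" "l1_seq r (up_seq Fp)" "l1_seq r (up_seq Fpi)"
  unfolding Fm_def N_def Fp_def Fpi_def using sm_dn sm_up r by (auto intro: l1_seq_dn l1_seq_up)

lemma N_diag: "fps_nth N 0 = 1" "fps_nth N' 0 = 1"
  by (simp_all add: N_def N'_def N_0)

lemma Fp_0: "fps_nth Fp 0 \<noteq> 0"
  using arg_cong[OF inverses(3), of "\<lambda>F. fps_nth F 0"] by auto

lemma pri_0: "fps_nth pri 0 \<noteq> 0"
  using arg_cong[OF pri, of "\<lambda>F. fps_nth F 0"] by auto

lemma factorized: "factorized_initial W0 W0i V0 V0i"
proof
  show "mmul W0 W0i = Lam 0" "mmul W0i W0 = Lam 0"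
    unfolding W0_def W0i_def
    by (subst toep_mult_one(1); simp add: conv_dn_seq inverses Lam_zero_toep)+
  show "mmul V0 V0i = Lam 0" "mmul V0i V0 = Lam 0"
    unfolding V0_def V0i_def
    by (subst toep_mult_one(1); simp add: conv_up_seq inverses Lam_zero_toep)+
  show "W0 i i = 1" for i unfolding W0_def by (simp add: toep_def dn_seq_def N_diag)
  show "V0 i i \<noteq> 0" for i unfolding V0_def by (simp add: toep_def up_seq_def Fp_0)
qed (simp_all add: W0_def W0i_def V0_def V0i_def supp_le_toep_dn supp_le_toep_up)

lemma dil_pr_pri: "fps_dil (inverse q) pr * fps_dil (inverse q) pri = 1"
  by (simp add: pri flip: fps_dil_mult)

lemma V0'_inverses: "(fps_dil (inverse q) pri * Fp) * (Fpi * fps_dil (inverse q) pr) = 1"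
    "(Fpi * fps_dil (inverse q) pr) * (fps_dil (inverse q) pri * Fp) = 1"
proof -
  have "(fps_dil (inverse q) pri * Fp) * (Fpi * fps_dil (inverse q) pr) =
      (Fp * Fpi) * (fps_dil (inverse q) pr * fps_dil (inverse q) pri)" by (simp add: mult_ac)
  thus "(fps_dil (inverse q) pri * Fp) * (Fpi * fps_dil (inverse q) pr) = 1"
    by (simp add: inverses dil_pr_pri)
  thus "(Fpi * fps_dil (inverse q) pr) * (fps_dil (inverse q) pri * Fp) = 1"
    by (simp only: mult.commute)
qed

lemma q_powi_cancel [simp]: "inverse q powi i * q powi i = 1" "q powi i * inverse q powi i = 1"
  by (simp_all add: power_int_inverse)

lemma factorized': "factorized_initial W0' W0i' V0' V0i'"
proof
  have n: "inverse h * inverse q powi i * ea i * (h * q powi i * inverse (ea i)) = 1" for i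
  proof -
    have "inverse h * inverse q powi i * ea i * (h * q powi i * inverse (ea i)) =
       (inverse h * h) * (inverse q powi i * q powi i) * (ea i * inverse (ea i))" by (simp only: mult_ac)
    thus ?thesis by simp
  qed
  show "mmul W0' W0i' = Lam 0" "mmul W0i' W0' = Lam 0"
    unfolding W0'_def W0i'_def
    by (subst toep_mult_one(1); simp add: conv_dn_seq inverses Lam_zero_toep)+
  show "mmul V0' V0i' = Lam 0"
    unfolding V0'_def V0i'_def
    by (subst toep_mult_one(1)) (simp_all only: conv_up_seq V0'_inverses Lam_zero_toep n right_inverse eb_nz simp_thms)
  show "mmul V0i' V0' = Lam 0"
    unfolding V0'_def V0i'_def
    by (subst toep_mult_one(1))
       (simp_all only: conv_up_seq V0'_inverses Lam_zero_toep n left_inverse eb_nz simp_thms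
         mult.commute[of "h * q powi m * inverse (ea m)" for m])
  show "W0' i i = 1" for i unfolding W0'_def by (simp add: toep_def dn_seq_def N_diag)
  show "V0' i i \<noteq> 0" for i unfolding V0'_def by (simp add: toep_def up_seq_def Fp_0 pri_0)
qed (simp_all add: W0'_def W0i'_def V0'_def V0i'_def supp_le_toep_dn supp_le_toep_up)

lemma U_factorization:
  "mconv W0i V0" "mmul W0i V0 = U" "mconv W0 U" "mmul W0 U = V0" "mmul U V0i = W0i"
  "mconv U (mmul (Lam (- int l)) V0i)"
proof -
  have one: "inverse (ea m) * ea m = 1" "eb m * inverse (eb m) = 1" for m by simp_all
  have T: "l1_seq r (conv (dn_seq Fm) (up_seq Fp))" using l1_seqs r by (intro l1_seq_conv)
  show "mconv W0i V0" "mmul W0i V0 = U"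
    unfolding W0i_def V0_def U_def
    using l1_seqs r by (auto intro!: toep_mult_one one conv_summable[of r])
  show "mconv W0 U"
    unfolding W0_def U_def using l1_seqs r T by (auto intro!: toep_mult_one one conv_summable[of r])
  have "conv (dn_seq N) (conv (dn_seq Fm) (up_seq Fp)) = up_seq Fp"
    using conv_assoc[OF l1_seqs(2,1,3) r]
    by (simp add: conv_dn_seq inverses) (simp add: dn_seq_one conv_delta_left)
  thus "mmul W0 U = V0"
    unfolding W0_def U_def V0_def by (simp add: toep_mult_one one)
  have "conv (conv (dn_seq Fm) (up_seq Fp)) (up_seq Fpi) = dn_seq Fm"
    unfolding conv_assoc[OF l1_seqs(1,3,4) r]
    by (simp add: conv_up_seq inverses) (simp add: up_seq_one conv_commute[of "dn_seq Fm"] conv_delta_left)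
  thus "mmul U V0i = W0i"
    unfolding W0i_def U_def V0i_def by (simp add: toep_mult_one one)
  have L: "mmul (Lam (- int l)) V0i =
      toep (\<lambda>i. inverse (eb (i - int l))) (shift (- int l) (up_seq Fpi)) (\<lambda>i. inverse (ea i))"
    by (simp add: V0i_def toep_def shift_def algebra_simps)
  \<comment> \<open>The base of the geometric sequence left over when the Gaussian in
    \<open>eb\<close> meets its translate by \<open>l\<close>; it moves the circle of convergence
    from radius \<open>r\<close> to \<open>r / |w|\<close>.\<close>
  define w where "w = exp (2 * cb * of_nat l * lq)"
  have w: "w \<noteq> 0" by (simp add: w_def)
  have e: "eb m * inverse (eb (m - int l)) = (y powi int l * exp (- cb * (of_nat l)\<^sup>2 * lq)) * w powi m" for m
  proof -
    have "exp (cb * (of_int m)\<^sup>2 * lq) = exp (- cb * (of_nat l)\<^sup>2 * lq) * w powi m *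
        exp (cb * (of_int (m - int l))\<^sup>2 * lq)"
      unfolding w_def exp_power_int exp_add[symmetric]
      by (intro arg_cong[of _ _ exp]) (simp add: algebra_simps power2_eq_square)
    moreover have "y powi m = y powi int l * y powi (m - int l)"
      using y power_int_add[of y "int l" "m - int l"] by simp
    ultimately have "eb m = (y powi int l * exp (- cb * (of_nat l)\<^sup>2 * lq)) * w powi m * eb (m - int l)"
      unfolding eb_def by (simp only: mult_ac)
    thus ?thesis by simp
  qed
  show "mconv U (mmul (Lam (- int l)) V0i)"
    unfolding L U_def
  proof (rule toep_mult(2)[OF w e])
    fix n
    let ?s = "r / norm w"
    have s: "?s > 0" using r w by simp
    have "l1_seq ?s (\<lambda>k. w powi k * conv (dn_seq Fm) (up_seq Fp) k)"
      by (rule l1_seq_powi[OF T w])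
    moreover have "l1_seq ?s (up_seq Fpi)"
      unfolding Fpi_def using sm_shifted[of l] s by (intro l1_seq_up) (auto simp: w_def)
    ultimately have "(\<lambda>k. (w powi k * conv (dn_seq Fm) (up_seq Fp) k) * up_seq Fpi (n + int l - k))
        summable_on UNIV" using s by (intro conv_summable)
    thus "(\<lambda>k. w powi k * conv (dn_seq Fm) (up_seq Fp) k * shift (- int l) (up_seq Fpi) (n - k))
        summable_on UNIV" by (simp add: shift_def algebra_simps)
  qed
qed

section \<open>Band matrices acting on the initial data\<close>

lemma up_pr: "up_seq pr = shift (int a) (dn_seq p)"
  by (simp add: p_rev shift_shift)

lemma banded_B0: "banded B0"
proof -
  have "supp_le 1 (int a) B0" unfolding B0_def up_pr by (rule supp_le_toep_shift_dn)
  moreover have "supp_le (-1) 0 B0" unfolding B0_def by (rule supp_le_toep_up)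
  ultimately show ?thesis by (auto simp: banded_def one_sided_def)
qed

lemma banded_C0: "banded C0"
proof -
  have "supp_le (-1) (int b) C0" unfolding C0_def c_rev by (rule supp_le_toep_shift_up)
  moreover have "supp_le 1 0 C0" unfolding C0_def by (rule supp_le_toep_dn)
  ultimately show ?thesis by (auto simp: banded_def one_sided_def)
qed

lemma B0_V0': "mmul B0 V0' = V0"
proof -
  have e: "inverse (ea m) * (inverse h * inverse q powi m * ea m) = inverse h * inverse q powi m" for m
    by simp
  have "mmul B0 V0' = toep (\<lambda>i. inverse h * inverse q powi i * (h * q powi i * ea i))
     (conv (\<lambda>n. inverse q powi n * up_seq pr n) (up_seq (fps_dil (inverse q) pri * Fp))) eb"
    unfolding B0_def V0'_def by (rule toep_mult(1)[OF _ e]) simp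
  also have "(\<lambda>i. inverse h * inverse q powi i * (h * q powi i * ea i)) = ea"
  proof
    fix i
    have "inverse h * inverse q powi i * (h * q powi i * ea i) =
        (inverse h * h) * (inverse q powi i * q powi i) * ea i" by (simp only: mult_ac)
    thus "inverse h * inverse q powi i * (h * q powi i * ea i) = ea i" by simp
  qed
  also have "conv (\<lambda>n. inverse q powi n * up_seq pr n) (up_seq (fps_dil (inverse q) pri * Fp)) = up_seq Fp"
    by (subst powi_up_seq) (simp_all add: conv_up_seq dil_pr_pri flip: mult.assoc)
  finally show ?thesis by (simp add: V0_def)
qed

lemma p_N': "p * N' = fps_dil (inverse q) N"
  by (simp add: N'_def N_def fps_dil_mult p_N1 mult.assoc)

text \<open>The polynomial \<open>p\<close> turns \<open>N'\<close> into the full dilation of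
  \<open>N\<close>, which is also the effect of moving \<open>\<Lambda>^a\<close> through the
  Gaussian; the constants cancel by \<open>h * h = q^a\<close>.\<close>

lemma B0_W0': "mmul B0 W0' = mmul W0 (Lam (int a))"
proof (intro ext)
  fix i j
  let ?n = "j - i - int a"
  have "mmul B0 W0' = toep (\<lambda>i. h * q powi i * ea i) (conv (up_seq pr) (dn_seq N')) (\<lambda>i. inverse (ea i))"
    unfolding B0_def W0'_def by (rule toep_mult_one) simp
  hence "mmul B0 W0' = toep (\<lambda>i. h * q powi i * ea i)
      (shift (int a) (dn_seq (fps_dil (inverse q) N))) (\<lambda>i. inverse (ea i))"
    by (simp add: up_pr conv_shift_left conv_dn_seq p_N')
  hence "mmul B0 W0' i j = h * q powi i * ea i * dn_seq (fps_dil (inverse q) N) ?n * inverse (ea j)"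
    by (simp add: toep_def shift_def)
  also have "dn_seq (fps_dil (inverse q) N) ?n = q powi ?n * dn_seq N ?n"
    using fun_cong[OF powi_dn_seq[OF q_nz, of N], of ?n] by simp
  also have "inverse (ea j) = h * inverse (ea (j - int a)) * inverse (q powi j)"
    using ea_shift[of j] by (simp add: field_simps)
  also have "h * q powi i * ea i * (q powi ?n * dn_seq N ?n) * (h * inverse (ea (j - int a)) * inverse (q powi j))
     = (h * h * q powi i * q powi ?n * inverse (q powi j)) * (ea i * dn_seq N ?n * inverse (ea (j - int a)))"
    by (simp only: mult_ac)
  also have "h * h * q powi i * q powi ?n * inverse (q powi j) = 1"
    unfolding h_h by (simp add: power_int_diff)
  finally show "mmul B0 W0' i j = mmul W0 (Lam (int a)) i j"
    by (simp add: W0_def toep_def algebra_simps)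
qed

lemma evolution_solution:
  assumes "evolution W0 V0 G Gi W Wi V Vi"
  shows "toda_solution_from U (tmul (tmul W (tLam 1)) Wi) (tmul (tmul V (tLam (- 1))) Vi)"
proof -
  interpret factorized_initial W0 W0i V0 V0i by (rule factorized)
  have "toda_factorization U W Wi V Vi"
    by (rule evolution_toda_factorization[OF assms W0_inv(1) one_sided_initial(2) V0_inv(1)
          one_sided_initial(4) U_factorization(1-4) U_factorization(6,5)])
  thus ?thesis
    unfolding toda_solution_from_def using evolution_toda_lax[OF assms] by blast
qed

lemma first_evolution: "\<exists>G Gi W Wi V Vi. evolution W0 V0 G Gi W Wi V Vi"
  using factorized_initial.evolution_exists[OF factorized] .

lemma second_evolution: "\<exists>G Gi W Wi V Vi. evolution W0' V0' G Gi W Wi V Vi"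
  using factorized_initial.evolution_exists[OF factorized'] .

section \<open>The two reductions\<close>

lemma eb_shift: "eb (j + int b) = (y ^ b * exp (cb * (of_nat b)\<^sup>2 * lq)) * exp (2 * cb * of_nat b * of_int j * lq) * eb j"
proof -
  have "exp (cb * (of_int (j + int b))\<^sup>2 * lq) =
     exp (cb * (of_nat b)\<^sup>2 * lq) * exp (2 * cb * of_nat b * of_int j * lq) * exp (cb * (of_int j)\<^sup>2 * lq)"
    unfolding exp_add[symmetric] by (intro arg_cong[of _ _ exp]) (simp add: algebra_simps power2_eq_square)
  moreover have "y powi (j + int b) = y ^ b * y powi j" using y by (simp add: power_int_add)
  ultimately show ?thesis unfolding eb_def by (simp only: mult_ac)
qed

theorem bigraded_model:
  assumes cb: "cb = 1 / (2 * of_nat b)"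
    and c_N2: "fps_dil (inverse q) N2 = c * N2"
    and cr_Fp2: "fps_dil q Fp2 = fps_const K2 * cr * Fp2" and K2: "K2 \<noteq> 0"
  shows "\<exists>L Li. toda_solution_from U L Li \<and>
       (\<exists>D B C. D \<noteq> 0 \<and> B_form a B \<and> C_form b C \<and>
          tpow L a = tscale (inverse D) (tpow Li b) \<and>
          tscale (inverse D) (tpow Li b) = tmul B C)"
proof -
  obtain G Gi W Wi V Vi where ev: "evolution W0 V0 G Gi W Wi V Vi" using first_evolution by blast
  obtain G' Gi' W' Wi' V' Vi' where ev': "evolution W0' V0' G' Gi' W' Wi' V' Vi'"
    using second_evolution by blast
  define ck where "ck = y ^ b * exp (cb * (of_nat b)\<^sup>2 * lq)"
  have ck: "ck \<noteq> 0" using y by (simp add: ck_def)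
  \<comment> \<open>\<open>K1\<close> and \<open>K2\<close> stem from the functional equations of
    the upward series, \<open>inverse h\<close> from \<open>V0'\<close>, \<open>ck\<close> from
    shifting \<open>eb\<close> by \<open>b\<close>, and \<open>inverse q ^ b\<close> from writing
    \<open>q^(j-i)\<close> in the shifted index \<open>j - i + b\<close>.\<close>
  define D where "D = K1 * K2 * inverse h * ck * inverse q ^ b"
  have D: "D \<noteq> 0" using K1 K2 ck by (simp add: D_def)
  have C0_W0: "mmul C0 W0 = W0'"
  proof -
    have "c * N = N'" by (simp add: N_def N'_def c_N2 mult_ac)
    thus ?thesis unfolding C0_def W0_def W0'_def
      by (subst toep_mult_one(1)) (simp_all add: conv_dn_seq)
  qed
  have C0_V0: "mmul C0 V0 = (\<lambda>i j. inverse D * mmul V0' (Lam (- int b)) i j)"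
  proof (intro ext)
    fix i j
    let ?n = "j - i + int b"
    have "mmul C0 V0 = toep ea (conv (dn_seq c) (up_seq Fp)) eb"
      unfolding C0_def V0_def by (rule toep_mult_one) simp
    hence "mmul C0 V0 = toep ea (shift (- int b) (up_seq (cr * Fp))) eb"
      by (simp add: c_rev conv_shift_left conv_up_seq)
    hence 1: "mmul C0 V0 i j = ea i * up_seq (cr * Fp) ?n * eb j"
      by (simp add: toep_def shift_def)
    \<comment> \<open>The outer dilation undoes the inner one on \<open>pri\<close>, which then
      cancels the factor \<open>pr\<close> produced by \<open>Fp1\<close>; only the
      \<open>cr\<close> produced by \<open>Fp2\<close> remains.\<close>
    have "fps_dil q (fps_dil (inverse q) pri * Fp) = pri * (fps_dil q Fp1 * fps_dil q Fp2)"
      by (simp add: fps_dil_mult fps_dil_dil Fp_def)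
    also have "\<dots> = (pr * pri) * (fps_const K1 * fps_const K2 * (cr * Fp))"
      unfolding pr_Fp1 cr_Fp2 Fp_def by (simp only: mult_ac)
    finally have "fps_dil q (fps_dil (inverse q) pri * Fp) = fps_const (K1 * K2) * (cr * Fp)"
      by (simp add: pri)
    hence u: "q powi ?n * up_seq (fps_dil (inverse q) pri * Fp) ?n = K1 * K2 * up_seq (cr * Fp) ?n"
      using fun_cong[OF powi_up_seq[OF q_nz, of "fps_dil (inverse q) pri * Fp"], of ?n]
      by (simp add: up_seq_def)
    have "exp (2 * cb * of_nat b * of_int j * lq) = q powi j"
      using b by (simp add: cb q_powi)
    hence e: "eb (j + int b) = ck * q powi j * eb j" by (simp add: eb_shift ck_def)
    have qs: "inverse q powi i * q powi j = q powi ?n * inverse q ^ b"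
      by (simp add: power_int_inverse power_int_add power_int_diff field_simps)
    have "mmul V0' (Lam (- int b)) i j =
        inverse h * inverse q powi i * ea i * up_seq (fps_dil (inverse q) pri * Fp) ?n * eb (j + int b)"
      by (simp add: V0'_def toep_def algebra_simps)
    also have "\<dots> = inverse h * ck * (inverse q powi i * q powi j) * ea i *
        up_seq (fps_dil (inverse q) pri * Fp) ?n * eb j"
      unfolding e by (simp only: mult_ac)
    also have "\<dots> = inverse h * ck * inverse q ^ b * ea i *
        (q powi ?n * up_seq (fps_dil (inverse q) pri * Fp) ?n) * eb j"
      unfolding qs by (simp only: mult_ac)
    also have "\<dots> = D * mmul C0 V0 i j"
      unfolding u 1 D_def by (simp only: mult_ac)
    finally show "mmul C0 V0 i j = inverse D * mmul V0' (Lam (- int b)) i j" using D by simp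
  qed
  interpret evolution_pair W0 V0 G Gi W Wi V Vi W0' V0' G' Gi' W' Wi' V' Vi' a b B0 C0 D
    by unfold_locales (rule ev ev' banded_B0 banded_C0 D B0_W0' B0_V0')+
  show ?thesis
    using evolution_solution[OF ev] D B_form bigraded_reduction[OF C0_W0 C0_V0] by blast
qed

theorem rational_model:
  assumes cb: "cb = - 1 / (2 * of_nat b)"
    and c_N2: "N2 = c * fps_dil (inverse q) N2"
    and cr_Fp2: "Fp2 = fps_const K2 * cr * fps_dil q Fp2" and K2: "K2 \<noteq> 0"
  shows "\<exists>L Li. toda_solution_from U L Li \<and>
       (\<exists>D B C Bi Ci. D \<noteq> 0 \<and> B_form a B \<and> C_form b C \<and>
          upper_inverse B Bi \<and> lower_inverse C Ci \<and>
          tpow L a = tmul B Ci \<and>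
          tpow Li b = tscale D (tmul C Bi))"
proof -
  obtain G Gi W Wi V Vi where ev: "evolution W0 V0 G Gi W Wi V Vi" using first_evolution by blast
  obtain G' Gi' W' Wi' V' Vi' where ev': "evolution W0' V0' G' Gi' W' Wi' V' Vi'"
    using second_evolution by blast
  define ck where "ck = y ^ b * exp (cb * (of_nat b)\<^sup>2 * lq)"
  have ck: "ck \<noteq> 0" using y by (simp add: ck_def)
  \<comment> \<open>\<open>C0\<close> now maps \<open>V0'\<close> to \<open>V0\<close> instead of
    conversely, so \<open>h\<close> and \<open>K1\<close> enter inversely to the bi-graded case. The
    opposite Gaussian gives \<open>q^(-j)\<close>, and the powers of \<open>q\<close> cancel
    completely.\<close>
  define D where "D = h * inverse K1 * K2 * ck"
  have D: "D \<noteq> 0" using K1 K2 ck by (simp add: D_def)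
  have C0_W0': "mmul C0 W0' = W0"
  proof -
    have "c * N' = N1 * (c * fps_dil (inverse q) N2)" by (simp add: N'_def mult_ac)
    hence "c * N' = N" by (simp only: c_N2[symmetric] N_def)
    thus ?thesis unfolding C0_def W0_def W0'_def
      by (subst toep_mult_one(1)) (simp_all add: conv_dn_seq)
  qed
  have C0_V0': "mmul C0 V0' = (\<lambda>i j. inverse D * mmul V0 (Lam (- int b)) i j)"
  proof (intro ext)
    fix i j
    let ?n = "j - i + int b"
    let ?q = "inverse q"
    have e1: "inverse (ea m) * (inverse h * ?q powi m * ea m) = inverse h * ?q powi m" for m
      by simp
    have "mmul C0 V0' = toep (\<lambda>i. inverse h * ?q powi i * ea i)
        (conv (\<lambda>n. ?q powi n * dn_seq c n) (up_seq (fps_dil ?q pri * Fp))) eb"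
      unfolding C0_def V0'_def by (rule toep_mult(1)[OF _ e1]) simp
    also have "(\<lambda>n. ?q powi n * dn_seq c n) =
        (\<lambda>n. ?q powi (- int b) * shift (- int b) (up_seq (fps_dil ?q cr)) n)"
      unfolding c_rev by (simp add: powi_shift powi_up_seq)
    also have "conv \<dots> (up_seq (fps_dil ?q pri * Fp)) =
        (\<lambda>n. ?q powi (- int b) * shift (- int b) (up_seq (fps_dil ?q (cr * pri) * Fp)) n)"
      by (simp add: conv_scale_left conv_shift_left conv_up_seq fps_dil_mult mult.assoc)
    finally have 1: "mmul C0 V0' i j = inverse h * ?q powi i * ea i *
        (?q powi (- int b) * up_seq (fps_dil ?q (cr * pri) * Fp) ?n) * eb j"
      by (simp add: toep_def shift_def)
    have "fps_const K2 * (cr * pri * fps_dil q Fp) = (pr * pri) * fps_const K1 * (Fp1 * (fps_const K2 * cr * fps_dil q Fp2))"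
      unfolding Fp_def fps_dil_mult pr_Fp1 by (simp only: mult_ac)
    hence "fps_const K2 * (cr * pri * fps_dil q Fp) = fps_const K1 * Fp"
      by (simp only: cr_Fp2[symmetric] pri Fp_def mult_1_left)
    hence "fps_dil ?q (fps_const K2 * (cr * pri * fps_dil q Fp)) = fps_dil ?q (fps_const K1 * Fp)" by simp
    hence "fps_const K2 * (fps_dil ?q (cr * pri) * Fp) = fps_const K1 * fps_dil ?q Fp"
      unfolding fps_dil_const_mult by (simp add: fps_dil_mult fps_dil_dil)
    hence "K2 * up_seq (fps_dil ?q (cr * pri) * Fp) ?n = K1 * up_seq (fps_dil ?q Fp) ?n"
      by (auto simp: up_seq_def dest!: arg_cong[of _ _ "\<lambda>F. fps_nth F (nat ?n)"])
    also have "up_seq (fps_dil ?q Fp) ?n = ?q powi ?n * up_seq Fp ?n"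
      using fun_cong[OF powi_up_seq[of ?q Fp], of ?n] by simp
    finally have u: "up_seq (fps_dil ?q (cr * pri) * Fp) ?n = inverse K2 * K1 * (?q powi ?n * up_seq Fp ?n)"
      using K2 by (simp add: field_simps)
    have "2 * cb * of_nat b * of_int j * lq = of_int (- j) * lq"
      using b by (simp add: cb)
    hence "exp (2 * cb * of_nat b * of_int j * lq) = ?q powi j"
      using q_powi[of "- j"] by (simp add: power_int_minus power_int_inverse)
    hence e: "eb (j + int b) = ck * ?q powi j * eb j" by (simp add: eb_shift ck_def)
    have qs: "?q powi i * ?q powi (- int b) * ?q powi ?n = ?q powi j"
      by (simp flip: power_int_add)
    have "D * mmul C0 V0' i j = (D * inverse h * inverse K2 * K1) *
        (?q powi i * ?q powi (- int b) * ?q powi ?n) * ea i * up_seq Fp ?n * eb j"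
      unfolding 1 u by (simp only: mult_ac)
    also have "D * inverse h * inverse K2 * K1 = ck"
      using K1 K2 by (simp add: D_def field_simps)
    also have "ck * (?q powi i * ?q powi (- int b) * ?q powi ?n) * ea i * up_seq Fp ?n * eb j =
        ea i * up_seq Fp ?n * eb (j + int b)"
      unfolding qs e by (simp only: mult_ac)
    also have "\<dots> = mmul V0 (Lam (- int b)) i j"
      by (simp add: V0_def toep_def algebra_simps)
    finally show "mmul C0 V0' i j = inverse D * mmul V0 (Lam (- int b)) i j"
      using D by (simp add: field_simps)
  qed
  interpret evolution_pair W0 V0 G Gi W Wi V Vi W0' V0' G' Gi' W' Wi' V' Vi' a b B0 C0 D
    by unfold_locales (rule ev ev' banded_B0 banded_C0 D B0_W0' B0_V0')+
  show ?thesis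
    using evolution_solution[OF ev] D B_form rational_reduction[OF C0_W0' C0_V0'] by blast
qed

end

section \<open>The generating matrices\<close>

text \<open>The series of a chain of vertex operator pairs in their original order. The dilations by
  \<open>z\<close> and \<open>inverse z\<close> record the powers \<open>u^\<Delta>\<close> moved
  past each pair.\<close>

fun ordered_seq :: "(complex \<times> complex fps) list \<Rightarrow> int \<Rightarrow> complex" where
  "ordered_seq [] = (\<lambda>k. of_bool (k = 0))"
| "ordered_seq ((z, F) # zs) =
     conv (dn_seq (fps_dil z F)) (conv (up_seq (fps_dil (inverse z) F)) (ordered_seq zs))"

fun partial_prods :: "complex \<Rightarrow> complex list \<Rightarrow> complex list" where
  "partial_prods x [] = []"
| "partial_prods x (u # us) = (x * u) # partial_prods (x * u) us"

definition block :: "complex \<times> complex fps \<Rightarrow> cmat list" where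
  "block = (\<lambda>(u, F). [pow_Delta u, ser_down F, ser_up F])"

lemma mmul_mdiag_left: "mmul (mdiag d) A = (\<lambda>i j. d i * A i j)"
proof (intro ext)
  fix i j
  have "mmul (mdiag d) A i j = infsum (\<lambda>k. mdiag d i k * A k j) {i}"
    unfolding mmul_def by (rule infsum_cong_neutral) (auto simp: mdiag_def)
  thus "mmul (mdiag d) A i j = d i * A i j" by (simp add: mdiag_def)
qed

text \<open>The base \<open>x\<close> accumulates the parameters already passed. The tail carries
  the inverse power of the base \<open>x u\<close> on its left, and multiplying by
  \<open>u^\<Delta>\<close> restores the base \<open>x\<close>; the full product of parameters
  collects on the right.\<close>

lemma mprod_blocks:
  assumes "x \<noteq> 0" "\<forall>(u, F)\<in>set us. u \<noteq> 0"
  shows "mprod (concat (map block us) @ [mdiag e]) =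
    toep (\<lambda>i. inverse x powi i) (ordered_seq (zip (partial_prods x (map fst us)) (map snd us)))
      (\<lambda>j. (x * prod_list (map fst us)) powi j * e j)"
  using assms
proof (induction us arbitrary: x)
  case Nil
  thus ?case by (auto simp: mdiag_def toep_def fun_eq_iff power_int_inverse)
next
  case (Cons uF us)
  obtain u F where uF: "uF = (u, F)" by (cases uF)
  define z where "z = x * u"
  have z: "z \<noteq> 0" and u: "u \<noteq> 0" using Cons.prems uF by (auto simp: z_def)
  let ?f = "ordered_seq (zip (partial_prods z (map fst us)) (map snd us))"
  let ?d = "\<lambda>j. (z * prod_list (map fst us)) powi j * e j"
  let ?M = "mprod (concat (map block us) @ [mdiag e])"
  let ?g = "conv (up_seq (fps_dil (inverse z) F)) ?f"
  have M: "?M = toep (\<lambda>i. inverse z powi i) ?f ?d"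
    using Cons.IH[OF z] Cons.prems by simp
  have step: "mmul (toep (\<lambda>_. 1) g (\<lambda>_. 1)) (toep (\<lambda>i. inverse z powi i) h ?d) =
      toep (\<lambda>i. inverse z powi i) (conv (\<lambda>n. inverse z powi n * g n) h) ?d" for g h
    using z by (subst toep_mult(1)[of "inverse z" _ _ 1]) simp_all
  have "mprod (concat (map block (uF # us)) @ [mdiag e]) =
      mmul (pow_Delta u) (mmul (ser_down F) (mmul (ser_up F) ?M))"
    by (simp add: uF block_def)
  also have "mmul (ser_up F) ?M = toep (\<lambda>i. inverse z powi i) ?g ?d"
    unfolding ser_up_toep M step using z by (simp add: powi_up_seq)
  also have "mmul (ser_down F) \<dots> =
      toep (\<lambda>i. inverse z powi i) (conv (dn_seq (fps_dil z F)) ?g) ?d"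
    unfolding ser_down_toep step using z by (simp add: powi_dn_seq)
  also have "mmul (pow_Delta u) \<dots> =
      toep (\<lambda>i. inverse x powi i) (conv (dn_seq (fps_dil z F)) ?g) ?d"
    unfolding pow_Delta_def mmul_mdiag_left using u
    by (simp add: toep_def z_def power_int_mult_distrib power_int_inverse fun_eq_iff)
  finally show ?case by (simp add: uF z_def mult.assoc)
qed

lemma l1_seq_dil_prods:
  assumes r: "r > 0"
    and sm: "\<forall>(z, F)\<in>set zs. fps_summable (norm z / r) F \<and> fps_summable (r / norm z) F"
  shows "l1_seq r (dn_seq (prod_list (map (\<lambda>(z, F). fps_dil z F) zs)))"
    and "l1_seq r (up_seq (prod_list (map (\<lambda>(z, F). fps_dil (inverse z) F) zs)))"
proof -
  have ir: "inverse r \<ge> 0" "r \<ge> 0" using r by simp_all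
  have d: "fps_summable (inverse r) (prod_list (map (\<lambda>(z, F). fps_dil z F) zs))"
    using sm ir by (intro fps_summable_prod_list) (auto simp: fps_summable_dil divide_inverse)
  have u: "fps_summable r (prod_list (map (\<lambda>(z, F). fps_dil (inverse z) F) zs))"
    using sm ir by (intro fps_summable_prod_list)
      (auto simp: fps_summable_dil divide_inverse norm_inverse mult.commute)
  from d u show "l1_seq r (dn_seq (prod_list (map (\<lambda>(z, F). fps_dil z F) zs)))"
    "l1_seq r (up_seq (prod_list (map (\<lambda>(z, F). fps_dil (inverse z) F) zs)))"
    using r by (auto intro: l1_seq_dn l1_seq_up)
qed

text \<open>All factors lie in the algebra of series absolutely convergent on one circle, so the
  downward ones can be collected in front without commutator factors.\<close>

lemma ordered_seq_eq:
  assumes r: "r > 0"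
    and sm: "\<forall>(z, F)\<in>set zs. fps_summable (norm z / r) F \<and> fps_summable (r / norm z) F"
  shows "ordered_seq zs = conv (dn_seq (prod_list (map (\<lambda>(z, F). fps_dil z F) zs)))
      (up_seq (prod_list (map (\<lambda>(z, F). fps_dil (inverse z) F) zs)))"
proof -
  show "ordered_seq zs = conv (dn_seq (prod_list (map (\<lambda>(z, F). fps_dil z F) zs)))
      (up_seq (prod_list (map (\<lambda>(z, F). fps_dil (inverse z) F) zs)))"
    using sm
  proof (induction zs)
    case Nil
    show ?case by (simp add: dn_seq_one up_seq_one conv_delta_left)
  next
    case (Cons zF zs)
    obtain z F where zF: "zF = (z, F)" by (cases zF)
    define D where "D = prod_list (map (\<lambda>(z, F). fps_dil z F) zs)"
    define P where "P = prod_list (map (\<lambda>(z, F). fps_dil (inverse z) F) zs)"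
    have l: "l1_seq r (dn_seq (fps_dil z F))" "l1_seq r (up_seq (fps_dil (inverse z) F))"
      using Cons.prems r unfolding zF
      by (auto intro!: l1_seq_dn l1_seq_up simp: fps_summable_dil divide_inverse norm_inverse mult.commute)
    have L: "l1_seq r (dn_seq D)" "l1_seq r (up_seq P)"
      unfolding D_def P_def using Cons.prems by (intro l1_seq_dil_prods[OF r]; simp)+
    let ?d = "dn_seq (fps_dil z F)" and ?u = "up_seq (fps_dil (inverse z) F)"
    have "conv ?u (conv (dn_seq D) (up_seq P)) = conv (conv ?u (dn_seq D)) (up_seq P)"
      by (rule conv_assoc[symmetric]) (use l L r in auto)
    also have "\<dots> = conv (conv (dn_seq D) ?u) (up_seq P)" by (simp only: conv_commute)
    also have "\<dots> = conv (dn_seq D) (conv ?u (up_seq P))"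
      by (rule conv_assoc) (use l L r in auto)
    finally have "conv ?u (conv (dn_seq D) (up_seq P)) =
        conv (dn_seq D) (up_seq (fps_dil (inverse z) F * P))"
      by (simp only: conv_up_seq)
    moreover have "conv ?d (conv (dn_seq D) (up_seq (fps_dil (inverse z) F * P))) =
        conv (conv ?d (dn_seq D)) (up_seq (fps_dil (inverse z) F * P))"
      by (rule conv_assoc[symmetric, OF l(1) L(1) _ r])
         (simp only: conv_up_seq[symmetric] l1_seq_conv[OF l(2) L(2) r])
    ultimately show ?case
      using Cons by (simp add: zF conv_dn_seq D_def P_def)
  qed
qed

section \<open>Accumulated parameters\<close>

lemma length_partial_prods [simp]: "length (partial_prods x us) = length us"
  by (induction us arbitrary: x) auto

lemma partial_prods_append:
  "partial_prods x (us @ vs) = partial_prods x us @ partial_prods (x * prod_list us) vs"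
  by (induction us arbitrary: x) (auto simp: mult.assoc)

lemma partial_prods_nth:
  "k < length us \<Longrightarrow> partial_prods x us ! k = x * prod_list (take (Suc k) us)"
proof (induction us arbitrary: x k)
  case (Cons u us)
  thus ?case by (cases k) (auto simp: mult.assoc)
qed simp

lemma prod_list_upt: "prod_list (map f [m..<n]) = prod f {m..<n}"
  using prod.distinct_set_conv_list[of "[m..<n]" f] by simp

text \<open>The leading 1 stands for the first vertex pair, which no parameter precedes, and yields
  the first accumulated parameter; the second list continues from the product of all
  \<open>P i\<close>.\<close>

lemma partial_prods_Qacc:
  assumes "a \<ge> 1" "b \<ge> 1"
  shows "set (partial_prods 1 (1 # map P [1..<a])) \<subseteq> Qacc a b P Q R ` {1..a + b}"
    and "set (partial_prods (prod P {1..<a}) (Q # map R (rev [1..<b]))) \<subseteq> Qacc a b P Q R ` {1..a + b}"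
proof -
  show "set (partial_prods 1 (1 # map P [1..<a])) \<subseteq> Qacc a b P Q R ` {1..a + b}"
  proof
    fix z assume "z \<in> set (partial_prods 1 (1 # map P [1..<a]))"
    then obtain k where k: "k < length (partial_prods 1 (1 # map P [1..<a]))"
        "z = partial_prods 1 (1 # map P [1..<a]) ! k"
      by (metis in_set_conv_nth)
    hence "k < a" using assms by simp
    moreover have "z = prod_list (map P (take k [1..<a]))"
      using k partial_prods_nth[of k "1 # map P [1..<a]" 1]
      by (simp add: take_map del: partial_prods.simps)
    moreover have "take k [1..<a] = [1..<Suc k]" using \<open>k < a\<close> by simp
    ultimately have "z = Qacc a b P Q R (Suc k)"
      by (simp only: prod_list_upt) (simp add: Qacc_def)
    thus "z \<in> Qacc a b P Q R ` {1..a + b}" using \<open>k < a\<close> by auto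
  qed
  show "set (partial_prods (prod P {1..<a}) (Q # map R (rev [1..<b]))) \<subseteq> Qacc a b P Q R ` {1..a + b}"
  proof
    fix z assume "z \<in> set (partial_prods (prod P {1..<a}) (Q # map R (rev [1..<b])))"
    then obtain k where k: "k < length (partial_prods (prod P {1..<a}) (Q # map R (rev [1..<b])))"
        "z = partial_prods (prod P {1..<a}) (Q # map R (rev [1..<b])) ! k"
      by (metis in_set_conv_nth)
    hence kb: "k < b" using assms by simp
    have t: "take k (rev [1..<b]) = rev [b - k..<b]"
      using kb by (simp add: take_rev drop_upt Suc_diff_Suc[symmetric] del: upt_Suc)
    have "z = prod P {1..<a} * (Q * prod_list (map R (rev [b - k..<b])))"
      using k partial_prods_nth[of k "Q # map R (rev [1..<b])" "prod P {1..<a}"]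
      unfolding t[symmetric] by (simp add: take_map del: partial_prods.simps)
    also have "prod_list (map R (rev [b - k..<b])) = prod R {b - k..<b}"
      using prod.distinct_set_conv_list[of "rev [b - k..<b]" R] by simp
    finally have "z = Qacc a b P Q R (a + 1 + k)"
      using kb by (simp add: Qacc_def mult.assoc Suc_diff_Suc)
    moreover have "a + 1 + k \<in> {1..a + b}" using kb by simp
    ultimately show "z \<in> Qacc a b P Q R ` {1..a + b}" by blast
  qed
qed

lemma Qacc_nonzero:
  assumes "\<forall>i\<in>{1..<a}. P i \<noteq> 0" "Q \<noteq> 0" "\<forall>j\<in>{1..<b}. R j \<noteq> 0"
  shows "Qacc a b P Q R k \<noteq> 0"
  using assms by (auto simp: Qacc_def)

section \<open>Products of dilated series\<close>

definition dil_prod :: "complex fps \<Rightarrow> complex list \<Rightarrow> complex fps" where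
  "dil_prod F zs = prod_list (map (\<lambda>z. fps_dil z F) zs)"

lemma dil_prod_simps [simp]:
  "dil_prod F [] = 1" "dil_prod F (z # zs) = fps_dil z F * dil_prod F zs"
  by (simp_all add: dil_prod_def)

lemma dil_prod_inverse: "F * Fi = 1 \<Longrightarrow> dil_prod F zs * dil_prod Fi zs = 1"
proof (induction zs)
  case (Cons z zs)
  have "dil_prod F (z # zs) * dil_prod Fi (z # zs) = fps_dil z (F * Fi) * (dil_prod F zs * dil_prod Fi zs)"
    by (simp add: fps_dil_mult mult_ac)
  thus ?case using Cons by simp
qed simp

lemma dil_prod_nth_0: "fps_nth F 0 = 1 \<Longrightarrow> fps_nth (dil_prod F zs) 0 = 1"
  by (induction zs) auto

lemma fps_summable_dil_prod:
  "(\<And>z. z \<in> set zs \<Longrightarrow> fps_summable (norm z * r) F) \<Longrightarrow> r \<ge> 0 \<Longrightarrow> fps_summable r (dil_prod F zs)"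
  unfolding dil_prod_def by (rule fps_summable_prod_list) (auto simp: fps_summable_dil)

lemma dil_prod_ratio:
  assumes "fps_dil c F = (1 - fps_const d * fps_X) * F"
  shows "fps_dil c (dil_prod F zs) =
    prod_list (map (\<lambda>z. 1 - fps_const (z * d) * fps_X) zs) * dil_prod F zs"
proof (induction zs)
  case (Cons z zs)
  have "fps_dil c (fps_dil z F) = fps_dil z (fps_dil c F)"
    by (simp add: fps_dil_dil mult.commute)
  also have "\<dots> = (1 - fps_const (z * d) * fps_X) * fps_dil z F"
    unfolding assms fps_dil_mult fps_dil_linear ..
  finally show ?case using Cons by (simp add: fps_dil_mult mult_ac)
qed simp

lemma dil_prod_ratio':
  assumes "F = (1 - fps_const d * fps_X) * fps_dil c F"
  shows "dil_prod F zs =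
    prod_list (map (\<lambda>z. 1 - fps_const (z * d) * fps_X) zs) * fps_dil c (dil_prod F zs)"
proof (induction zs)
  case (Cons z zs)
  let ?l = "1 - fps_const (z * d) * fps_X"
  let ?p = "prod_list (map (\<lambda>z. 1 - fps_const (z * d) * fps_X) zs)"
  have "fps_dil z F = fps_dil z ((1 - fps_const d * fps_X) * fps_dil c F)"
    using assms by simp
  also have "\<dots> = ?l * fps_dil c (fps_dil z F)"
    unfolding fps_dil_mult fps_dil_linear fps_dil_dil by (simp only: mult.commute)
  finally have 1: "fps_dil z F = ?l * fps_dil c (fps_dil z F)" .
  have "dil_prod F (z # zs) = (?l * fps_dil c (fps_dil z F)) * (?p * fps_dil c (dil_prod F zs))"
    using 1 Cons by simp
  also have "\<dots> = (?l * ?p) * fps_dil c (dil_prod F (z # zs))"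
    by (simp only: fps_dil_mult dil_prod_simps mult_ac)
  finally show ?case by simp
qed simp

text \<open>In terms of \<Lambda> this is
  \<open>1 - w \<Lambda>^(-1) = \<Lambda>^(-1) (\<Lambda> - w)\<close>.\<close>

lemma dn_seq_linear: "dn_seq (1 - fps_const w * fps_X) = shift (- 1) (up_seq (fps_X - fps_const w))"
  by (auto simp: dn_seq_def shift_def up_seq_def fun_eq_iff fps_X_def nat_add_distrib)

section \<open>Band polynomials from the functional equations\<close>

context nome
begin

text \<open>The sign \<open>\<sigma> = 1\<close> belongs to \<open>Gam\<close>,
  \<open>\<sigma> = - 1\<close> to \<open>Gam'\<close>. Evaluated at \<open>\<Lambda>^(-1)\<close>,
  the polynomial has its roots in \<Lambda> at \<open>z * (\<sigma> / sq)\<close>.\<close>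

definition lin_prod :: "complex \<Rightarrow> complex list \<Rightarrow> complex fps" where
  "lin_prod \<sigma> zs = prod_list (map (\<lambda>z. 1 - fps_const (z * (\<sigma> / sq)) * fps_X) zs)"

definition rev_prod :: "complex \<Rightarrow> complex list \<Rightarrow> complex fps" where
  "rev_prod \<sigma> zs = prod_list (map (\<lambda>z. fps_X - fps_const (z * (\<sigma> / sq))) zs)"

definition rev_const :: "complex \<Rightarrow> complex list \<Rightarrow> complex" where
  "rev_const \<sigma> zs = prod_list (map (\<lambda>z. - \<sigma> * sq / z) zs)"

lemma dn_seq_lin_prod: "dn_seq (lin_prod \<sigma> zs) = shift (- int (length zs)) (up_seq (rev_prod \<sigma> zs))"
proof (induction zs)
  case Nil show ?case by (simp add: lin_prod_def rev_prod_def dn_seq_one up_seq_one)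
next
  case (Cons z zs)
  have "dn_seq (lin_prod \<sigma> (z # zs)) =
      conv (dn_seq (1 - fps_const (z * (\<sigma> / sq)) * fps_X)) (dn_seq (lin_prod \<sigma> zs))"
    by (simp add: conv_dn_seq lin_prod_def)
  also have "\<dots> = shift (- int (length zs) + - 1) (up_seq (rev_prod \<sigma> (z # zs)))"
    unfolding Cons dn_seq_linear conv_shift_left conv_shift_right shift_shift conv_up_seq
    by (simp add: rev_prod_def)
  also have "- int (length zs) + - 1 = - int (length (z # zs))" by simp
  finally show ?case .
qed

lemma rev_prod_nth_0: "\<sigma> \<noteq> 0 \<Longrightarrow> 0 \<notin> set zs \<Longrightarrow> fps_nth (rev_prod \<sigma> zs) 0 \<noteq> 0"
  using sq_nz by (induction zs) (auto simp: rev_prod_def)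

lemma rev_const_nonzero: "\<sigma> \<noteq> 0 \<Longrightarrow> 0 \<notin> set zs \<Longrightarrow> rev_const \<sigma> zs \<noteq> 0"
  using sq_nz by (induction zs) (auto simp: rev_const_def)

text \<open>By \<open>\<sigma> * \<sigma> = 1\<close> the numbers \<open>\<sigma> * sq / z\<close>
  and \<open>z * (\<sigma> / sq)\<close> are inverse to each other. The linear factor of the upward
  series thus has the same root in \<Lambda> as that of the downward series, so one band matrix fits
  both triangular factors.\<close>

lemma linear_rev:
  assumes "z \<noteq> 0" "\<sigma> * \<sigma> = 1"
  shows "1 - fps_const (inverse z * (\<sigma> * sq)) * fps_X =
    fps_const (- \<sigma> * sq / z) * (fps_X - fps_const (z * (\<sigma> / sq)))"
proof -
  have "\<sigma> * sq / z * (z * (\<sigma> / sq)) = 1" using assms sq_nz by (simp add: field_simps)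
  hence "fps_const (\<sigma> * sq / z) * fps_const (z * (\<sigma> / sq)) = 1"
    by (simp only: fps_const_mult fps_const_1_eq_1)
  thus ?thesis
    by (simp add: right_diff_distrib divide_inverse mult_ac flip: fps_const_neg)
qed

lemma prod_linear_rev:
  assumes "\<sigma> * \<sigma> = 1" "0 \<notin> set zs"
  shows "prod_list (map (\<lambda>z. 1 - fps_const (z * (\<sigma> * sq)) * fps_X) (map inverse zs)) =
    fps_const (rev_const \<sigma> zs) * rev_prod \<sigma> zs"
  using assms(2)
proof (induction zs)
  case (Cons z zs)
  let ?c = "fps_const (- \<sigma> * sq / z)" and ?l = "fps_X - fps_const (z * (\<sigma> / sq))"
  have "prod_list (map (\<lambda>z. 1 - fps_const (z * (\<sigma> * sq)) * fps_X) (map inverse (z # zs))) =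
      (?c * ?l) * (fps_const (rev_const \<sigma> zs) * rev_prod \<sigma> zs)"
    using Cons linear_rev[OF _ assms(1), of z] by simp
  also have "\<dots> = (?c * fps_const (rev_const \<sigma> zs)) * (?l * rev_prod \<sigma> zs)"
    by (simp only: mult_ac)
  finally show ?case by (simp add: rev_const_def rev_prod_def)
qed (simp add: rev_const_def rev_prod_def)

lemma sq_div_q: "sq / q = inverse sq"
  using sq_nz by (simp add: field_simps flip: sq_sq)

lemma Gam_inv_lin: "fps_dil (inverse q) Gam_inv = (1 - fps_const (1 / sq) * fps_X) * Gam_inv"
proof -
  have "fps_dil (inverse q) Gam_inv =
      fps_dil (inverse q) ((1 - fps_const sq * fps_X) * fps_dil q Gam_inv)"
    using Gam_inv_dil by simp
  also have "\<dots> = (1 - fps_const (inverse q * sq) * fps_X) * Gam_inv"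
    unfolding fps_dil_mult fps_dil_linear by (simp add: fps_dil_dil q_nz)
  also have "inverse q * sq = 1 / sq" using sq_div_q by (simp add: divide_inverse mult.commute)
  finally show ?thesis .
qed

lemma Gam'_inv_lin: "Gam'_inv = (1 - fps_const (- 1 / sq) * fps_X) * fps_dil (inverse q) Gam'_inv"
proof -
  have "Gam'_inv = fps_dil (inverse q) (fps_dil q Gam'_inv)" by (simp add: fps_dil_dil q_nz)
  also have "fps_dil q Gam'_inv = (1 - fps_const (- sq) * fps_X) * Gam'_inv"
    using Gam'_inv_dil by (simp flip: fps_const_neg)
  also have "fps_dil (inverse q) \<dots> =
      (1 - fps_const (inverse q * - sq) * fps_X) * fps_dil (inverse q) Gam'_inv"
    unfolding fps_dil_mult fps_dil_linear ..
  also have "inverse q * - sq = - 1 / sq" using sq_div_q by (simp add: divide_inverse mult.commute)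
  finally show ?thesis .
qed

lemma Gam_lin: "fps_dil q Gam = (1 - fps_const (1 * sq) * fps_X) * Gam"
  by (simp add: Gam_dil)

lemma Gam'_lin: "Gam' = (1 - fps_const (- 1 * sq) * fps_X) * fps_dil q Gam'"
  using Gam'_dil by (simp flip: fps_const_neg)

lemma fps_summable_Gam_inv: "s \<ge> 0 \<Longrightarrow> fps_summable s Gam_inv"
  by (simp add: fps_summable_dil fps_summable_Gam')

lemma fps_summable_Gam'_inv: "norm sq * s < 1 \<Longrightarrow> s \<ge> 0 \<Longrightarrow> fps_summable s Gam'_inv"
  by (simp add: fps_summable_dil fps_summable_Gam)

text \<open>Downward series require \<open>|sq| |z| < r\<close>, upward ones
  \<open>|sq| r < |z|\<close>. A common \<open>r\<close> lies between \<open>|sq| max |z|\<close>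
  and \<open>min |z| / |sq|\<close>, an interval that is nonempty by the quotient bound for the two
  extreme elements.\<close>

lemma radius_exists:
  fixes Z :: "complex set"
  assumes "finite Z" "Z \<noteq> {}" "0 \<notin> Z" "\<forall>z\<in>Z. \<forall>w\<in>Z. norm (z / w) < inverse (norm q)"
  obtains r where "r > 0" "\<And>z. z \<in> Z \<Longrightarrow> norm sq * norm z < r \<and> norm sq * r < norm z"
proof -
  define M m where "M = Max (norm ` Z)" and "m = Min (norm ` Z)"
  have "M \<in> norm ` Z" "m \<in> norm ` Z" unfolding M_def m_def using assms by auto
  then obtain z w where z: "z \<in> Z" "M = norm z" and w: "w \<in> Z" "m = norm w" by auto
  have pos: "norm sq > 0" "norm q > 0" "m > 0" using sq_nz q_nz w assms by auto
  have "norm (z / w) < inverse (norm q)" using assms(4) z w by blast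
  hence "M / m < inverse (norm q)" by (simp add: z w norm_divide)
  hence "norm q * M < m" using pos by (simp add: field_simps)
  hence "norm sq * M < m / norm sq" using pos norm_sq by (simp add: field_simps power2_eq_square)
  then obtain r where r: "norm sq * M < r" "r < m / norm sq" using dense by blast
  have "M > 0" using z assms by auto
  hence "r > 0" using r pos by (meson less_trans mult_pos_pos)
  moreover have "norm sq * norm z < r \<and> norm sq * r < norm z" if "z \<in> Z" for z
  proof
    have "norm z \<le> M" "m \<le> norm z" unfolding M_def m_def using that assms by auto
    thus "norm sq * norm z < r" using r pos by (meson le_less_trans mult_left_mono less_imp_le)
    have "norm sq * r < m" using r pos by (simp add: field_simps)
    thus "norm sq * r < norm z" using \<open>m \<le> norm z\<close> by simp
  qed
  ultimately show thesis using that by blast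
qed

text \<open>The alternative \<open>shifted\<close> reflects the sign of the second Gaussian. One
  sign enlarges the circle by arbitrary amounts and calls for an entire \<open>Fi\<close>; the other
  shrinks it, and summability at radius \<open>r\<close> is enough.\<close>

lemma model_data_instance:
  assumes zs: "length zs1 \<ge> 1" "length zs2 \<ge> 1" "0 \<notin> set zs1 \<union> set zs2"
    and r: "r > 0" "\<And>z. z \<in> set zs1 \<union> set zs2 \<Longrightarrow> norm sq * norm z < r \<and> norm sq * r < norm z"
    and y: "y \<noteq> 0"
    and F: "F * Fi = 1" "fps_nth F 0 = 1"
    and sm: "\<And>s. s \<ge> 0 \<Longrightarrow> norm sq * s < 1 \<Longrightarrow> fps_summable s F"
      "\<And>s. s \<ge> 0 \<Longrightarrow> norm sq * s < 1 \<Longrightarrow> fps_summable s Fi"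
    and shifted: "(\<forall>s\<ge>0. fps_summable s Fi) \<or> (\<forall>l::nat. 1 \<le> norm (exp (2 * cb * of_nat l * lq)))"
  shows "model_data q lq (length zs1) (length zs2) r y cb
    (dil_prod Gam zs1) (dil_prod F zs2) (dil_prod Gam_inv zs1) (dil_prod Fi zs2)
    (dil_prod Gam (map inverse zs1)) (dil_prod F (map inverse zs2))
    (dil_prod Gam_inv (map inverse zs1)) (dil_prod Fi (map inverse zs2))
    (lin_prod 1 zs1) (lin_prod \<sigma> zs2) (rev_prod 1 zs1) (inverse (rev_prod 1 zs1)) (rev_prod \<sigma> zs2)
    (rev_const 1 zs1)"
proof
  show "length zs1 \<ge> 1" "length zs2 \<ge> 1" "r > 0" "y \<noteq> 0" by fact+
  have GG: "Gam_inv * Gam = 1" using Gam_Gam_inv by (simp add: mult.commute)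
  have FF: "Fi * F = 1" using F by (simp add: mult.commute)
  have F0: "fps_nth Fi 0 = 1" using arg_cong[OF FF, of "\<lambda>F. fps_nth F 0"] F by simp
  have G0: "fps_nth Gam 0 = 1" "fps_nth Gam_inv 0 = 1" using Gam_ser_rec Gam'_ser_rec by simp_all
  show "dil_prod Gam_inv zs1 * dil_prod Gam zs1 = 1" "dil_prod Fi zs2 * dil_prod F zs2 = 1"
    "dil_prod Gam (map inverse zs1) * dil_prod Gam_inv (map inverse zs1) = 1"
    "dil_prod F (map inverse zs2) * dil_prod Fi (map inverse zs2) = 1"
    using GG FF Gam_Gam_inv F(1) by (simp_all add: dil_prod_inverse)
  show "fps_nth (dil_prod Gam_inv zs1) 0 = 1" "fps_nth (dil_prod Fi zs2) 0 = 1"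
    using G0 F0 by (simp_all add: dil_prod_nth_0)
  show "dn_seq (lin_prod 1 zs1) = shift (- int (length zs1)) (up_seq (rev_prod 1 zs1))"
    "dn_seq (lin_prod \<sigma> zs2) = shift (- int (length zs2)) (up_seq (rev_prod \<sigma> zs2))"
    by (rule dn_seq_lin_prod)+
  show "rev_prod 1 zs1 * inverse (rev_prod 1 zs1) = 1"
    using rev_prod_nth_0[of 1 zs1] zs by (simp add: inverse_mult_eq_1')
  show "fps_dil (inverse q) (dil_prod Gam_inv zs1) = lin_prod 1 zs1 * dil_prod Gam_inv zs1"
    unfolding lin_prod_def by (rule dil_prod_ratio[OF Gam_inv_lin])
  show "fps_dil q (dil_prod Gam (map inverse zs1)) =
      fps_const (rev_const 1 zs1) * rev_prod 1 zs1 * dil_prod Gam (map inverse zs1)"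
    using zs dil_prod_ratio[OF Gam_lin] prod_linear_rev[of 1 zs1] by simp
  show "rev_const 1 zs1 \<noteq> 0" using zs by (intro rev_const_nonzero) auto
  have d: "norm z * inverse r \<ge> 0" "norm sq * (norm z * inverse r) < 1" "r * inverse (norm z) \<ge> 0"
      "norm sq * (r * inverse (norm z)) < 1" if "z \<in> set zs1 \<union> set zs2" for z
  proof -
    have "z \<noteq> 0" using that zs(3) by auto
    thus "norm z * inverse r \<ge> 0" "norm sq * (norm z * inverse r) < 1" "r * inverse (norm z) \<ge> 0"
      "norm sq * (r * inverse (norm z)) < 1"
      using r(2)[OF that] r(1) by (simp_all add: field_simps)
  qed
  have ir: "inverse r \<ge> 0" "r \<ge> 0" using r by simp_all
  have G: "fps_summable s Gam" "fps_summable s Gam_inv" if "s \<ge> 0" "norm sq * s < 1" for s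
    using that by (auto intro: fps_summable_Gam fps_summable_Gam_inv)
  have dn: "fps_summable (inverse r) (dil_prod H zs)"
    if "set zs \<subseteq> set zs1 \<union> set zs2" "\<And>s. s \<ge> 0 \<Longrightarrow> norm sq * s < 1 \<Longrightarrow> fps_summable s H" for H zs
    using that d ir by (intro fps_summable_dil_prod) blast+
  have up: "fps_summable r (dil_prod H (map inverse zs))"
    if sub: "set zs \<subseteq> set zs1 \<union> set zs2"
      and H: "\<And>s. s \<ge> 0 \<Longrightarrow> norm sq * s < 1 \<Longrightarrow> fps_summable s H" for H zs
  proof (rule fps_summable_dil_prod)
    fix z assume "z \<in> set (map inverse zs)"
    then obtain w where "w \<in> set zs1 \<union> set zs2" "z = inverse w" using sub by auto
    thus "fps_summable (norm z * r) H"
      using H[OF d(3,4)] by (simp add: norm_inverse mult.commute)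
  qed (use ir in auto)
  show "fps_summable (inverse r) (dil_prod Gam zs1 * dil_prod F zs2)"
    "fps_summable (inverse r) (dil_prod Gam_inv zs1 * dil_prod Fi zs2)"
    using G sm ir by (auto intro!: fps_summable_mult dn)
  show "fps_summable r (dil_prod Gam (map inverse zs1) * dil_prod F (map inverse zs2))"
    using G sm ir by (auto intro!: fps_summable_mult up)
  show up_inv: "fps_summable r (dil_prod Gam_inv (map inverse zs1) * dil_prod Fi (map inverse zs2))"
    using G sm ir by (auto intro!: fps_summable_mult up)
  show "fps_summable (r / norm (exp (2 * cb * of_nat l * lq)))
      (dil_prod Gam_inv (map inverse zs1) * dil_prod Fi (map inverse zs2))" for l
    using shifted
  proof
    assume all: "\<forall>s\<ge>0. fps_summable s Fi"
    have "fps_summable t (dil_prod Gam_inv (map inverse zs1) * dil_prod Fi (map inverse zs2))"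
      if "t \<ge> 0" for t
      by (intro fps_summable_mult fps_summable_dil_prod fps_summable_Gam_inv all[rule_format]
            mult_nonneg_nonneg norm_ge_zero that)
    thus ?thesis using ir by simp
  next
    assume *: "\<forall>l::nat. 1 \<le> norm (exp (2 * cb * of_nat l * lq))"
    have "r / t \<le> r" if "1 \<le> t" for t
      using r(1) that by (simp add: divide_le_eq mult_le_cancel_left1)
    note le = this[OF *[rule_format]]
    show ?thesis
      by (rule fps_summable_mono[OF up_inv _ le]) (intro divide_nonneg_nonneg ir norm_ge_zero)
  qed
qed

lemma generating_matrix:
  fixes F :: "complex fps"
  assumes ab: "a \<ge> 1" "b \<ge> 1" and nz: "Q \<noteq> 0" "\<forall>i\<in>{1..<a}. P i \<noteq> 0" "\<forall>j\<in>{1..<b}. R j \<noteq> 0"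
    and zs: "zs1 = partial_prods 1 (1 # map P [1..<a])"
      "zs2 = partial_prods (prod P {1..<a}) (Q # map R (rev [1..<b]))"
    and y: "y = prod P {1..<a} * (Q * prod_list (map R (rev [1..<b])))"
    and r: "r > 0" "\<And>z. z \<in> set zs1 \<union> set zs2 \<Longrightarrow> norm sq * norm z < r \<and> norm sq * r < norm z"
    and sm: "\<And>s. s \<ge> 0 \<Longrightarrow> norm sq * s < 1 \<Longrightarrow> fps_summable s F"
  shows "mprod ([mdiag e] @ [ser_down Gam, ser_up Gam]
       @ concat (map (\<lambda>i. pow_Delta (P i) # [ser_down Gam, ser_up Gam]) [1..<a])
       @ (pow_Delta Q # [ser_down F, ser_up F])
       @ concat (map (\<lambda>j. pow_Delta (R j) # [ser_down F, ser_up F]) (rev [1..<b]))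
       @ [mdiag d]) =
    toep e (conv (dn_seq (dil_prod Gam zs1 * dil_prod F zs2))
        (up_seq (dil_prod Gam (map inverse zs1) * dil_prod F (map inverse zs2))))
      (\<lambda>j. y powi j * d j)"
proof -
  \<comment> \<open>The first vertex pair has no power in front of it; inserting
    \<open>1^\<Delta>\<close>, the unit matrix, makes all blocks uniform.\<close>
  define us where "us = map (\<lambda>u. (u, Gam)) (1 # map P [1..<a]) @ map (\<lambda>u. (u, F)) (Q # map R (rev [1..<b]))"
  have one: "mmul (pow_Delta 1) A = A" for A
    by (simp add: pow_Delta_def mmul_mdiag_left)
  have fst_us: "map fst us = (1 # map P [1..<a]) @ (Q # map R (rev [1..<b]))"
    by (simp add: us_def o_def)
  have snd_us: "map snd us = replicate (length zs1) Gam @ replicate (length zs2) F"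
    by (simp add: us_def zs o_def map_replicate_const)
  have pl: "prod_list (1 # map P [1..<a]) = prod P {1..<a}"
    using prod_list_upt[of P 1 a] by simp
  have zip: "zip (partial_prods 1 (map fst us)) (map snd us) =
      map (\<lambda>z. (z, Gam)) zs1 @ map (\<lambda>z. (z, F)) zs2"
    unfolding fst_us partial_prods_append snd_us pl zs[symmetric] mult_1_left
    by (simp add: zip_append zs) (simp add: zip_replicate2)
  have zz: "\<forall>(z, H)\<in>set (map (\<lambda>z. (z, Gam)) zs1 @ map (\<lambda>z. (z, F)) zs2).
      fps_summable (norm z / r) H \<and> fps_summable (r / norm z) H"
  proof -
    have "norm z / r \<ge> 0 \<and> norm sq * (norm z / r) < 1 \<and> r / norm z \<ge> 0 \<and> norm sq * (r / norm z) < 1"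
      if "z \<in> set zs1 \<union> set zs2" for z
    proof -
      have "norm z > 0" using r(2)[OF that] r(1) sq_nz
        by (smt (verit) mult_pos_pos zero_less_norm_iff)
      thus ?thesis using r(2)[OF that] r(1) by (simp add: field_simps)
    qed
    thus ?thesis using sm fps_summable_Gam by auto
  qed
  have "mprod ([ser_down Gam, ser_up Gam]
       @ concat (map (\<lambda>i. pow_Delta (P i) # [ser_down Gam, ser_up Gam]) [1..<a])
       @ (pow_Delta Q # [ser_down F, ser_up F])
       @ concat (map (\<lambda>j. pow_Delta (R j) # [ser_down F, ser_up F]) (rev [1..<b]))
       @ [mdiag d]) = mprod (concat (map block us) @ [mdiag d])"
    by (simp add: us_def block_def one o_def)
  also have "\<dots> = toep (\<lambda>i. 1) (ordered_seq (map (\<lambda>z. (z, Gam)) zs1 @ map (\<lambda>z. (z, F)) zs2))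
      (\<lambda>j. y powi j * d j)"
  proof -
    have "\<forall>(u, H)\<in>set us. u \<noteq> 0" using nz by (auto simp: us_def)
    from mprod_blocks[of 1 us d, OF _ this] show ?thesis
      unfolding zip by (simp add: fst_us y prod_list_upt[of P 1 a, simplified])
  qed
  also have "ordered_seq (map (\<lambda>z. (z, Gam)) zs1 @ map (\<lambda>z. (z, F)) zs2) =
      conv (dn_seq (dil_prod Gam zs1 * dil_prod F zs2))
        (up_seq (dil_prod Gam (map inverse zs1) * dil_prod F (map inverse zs2)))"
    unfolding ordered_seq_eq[OF r(1) zz] by (simp add: dil_prod_def o_def)
  finally show ?thesis by (simp add: mmul_mdiag_left) (simp add: toep_def mult.assoc)
qed

end

theorem theorem3:
  fixes a b :: nat and q lq Q :: complex and P R :: "nat \<Rightarrow> complex"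
  assumes "a \<ge> 1" and "b \<ge> 1"
    and "exp lq = q" and "0 < cmod q" and "cmod q < 1"
    and "Q \<noteq> 0" and "\<forall>i\<in>{1..<a}. P i \<noteq> 0" and "\<forall>j\<in>{1..<b}. R j \<noteq> 0"
    and "\<forall>k\<in>{1..a + b}. \<forall>l\<in>{1..a + b}.
           cmod (Qacc a b P Q R k / Qacc a b P Q R l) < inverse (cmod q)"
  shows
    "(\<exists>L Li. toda_solution_from (U_first a b lq P Q R) L Li \<and>
       (\<exists>D B C. D \<noteq> 0 \<and> B_form a B \<and> C_form b C \<and>
          tpow L a = tscale (inverse D) (tpow Li b) \<and>
          tscale (inverse D) (tpow Li b) = tmul B C)) \<and>
     (\<exists>L Li. toda_solution_from (U_second a b lq P Q R) L Li \<and>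
       (\<exists>D B C Bi Ci. D \<noteq> 0 \<and> B_form a B \<and> C_form b C \<and>
          upper_inverse B Bi \<and> lower_inverse C Ci \<and>
          tpow L a = tmul B Ci \<and>
          tpow Li b = tscale D (tmul C Bi)))"
proof -
  interpret nome q lq by unfold_locales (use assms in auto)
  define zs1 zs2 where "zs1 = partial_prods 1 (1 # map P [1..<a])"
    and "zs2 = partial_prods (prod P {1..<a}) (Q # map R (rev [1..<b]))"
  define y where "y = prod P {1..<a} * (Q * prod_list (map R (rev [1..<b])))"
  have y: "y \<noteq> 0" using assms(6-8) by (auto simp: y_def prod_list_zero_iff)
  have Z: "set zs1 \<union> set zs2 \<subseteq> Qacc a b P Q R ` {1..a + b}"
    using partial_prods_Qacc[OF assms(1,2)] by (simp add: zs1_def zs2_def)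
  have len: "length zs1 = a" "length zs2 = b" using assms(1,2) by (simp_all add: zs1_def zs2_def)
  have zs0: "0 \<notin> set zs1 \<union> set zs2" using Z Qacc_nonzero[OF assms(7,6,8)] by fastforce
  have "\<forall>z\<in>set zs1 \<union> set zs2. \<forall>w\<in>set zs1 \<union> set zs2. norm (z / w) < inverse (norm q)"
    using Z assms(9) by blast
  moreover have "set zs1 \<union> set zs2 \<noteq> {}" using len assms(1) by auto
  ultimately obtain r where r: "r > 0"
    "\<And>z. z \<in> set zs1 \<union> set zs2 \<Longrightarrow> norm sq * norm z < r \<and> norm sq * r < norm z"
    using radius_exists[of "set zs1 \<union> set zs2"] zs0 by blast
  have l: "length zs1 \<ge> 1" "length zs2 \<ge> 1" using len assms by simp_all
  have smG: "fps_summable s Gam" "fps_summable s Gam_inv" "fps_summable s Gam'" "fps_summable s Gam'_inv"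
    if "s \<ge> 0" "norm sq * s < 1" for s
    using that by (auto intro: fps_summable_Gam fps_summable_Gam_inv fps_summable_Gam' fps_summable_Gam'_inv)
  note gen = generating_matrix[OF assms(1,2,6-8) zs1_def zs2_def y_def r(1)]
  let ?cb = "1 / (2 * of_nat b) :: complex" and ?cb' = "- 1 / (2 * of_nat b) :: complex"

  \<comment> \<open>The positive second Gaussian enlarges the circles, but \<open>Gam_inv\<close> is
    entire, so the first alternative of \<open>shifted\<close> holds.\<close>
  have "model_data q lq (length zs1) (length zs2) r y ?cb
    (dil_prod Gam zs1) (dil_prod Gam zs2) (dil_prod Gam_inv zs1) (dil_prod Gam_inv zs2)
    (dil_prod Gam (map inverse zs1)) (dil_prod Gam (map inverse zs2))
    (dil_prod Gam_inv (map inverse zs1)) (dil_prod Gam_inv (map inverse zs2))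
    (lin_prod 1 zs1) (lin_prod 1 zs2) (rev_prod 1 zs1) (inverse (rev_prod 1 zs1)) (rev_prod 1 zs2)
    (rev_const 1 zs1)"
    by (rule model_data_instance[OF l zs0 r y Gam_Gam_inv Gam_ser_rec(1) smG(1,2)])
       (auto intro: fps_summable_Gam_inv)
  then interpret F: model_data q lq a b r y ?cb
    "dil_prod Gam zs1" "dil_prod Gam zs2" "dil_prod Gam_inv zs1" "dil_prod Gam_inv zs2"
    "dil_prod Gam (map inverse zs1)" "dil_prod Gam (map inverse zs2)"
    "dil_prod Gam_inv (map inverse zs1)" "dil_prod Gam_inv (map inverse zs2)"
    "lin_prod 1 zs1" "lin_prod 1 zs2" "rev_prod 1 zs1" "inverse (rev_prod 1 zs1)" "rev_prod 1 zs2"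
    "rev_const 1 zs1" unfolding len .
  have "U_first a b lq P Q R = F.U"
    unfolding U_first_def Let_def qpow_Delta_sq_def F.U_def F.Fm_def F.Fp_def F.ea_def[abs_def] F.eb_def[abs_def]
    by (rule gen) (use r(2) smG(1) in blast)+
  moreover have rev: "fps_dil q (dil_prod Gam (map inverse zs2)) =
      fps_const (rev_const 1 zs2) * rev_prod 1 zs2 * dil_prod Gam (map inverse zs2)"
    using zs0 dil_prod_ratio[OF Gam_lin] prod_linear_rev[of 1 zs2] by simp
  moreover note F.bigraded_model[OF refl dil_prod_ratio[OF Gam_inv_lin, folded lin_prod_def] rev
      rev_const_nonzero]
  ultimately have first: "\<exists>L Li. toda_solution_from (U_first a b lq P Q R) L Li \<and>
       (\<exists>D B C. D \<noteq> 0 \<and> B_form a B \<and> C_form b C \<and>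
          tpow L a = tscale (inverse D) (tpow Li b) \<and>
          tscale (inverse D) (tpow Li b) = tmul B C)"
    using zs0 by simp

  \<comment> \<open>The negative second Gaussian leaves the base \<open>q^(-l/b)\<close>, of modulus
    at least 1 because \<open>Re lq < 0\<close>; so the circles only shrink.\<close>
  have growth: "1 \<le> norm (exp (2 * ?cb' * of_nat l * lq))" for l :: nat
  proof -
    have "exp (Re lq) = norm q" using assms(3) by (metis norm_exp_eq_Re)
    hence "Re lq < 0" using assms(5) by (metis exp_less_one_iff)
    hence "0 \<le> (real l / real b) * (- Re lq)" by (intro mult_nonneg_nonneg) auto
    moreover have "2 * ?cb' * of_nat l * lq = complex_of_real (- (real l / real b)) * lq" by simp
    hence "Re (2 * ?cb' * of_nat l * lq) = - (real l / real b) * Re lq"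
      by (simp only: Re_complex_of_real Im_complex_of_real times_complex.sel mult_zero_left diff_zero)
    ultimately show ?thesis by (simp add: norm_exp_eq_Re)
  qed
  have "model_data q lq (length zs1) (length zs2) r y ?cb'
    (dil_prod Gam zs1) (dil_prod Gam' zs2) (dil_prod Gam_inv zs1) (dil_prod Gam'_inv zs2)
    (dil_prod Gam (map inverse zs1)) (dil_prod Gam' (map inverse zs2))
    (dil_prod Gam_inv (map inverse zs1)) (dil_prod Gam'_inv (map inverse zs2))
    (lin_prod 1 zs1) (lin_prod (- 1) zs2) (rev_prod 1 zs1) (inverse (rev_prod 1 zs1)) (rev_prod (- 1) zs2)
    (rev_const 1 zs1)"
    by (rule model_data_instance[OF l zs0 r y Gam'_Gam'_inv Gam'_ser_rec(1) smG(3,4)])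
       (use growth in auto)
  then interpret S: model_data q lq a b r y ?cb'
    "dil_prod Gam zs1" "dil_prod Gam' zs2" "dil_prod Gam_inv zs1" "dil_prod Gam'_inv zs2"
    "dil_prod Gam (map inverse zs1)" "dil_prod Gam' (map inverse zs2)"
    "dil_prod Gam_inv (map inverse zs1)" "dil_prod Gam'_inv (map inverse zs2)"
    "lin_prod 1 zs1" "lin_prod (- 1) zs2" "rev_prod 1 zs1" "inverse (rev_prod 1 zs1)" "rev_prod (- 1) zs2"
    "rev_const 1 zs1" unfolding len .
  have "U_second a b lq P Q R = S.U"
    unfolding U_second_def Let_def qpow_Delta_sq_def S.U_def S.Fm_def S.Fp_def S.ea_def[abs_def] S.eb_def[abs_def]
    by (rule gen) (use r(2) smG(3) in blast)+
  moreover have rev': "dil_prod Gam' (map inverse zs2) = fps_const (rev_const (- 1) zs2) *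
      rev_prod (- 1) zs2 * fps_dil q (dil_prod Gam' (map inverse zs2))"
    using prod_linear_rev[of "- 1" zs2] zs0 by (subst dil_prod_ratio'[OF Gam'_lin]) auto
  moreover note S.rational_model[OF refl dil_prod_ratio'[OF Gam'_inv_lin, folded lin_prod_def] rev'
      rev_const_nonzero]
  ultimately have second: "\<exists>L Li. toda_solution_from (U_second a b lq P Q R) L Li \<and>
       (\<exists>D B C Bi Ci. D \<noteq> 0 \<and> B_form a B \<and> C_form b C \<and>
          upper_inverse B Bi \<and> lower_inverse C Ci \<and>
          tpow L a = tmul B Ci \<and>
          tpow Li b = tscale D (tmul C Bi))"
    using zs0 by simp
  from first second show ?thesis by blast
qed

end
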